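(* Let $F_0\in\mathbb F_{\mathcal X}$, let $\phi$ be a weight function, and suppose that one of the following two sets of assumptions holds. (A) $\mathcal X$ is a Stonean vector lattice, i.e. $X\wedge Y,\ X\vee Y\in\mathcal X$ for all $X,Y\in\mathcal X$; $\rho:\mathcal X\to\mathbb R$ is a law-invariant coherent risk measure with associated distortion function $g_\rho$ such that $\lim_{k\to\infty}\rho(-(X-k)^+)=0$ for all nonnegative $X\in\mathcal X$ and $\lim_{t\downarrow0}g_\rho(t)=0$; there is a finite set $D(F_0)\subset\mathbb R$ such that $F_0$ is continuously differentiable with strictly positive derivative on $(F_0^{\rightarrow}(0),F_0^{\leftarrow}(1))\setminus D(F_0)$; and $\int_{F_0^{\rightarrow}(0)}^{F_0^{\leftarrow}(1)}\frac{g_\rho(\gamma F_0(x))}{F_0(x)\phi(x)}\,dx<\infty$ for some $\gamma\in(0,1)$. In this case let $\mathcal G_\rho$ be the representing set described in the context. (B) $\rho=\rho_g:\mathcal X\to\mathbb R$ is the distortion risk measure associated with a continuous concave distortion function $g$; the set of points $x\in(F_0^{\rightarrow}(0),F_0^{\leftarrow}(1))$ for which $g$ is not differentiable at $F_0(x)$ has Lebesgue measure zero; and $\int_{F_0^{\rightarrow}(0)}^{F_0^{\leftarrow}(1)}\frac{g(\gamma F_0(x))}{F_0(x)\phi(x)}\,dx<\infty$ for some $\gamma\in(0,1)$. In this case $g_\rho=g$ and $\mathcal G_\rho:=\{g\}$. Let $\widehat F_n:\Omega\to D$ be a map for every $n\in\mathbb N$, and assume: (a) $\widehat F_n$ takes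 values only in $\mathbb F_{\mathcal X}$ and is $(\mathcal F,\mathcal D)$-measurable, $n\in\mathbb N$. (b) $\widehat F_n-F_0$ takes values only in $D_{\phi,F_0}$, $n\in\mathbb N$. (c) There are a random element $B^\circ$ of $(D_{\phi,F_0},\mathcal D_{\phi,F_0})$, a $\|\cdot\|_\phi$-separable and $\mathcal D_{\phi,F_0}$-measurable subset $C\subset C_{\phi,F_0}$ with $\mathbb P[B^\circ\in C]=1$, and a nondecreasing sequence $(r_n)\subset(0,\infty)$ with $r_n\uparrow\infty$, such that $$r_n(\widehat F_n-F_0)\ \longrightarrow\ B^\circ\quad\text{in distribution in }(D_{\phi,F_0},\mathcal D_{\phi,F_0},\|\cdot\|_\phi).$$ Then $$r_n\big(\mathcal R_\rho(\widehat F_n)-\mathcal R_\rho(F_0)\big)\ \longrightarrow\ \dot{\mathcal R}_{\rho,F_0}(B^\circ)\quad\text{in distribution in }(\mathbb R,\mathcal B(\mathbb R)),$$ where $$\dot{\mathcal R}_{\rho,F_0}(v)=\lim_{\varepsilon\downarrow0}\ \sup_{h\in\mathcal G_\rho(F_0,\varepsilon)}\int_{F_0^{\rightarrow}(0)}^{F_0^{\leftarrow}(1)}h'(F_0(x))\,v(x)\,dx,\qquad v\in C_{\phi,F_0},$$ $\mathcal G_\rho(F_0,\varepsilon)$ is the set of all $h\in\mathcal G_\rho$ with $\mathcal R_\rho(F_0)-\varepsilon\le\mathcal R_h(F_0)$, and $h'$ is the right-sided derivative of $h$. If in addition $\int_{-\infty}^0 g_\rho(\delta F_0(x))\,dx<\infty$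 holds for some $\delta\in(0,1)$ (which is the case, for example, if the restriction of $F_0\phi$ to $(-\infty,0)$ is bounded), then $$\dot{\mathcal R}_{\rho,F_0}(v)=\sup_{h\in\mathcal G_\rho(F_0)}\int_{F_0^{\rightarrow}(0)}^{F_0^{\leftarrow}(1)}h'(F_0(x))\,v(x)\,dx,\qquad v\in C_{\phi,F_0},$$ where $\mathcal G_\rho(F_0)$ is the set of all $h\in\mathcal G_\rho$ with $\mathcal R_\rho(F_0)=\mathcal R_h(F_0)$.
   Context: $(\Omega,\mathcal F,\mathbb P)$ is an atomless probability space and $\mathcal X$ is a linear subspace of $L^1(\Omega,\mathcal F,\mathbb P)$ containing $L^\infty(\Omega,\mathcal F,\mathbb P)$. $F_X$ denotes the distribution function of $X$, and $\mathbb F_{\mathcal X}$ the set of distribution functions of elements of $\mathcal X$. For a distribution function $F$, $F^{\leftarrow}(s):=\inf\{x\in\mathbb R:F(x)\ge s\}$ and $F^{\rightarrow}(s):=\inf\{x\in\mathbb R:F(x)>s\}$ (values $\pm\infty$ possible). A map $\rho:\mathcal X\to\mathbb R$ is a coherent risk measure if it is monotone ($\rho(X)\ge\rho(Y)$ whenever $X\le Y$), cash-invariant ($\rho(X+m)=\rho(X)-m$ for $m\in\mathbb R$), subadditive and positively homogeneous ($\rho(\lambda X)=\lambda\rho(X)$, $\lambda\ge0$). It is law-invariant if $\rho(X)=\rho(Y)$ whenever $X,Y$ have the same law; then $\mathcal R_\rho:\mathbb F_{\mathcal X}\to\mathbb R$ is defined by $\mathcal R_\rho(F_X):=\rho(X)$.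 A distortion function is a nondecreasing $g:[0,1]\to[0,1]$ with $g(0)=0$, $g(1)=1$. For a concave distortion function $g$, the distortion risk measure is $\rho_g(X)=\int_{-\infty}^0 g(F_X(x))\,dx-\int_0^\infty(1-g(F_X(x)))\,dx$ for $X$ with $\int_0^\infty g(1-F_{|X|}(x))\,dx<\infty$ (writing $\rho_g:\mathcal X\to\mathbb R$ includes the requirement that all elements of $\mathcal X$ satisfy this), and $\mathcal R_g(F_X):=\rho_g(X)$. The map $\rho_g$ is a law-invariant coherent risk measure. The distortion function associated with $\rho$ is $g_\rho(t):=\rho(-B_{1,t})$, with $B_{1,t}$ Bernoulli with expectation $t\in[0,1]$. Under the assumptions on $\mathcal X$, $\rho$ and $g_\rho$ in (A) (Stonean vector lattice and the two limit conditions) there exists a set $\mathcal G_\rho$ of continuous concave distortion functions such that: (i) $\mathcal G_\rho$ is compact for the uniform metric; (ii) $g_\rho=\sup_{g\in\mathcal G_\rho}g$; (iii) $\sup_{g\in\mathcal G_\rho}g'(t)\le g_\rho(\gamma t)/(\gamma t)$ for all $\gamma,t\in(0,1)$ ($g'$ the right-sided derivative); (iv) $\rho(X)=\sup_{g\in\mathcal G_\rho}\rho_g(X)$ for all $X\in\mathcal X$; (v) for every $X\in\mathcal X$ the map $\mathcal G_\rho\to\mathbb R$, $g\mapsto\rho_g(X)$ is lower semicontinuous for the uniform metric, and continuous if $\int_{-\infty}^0g_\rho(\gamma F_X(x))\,dx<\infty$ for some $\gamma\in(0,1)$. Such a set is fixed and denoted $\mathcal G_\rho$. A weight function is a continuous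 function $\phi:\mathbb R\to[1,\infty)$ that is nonincreasing on $(-\infty,0]$ and nondecreasing on $[0,\infty)$. $D_\phi$ is the space of all càdlàg functions $v$ on $\mathbb R$ with $\|v\|_\phi:=\sup_{x}|v(x)\phi(x)|<\infty$; $D_{\phi,F_0}$ is the subspace of all $v\in D_\phi$ vanishing outside $[F_0^{\rightarrow}(0),F_0^{\leftarrow}(1)]$; $C_{\phi,F_0}$ is the set of all $v\in D_{\phi,F_0}$ whose discontinuity points in $(F_0^{\rightarrow}(0),F_0^{\leftarrow}(1))$ are discontinuity points of $F_0$. Both carry the norm $\|\cdot\|_\phi$. $D$ is the space of all bounded càdlàg functions on $\mathbb R$, $\mathcal D$ the $\sigma$-algebra on $D$ generated by the coordinate projections, and $\mathcal D_{\phi,F_0}:=\mathcal D\cap D_{\phi,F_0}$ the trace $\sigma$-algebra on $D_{\phi,F_0}$ (it coincides with the $\sigma$-algebra generated by the $\|\cdot\|_\phi$-balls). Convergence in distribution in $(D_{\phi,F_0},\mathcal D_{\phi,F_0},\|\cdot\|_\phi)$ is understood in the sense of Pollard and Shorack–Wellner: $\mathbb E[f(Y_n)]\to\mathbb E[f(Y)]$ for all bounded, $\|\cdot\|_\phi$-continuous and $\mathcal D_{\phi,F_0}$-measurable $f:D_{\phi,F_0}\to\mathbb R$. *)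

theory Defs
  imports "HOL-Probability.Probability"
begin

section \<open>Model spaces and risk measures\<close>

definition atomless :: "'a measure \<Rightarrow> bool" where
  "atomless M \<longleftrightarrow> (\<forall>A\<in>sets M. 0 < measure M A \<longrightarrow>
     (\<exists>B\<in>sets M. B \<subseteq> A \<and> 0 < measure M B \<and> measure M B < measure M A))"

text \<open>A linear space of (classes of) random variables between \<open>L\<^sup>\<infinity>\<close> and \<open>L\<^sup>1\<close> is represented
  by the set of all representing functions.  Since every measurable function that is almost surely
  zero belongs to \<open>L\<^sup>\<infinity>\<close>, such a set is automatically closed under almost sure equality of
  measurable functions.\<close>

definition model_space :: "'a measure \<Rightarrow> ('a \<Rightarrow> real) set \<Rightarrow> bool" where
  "model_space M \<X> \<longleftrightarrow>
     (\<forall>X\<in>\<X>. integrable M X) \<and>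
     (\<forall>X\<in>borel_measurable M. (\<exists>c. AE \<omega> in M. \<bar>X \<omega>\<bar> \<le> c) \<longrightarrow> X \<in> \<X>) \<and>
     (\<forall>X\<in>\<X>. \<forall>Y\<in>\<X>. (\<lambda>\<omega>. X \<omega> + Y \<omega>) \<in> \<X>) \<and>
     (\<forall>X\<in>\<X>. \<forall>c. (\<lambda>\<omega>. c * X \<omega>) \<in> \<X>)"

definition stonean_lattice :: "('a \<Rightarrow> real) set \<Rightarrow> bool" where
  "stonean_lattice \<X> \<longleftrightarrow> (\<forall>X\<in>\<X>. \<forall>Y\<in>\<X>.
     (\<lambda>\<omega>. min (X \<omega>) (Y \<omega>)) \<in> \<X> \<and> (\<lambda>\<omega>. max (X \<omega>) (Y \<omega>)) \<in> \<X>)"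

definition dist_fun :: "'a measure \<Rightarrow> ('a \<Rightarrow> real) \<Rightarrow> real \<Rightarrow> real" where
  "dist_fun M X = cdf (distr M borel X)"

definition dist_funs :: "'a measure \<Rightarrow> ('a \<Rightarrow> real) set \<Rightarrow> (real \<Rightarrow> real) set" where
  "dist_funs M \<X> = dist_fun M ` \<X>"

definition left_quantile :: "(real \<Rightarrow> real) \<Rightarrow> real \<Rightarrow> ereal" where
  "left_quantile F s = Inf (ereal ` {x. s \<le> F x})"

definition right_quantile :: "(real \<Rightarrow> real) \<Rightarrow> real \<Rightarrow> ereal" where
  "right_quantile F s = Inf (ereal ` {x. s < F x})"

definition coherent_risk_measure ::
    "'a measure \<Rightarrow> ('a \<Rightarrow> real) set \<Rightarrow> (('a \<Rightarrow> real) \<Rightarrow> real) \<Rightarrow> bool" where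
  "coherent_risk_measure M \<X> \<rho> \<longleftrightarrow>
     (\<forall>X\<in>\<X>. \<forall>Y\<in>\<X>. (AE \<omega> in M. X \<omega> \<le> Y \<omega>) \<longrightarrow> \<rho> Y \<le> \<rho> X) \<and>
     (\<forall>X\<in>\<X>. \<forall>m. \<rho> (\<lambda>\<omega>. X \<omega> + m) = \<rho> X - m) \<and>
     (\<forall>X\<in>\<X>. \<forall>Y\<in>\<X>. \<rho> (\<lambda>\<omega>. X \<omega> + Y \<omega>) \<le> \<rho> X + \<rho> Y) \<and>
     (\<forall>X\<in>\<X>. \<forall>c\<ge>0. \<rho> (\<lambda>\<omega>. c * X \<omega>) = c * \<rho> X)"

definition law_invariant ::
    "'a measure \<Rightarrow> ('a \<Rightarrow> real) set \<Rightarrow> (('a \<Rightarrow> real) \<Rightarrow> real) \<Rightarrow> bool" where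
  "law_invariant M \<X> \<rho> \<longleftrightarrow>
     (\<forall>X\<in>\<X>. \<forall>Y\<in>\<X>. distr M borel X = distr M borel Y \<longrightarrow> \<rho> X = \<rho> Y)"

text \<open>The functional \<open>\<R>\<^sub>\<rho>(F\<^sub>X) = \<rho>(X)\<close>; the description is proper if \<open>\<rho>\<close> is law-invariant and
  \<open>F\<close> is the distribution function of an element of \<open>\<X>\<close>.\<close>

definition risk_functional ::
    "'a measure \<Rightarrow> ('a \<Rightarrow> real) set \<Rightarrow> (('a \<Rightarrow> real) \<Rightarrow> real) \<Rightarrow> (real \<Rightarrow> real) \<Rightarrow> real" where
  "risk_functional M \<X> \<rho> F = (THE r. \<exists>X\<in>\<X>. dist_fun M X = F \<and> \<rho> X = r)"

section \<open>Distortion functions\<close>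

text \<open>A function with domain \<open>[0,1]\<close> is represented by an extensional function on \<open>{0..1}\<close>,
  so that equality of distortion functions and the uniform metric have their usual meaning.\<close>

definition distortion_function :: "(real \<Rightarrow> real) \<Rightarrow> bool" where
  "distortion_function g \<longleftrightarrow> g \<in> {0..1} \<rightarrow>\<^sub>E {0..1} \<and> mono_on {0..1} g \<and> g 0 = 0 \<and> g 1 = 1"

definition cc_distortion_function :: "(real \<Rightarrow> real) \<Rightarrow> bool" where
  "cc_distortion_function g \<longleftrightarrow>
     distortion_function g \<and> concave_on {0..1} g \<and> continuous_on {0..1} g"

definition uniform_topology :: "(real \<Rightarrow> real) topology" where
  "uniform_topology = mtopology_of (cfunspace (top_of_set {0..1}) (euclidean_metric :: real metric))"

definition right_deriv :: "(real \<Rightarrow> real) \<Rightarrow> real \<Rightarrow> real" where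
  "right_deriv h t = vector_derivative h (at_right t)"

definition distortion_admissible :: "'a measure \<Rightarrow> (real \<Rightarrow> real) \<Rightarrow> ('a \<Rightarrow> real) \<Rightarrow> bool" where
  "distortion_admissible M g X \<longleftrightarrow>
     set_integrable lborel {0<..} (\<lambda>x. g (1 - dist_fun M (\<lambda>\<omega>. \<bar>X \<omega>\<bar>) x))"

definition distortion_risk_measure :: "'a measure \<Rightarrow> (real \<Rightarrow> real) \<Rightarrow> ('a \<Rightarrow> real) \<Rightarrow> real" where
  "distortion_risk_measure M g X =
     (LBINT x:{..<0}. g (dist_fun M X x)) - (LBINT x:{0<..}. 1 - g (dist_fun M X x))"

text \<open>The distortion function \<open>g\<^sub>\<rho>(t) = \<rho>(-B)\<close>, \<open>B\<close> Bernoulli distributed with expectation \<open>t\<close>;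
  by law-invariance the value does not depend on the choice of \<open>B\<close>.\<close>

definition assoc_distortion :: "'a measure \<Rightarrow> (('a \<Rightarrow> real) \<Rightarrow> real) \<Rightarrow> real \<Rightarrow> real" where
  "assoc_distortion M \<rho> = (\<lambda>t\<in>{0..1}. THE r. \<exists>B\<in>borel_measurable M.
     distr M borel B = distr (measure_pmf (bernoulli_pmf t)) borel of_bool \<and> \<rho> (\<lambda>\<omega>. - B \<omega>) = r)"

text \<open>The properties of a representing set \<open>\<G>\<^sub>\<rho>\<close>.  The suprema are taken in the
  extended reals, so that the equations include nonemptiness and boundedness.\<close>

definition representing_set :: "'a measure \<Rightarrow> ('a \<Rightarrow> real) set \<Rightarrow>
    (('a \<Rightarrow> real) \<Rightarrow> real) \<Rightarrow> (real \<Rightarrow> real) set \<Rightarrow> bool" where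
  "representing_set M \<X> \<rho> \<G> \<longleftrightarrow>
     (\<forall>g\<in>\<G>. cc_distortion_function g) \<and>
     (\<forall>g\<in>\<G>. \<forall>X\<in>\<X>. distortion_admissible M g X) \<and>
     compactin uniform_topology \<G> \<and>
     (\<forall>t\<in>{0..1}. ereal (assoc_distortion M \<rho> t) = (SUP g\<in>\<G>. ereal (g t))) \<and>
     (\<forall>\<gamma>\<in>{0<..<1}. \<forall>t\<in>{0<..<1}.
        (SUP g\<in>\<G>. ereal (right_deriv g t)) \<le> ereal (assoc_distortion M \<rho> (\<gamma> * t) / (\<gamma> * t))) \<and>
     (\<forall>X\<in>\<X>. ereal (\<rho> X) = (SUP g\<in>\<G>. ereal (distortion_risk_measure M g X))) \<and>
     (\<forall>X\<in>\<X>. \<forall>c. openin (subtopology uniform_topology \<G>)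
        {g\<in>\<G>. c < distortion_risk_measure M g X}) \<and>
     (\<forall>X\<in>\<X>. (\<exists>\<gamma>\<in>{0<..<1}.
          set_integrable lborel {..<0} (\<lambda>x. assoc_distortion M \<rho> (\<gamma> * dist_fun M X x))) \<longrightarrow>
        continuous_map (subtopology uniform_topology \<G>) euclideanreal
          (\<lambda>g. distortion_risk_measure M g X))"

section \<open>Weighted spaces of cadlag functions\<close>

definition weight_function :: "(real \<Rightarrow> real) \<Rightarrow> bool" where
  "weight_function \<phi> \<longleftrightarrow>
     continuous_on UNIV \<phi> \<and> (\<forall>x. 1 \<le> \<phi> x) \<and> antimono_on {..0} \<phi> \<and> mono_on {0..} \<phi>"

definition cadlag :: "(real \<Rightarrow> real) \<Rightarrow> bool" where
  "cadlag v \<longleftrightarrow> (\<forall>x. continuous (at_right x) v \<and> (\<exists>l. (v \<longlongrightarrow> l) (at_left x)))"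

definition D_space :: "(real \<Rightarrow> real) set" where
  "D_space = {v. cadlag v \<and> bounded (range v)}"

definition D_algebra :: "(real \<Rightarrow> real) measure" where
  "D_algebra = sigma D_space {{v\<in>D_space. v x \<in> A} | x A. A \<in> sets borel}"

definition weighted_norm :: "(real \<Rightarrow> real) \<Rightarrow> (real \<Rightarrow> real) \<Rightarrow> ereal" where
  "weighted_norm \<phi> v = (SUP x. ereal \<bar>v x * \<phi> x\<bar>)"

definition D_weighted :: "(real \<Rightarrow> real) \<Rightarrow> (real \<Rightarrow> real) set" where
  "D_weighted \<phi> = {v. cadlag v \<and> weighted_norm \<phi> v < \<infinity>}"

definition D_weighted_on :: "(real \<Rightarrow> real) \<Rightarrow> (real \<Rightarrow> real) \<Rightarrow> (real \<Rightarrow> real) set" where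
  "D_weighted_on \<phi> F =
     {v\<in>D_weighted \<phi>. \<forall>x. ereal x \<notin> {right_quantile F 0..left_quantile F 1} \<longrightarrow> v x = 0}"

definition C_weighted_on :: "(real \<Rightarrow> real) \<Rightarrow> (real \<Rightarrow> real) \<Rightarrow> (real \<Rightarrow> real) set" where
  "C_weighted_on \<phi> F =
     {v\<in>D_weighted_on \<phi> F. \<forall>x\<in>einterval (right_quantile F 0) (left_quantile F 1).
        \<not> isCont v x \<longrightarrow> \<not> isCont F x}"

definition D_weighted_algebra :: "(real \<Rightarrow> real) \<Rightarrow> (real \<Rightarrow> real) \<Rightarrow> (real \<Rightarrow> real) measure" where
  "D_weighted_algebra \<phi> F = restrict_space D_algebra (D_weighted_on \<phi> F)"

definition D_weighted_topology :: "(real \<Rightarrow> real) \<Rightarrow> (real \<Rightarrow> real) \<Rightarrow> (real \<Rightarrow> real) topology" where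
  "D_weighted_topology \<phi> F =
     Metric_space.mtopology (D_weighted_on \<phi> F)
       (\<lambda>u v. real_of_ereal (weighted_norm \<phi> (\<lambda>x. u x - v x)))"

section \<open>Convergence in distribution\<close>

text \<open>Convergence in the sense of Pollard and Shorack--Wellner: the test functions are the bounded,
  norm-continuous functions that are measurable for the trace of the projection
  \<open>\<sigma>\<close>-algebra (which is in general smaller than the Borel \<open>\<sigma>\<close>-algebra of the norm).\<close>

definition conv_in_distr_D :: "(real \<Rightarrow> real) \<Rightarrow> (real \<Rightarrow> real) \<Rightarrow>
    'a measure \<Rightarrow> (nat \<Rightarrow> 'a \<Rightarrow> real \<Rightarrow> real) \<Rightarrow> 'b measure \<Rightarrow> ('b \<Rightarrow> real \<Rightarrow> real) \<Rightarrow> bool" where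
  "conv_in_distr_D \<phi> F M Y N Z \<longleftrightarrow>
     (\<forall>f. bounded (f ` D_weighted_on \<phi> F) \<and>
          continuous_map (D_weighted_topology \<phi> F) euclideanreal f \<and>
          f \<in> borel_measurable (D_weighted_algebra \<phi> F) \<longrightarrow>
          (\<lambda>n. \<integral>\<omega>. f (Y n \<omega>) \<partial>M) \<longlonglongrightarrow> (\<integral>\<omega>. f (Z \<omega>) \<partial>N))"

definition conv_in_distr_real ::
    "'a measure \<Rightarrow> (nat \<Rightarrow> 'a \<Rightarrow> real) \<Rightarrow> 'b measure \<Rightarrow> ('b \<Rightarrow> real) \<Rightarrow> bool" where
  "conv_in_distr_real M Y N Z \<longleftrightarrow>
     (\<forall>n. Y n \<in> borel_measurable M) \<and> Z \<in> borel_measurable N \<and>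
     weak_conv_m (\<lambda>n. distr M borel (Y n)) (distr N borel Z)"

section \<open>The derivative of the risk functional\<close>

definition near_optimal :: "'a measure \<Rightarrow> ('a \<Rightarrow> real) set \<Rightarrow> (('a \<Rightarrow> real) \<Rightarrow> real) \<Rightarrow>
    (real \<Rightarrow> real) set \<Rightarrow> (real \<Rightarrow> real) \<Rightarrow> real \<Rightarrow> (real \<Rightarrow> real) set" where
  "near_optimal M \<X> \<rho> \<G> F \<epsilon> =
     {h\<in>\<G>. risk_functional M \<X> \<rho> F - \<epsilon> \<le> risk_functional M \<X> (distortion_risk_measure M h) F}"

definition optimal :: "'a measure \<Rightarrow> ('a \<Rightarrow> real) set \<Rightarrow> (('a \<Rightarrow> real) \<Rightarrow> real) \<Rightarrow>
    (real \<Rightarrow> real) set \<Rightarrow> (real \<Rightarrow> real) \<Rightarrow> (real \<Rightarrow> real) set" where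
  "optimal M \<X> \<rho> \<G> F =
     {h\<in>\<G>. risk_functional M \<X> \<rho> F = risk_functional M \<X> (distortion_risk_measure M h) F}"

definition deriv_integral :: "(real \<Rightarrow> real) \<Rightarrow> (real \<Rightarrow> real) \<Rightarrow> (real \<Rightarrow> real) \<Rightarrow> real" where
  "deriv_integral F h v =
     (LBINT x=right_quantile F 0..left_quantile F 1. right_deriv h (F x) * v x)"

definition risk_derivative :: "'a measure \<Rightarrow> ('a \<Rightarrow> real) set \<Rightarrow> (('a \<Rightarrow> real) \<Rightarrow> real) \<Rightarrow>
    (real \<Rightarrow> real) set \<Rightarrow> (real \<Rightarrow> real) \<Rightarrow> (real \<Rightarrow> real) \<Rightarrow> real" where
  "risk_derivative M \<X> \<rho> \<G> F v =
     Lim (at_right 0) (\<lambda>\<epsilon>. SUP h\<in>near_optimal M \<X> \<rho> \<G> F \<epsilon>. deriv_integral F h v)"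

end

theory Submission
  imports Defs
begin

text \<open>A concave \<open>h\<close> with \<open>h 0 = 0\<close> satisfies \<open>\<bar>h s - h t\<bar> \<le> h t / t * \<bar>s - t\<bar>\<close> for all \<open>s\<close>, so the
  integrability assumption gives one dominating function for all increments \<open>h (F x) - h (F\<^sub>0 x)\<close>
  and all derivatives \<open>h' (F\<^sub>0 x) * v x\<close>, \<open>h \<in> \<G>\<close>.  Write \<open>S\<^sub>\<epsilon> v\<close> for the supremum in the definition of
  the derivative and \<open>v = r\<^sub>n (F - F\<^sub>0)\<close>.  Concavity of \<open>h\<close> gives \<open>r\<^sub>n (\<R> F - \<R> F\<^sub>0) \<le> S\<^sub>\<epsilon> v\<close> once
  \<open>r\<^sub>n \<epsilon>\<close> is large compared with the norm of \<open>v\<close>.  Compactness of \<open>\<G>\<close>, almost everywhere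
  differentiability and dominated convergence make the first-order expansion uniform in \<open>h\<close> and in
  norm-bounded \<open>v\<close>, which bounds \<open>r\<^sub>n (\<R> F - \<R> F\<^sub>0)\<close> from below by the derivative at \<open>v\<close> up to \<open>o(1)\<close>.
  Both bounds are norm-Lipschitz and measurable in \<open>v\<close>, so monotone test functions
  transfer the convergence of \<open>r\<^sub>n (F\<^sub>n - F\<^sub>0)\<close> directly, without an almost sure representation.  Case (B) is the singleton instance of a representing set.\<close>

section \<open>Concave distortion functions\<close>

text \<open>The obstacle is that two nonsmooth operations are stacked: each \<open>h\<close> may
  have kinks, and the supremum over \<open>\<G>\<close> need not be attained, because lower
  semicontinuity of \<open>h \<mapsto> distortion_functional h F0\<close> gives no maximiser. For
  the kinks, differentiability is recorded as smallness of a symmetric second difference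
  (\<open>kink_free\<close>). At a fixed step this quotient involves three values of
  \<open>h\<close>, so pointwise convergence of concave functions controls it along the sequence,
  and only the kinks of the limit matter; no null set common to all \<open>h\<close> is required.
  For the supremum, a near-maximiser at a perturbed \<open>F\<close> is still
  \<open>\<epsilon>\<close>-optimal at \<open>F0\<close>. This is why the upper bound involves
  \<open>S \<epsilon>\<close> with a fixed \<open>\<epsilon>\<close>, whereas the lower bound can
  use a tolerance of order \<open>1 / r\<close>. The gap between the two closes only under the limit
  law, where \<open>\<epsilon>\<close> is chosen before \<open>n\<close>. Test functions must be
  measurable for the projections, so every supremum over an uncountable family is rewritten as a
  countable one.\<close>

lemma concave_slopes:
  fixes h :: "real \<Rightarrow> real"
  assumes "concave_on S h" "u \<in> S" "s \<in> S" "u < t" "t < s"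
  shows "(h s - h t) / (s - t) \<le> (h s - h u) / (s - u)"
    and "(h s - h u) / (s - u) \<le> (h t - h u) / (t - u)"
proof -
  have c: "convex_on S (\<lambda>x. - h x)" using assms(1) by (simp add: concave_on_def)
  have flip: "(- q - - p) / (y - x) = - ((p - q) / (x - y))" if "y < x" for p q x y :: real
    using that by (simp add: field_simps)
  note flips = flip[OF \<open>u < t\<close>] flip[OF \<open>t < s\<close>] flip[OF less_trans[OF \<open>u < t\<close> \<open>t < s\<close>]]
  show "(h s - h t) / (s - t) \<le> (h s - h u) / (s - u)"
    using convex_on_slope_le(2)[OF c assms(2-5)] unfolding flips by simp
  show "(h s - h u) / (s - u) \<le> (h t - h u) / (t - u)"
    using convex_on_slope_le(1)[OF c assms(2-5)] unfolding flips by simp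
qed

text \<open>\<open>right_deriv\<close> rests on a choice operator, so existence of the one-sided
  limit has to be established before any bound. Slopes to the right of \<open>t\<close> increase as
  \<open>s\<close> decreases to \<open>t\<close> and stay below every slope from the left, so they
  converge to their supremum.\<close>

lemma right_deriv_concave_bounds:
  fixes h :: "real \<Rightarrow> real"
  assumes h: "concave_on {0..1} h" and t: "0 < t" "t < 1"
  shows "\<And>s. t < s \<Longrightarrow> s \<le> 1 \<Longrightarrow> (h s - h t) / (s - t) \<le> right_deriv h t"
    and "\<And>u. 0 \<le> u \<Longrightarrow> u < t \<Longrightarrow> right_deriv h t \<le> (h t - h u) / (t - u)"
proof -
  \<comment> \<open>The sign turns the slopes into a nondecreasing function with a lower bound, the
    form in which \<open>Lim_right_bound\<close> supplies a right-hand limit.\<close>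
  define f where "f s = - ((h s - h t) / (s - t))" for s
  have bnd: "- ((h t - h u) / (t - u)) \<le> f s" if "t < s" "s \<le> 1" "0 \<le> u" "u < t" for s u
    using concave_slopes[OF h, of u s t] that t unfolding f_def by force
  have mono: "f p \<le> f q" if "t < p" "p \<le> q" "q \<le> 1" for p q
  proof (cases "p = q")
    case False
    then show ?thesis using concave_slopes(2)[OF h, of t q p] that t unfolding f_def by simp
  qed simp
  have eqI: "{t<..} \<inter> {..1} = {t<..1}" by auto
  have lim: "(f \<longlongrightarrow> Inf (f ` {t<..1})) (at t within {t<..1})"
    using Lim_right_bound[of "{..1}" t f "- ((h t - h 0) / (t - 0))"] mono bnd[of _ 0] t
    unfolding eqI by auto
  moreover have "at t within {t<..1} = at_right t"
    using t by (rule_tac at_within_nhd[where S="{..<1}"]) auto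
  ultimately have "(f \<longlongrightarrow> Inf (f ` {t<..1})) (at_right t)" by simp
  then have "((\<lambda>s. (h s - h t) / (s - t)) \<longlongrightarrow> - Inf (f ` {t<..1})) (at_right t)"
    unfolding f_def using tendsto_minus by fastforce
  then have "(h has_vector_derivative - Inf (f ` {t<..1})) (at_right t)"
    by (simp add: has_field_derivative_iff has_real_derivative_iff_has_vector_derivative[symmetric])
  then have eq: "right_deriv h t = - Inf (f ` {t<..1})"
    unfolding right_deriv_def by (rule vector_derivative_within[rotated]) simp
  have ne: "f ` {t<..1} \<noteq> {}" using t by auto
  have bdd: "bdd_below (f ` {t<..1})" using bnd[of _ 0] t by (auto intro!: bdd_belowI2)
  show "(h s - h t) / (s - t) \<le> right_deriv h t" if "t < s" "s \<le> 1" for s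
  proof -
    have "Inf (f ` {t<..1}) \<le> f s" using bdd that by (intro cInf_lower) auto
    then show ?thesis unfolding eq by (simp add: f_def)
  qed
  show "right_deriv h t \<le> (h t - h u) / (t - u)" if "0 \<le> u" "u < t" for u
  proof -
    have "- ((h t - h u) / (t - u)) \<le> Inf (f ` {t<..1})"
      using bnd that by (intro cInf_greatest ne) auto
    then show ?thesis unfolding eq by simp
  qed
qed

text \<open>Chords to the right of \<open>t\<close> have smaller slope than the right derivative,
  chords to the left larger slope; the sign of \<open>s - t\<close> makes both cases one
  inequality.\<close>

lemma right_deriv_supergradient:
  fixes h :: "real \<Rightarrow> real"
  assumes h: "concave_on {0..1} h" and t: "0 < t" "t < 1" and s: "0 \<le> s" "s \<le> 1"
  shows "h s - h t \<le> right_deriv h t * (s - t)"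
proof -
  consider "s < t" | "s = t" | "t < s" by linarith
  then show ?thesis
  proof cases
    case 1
    then show ?thesis using right_deriv_concave_bounds(2)[OF h t s(1)] by (simp add: field_simps)
  next
    case 3
    then show ?thesis using right_deriv_concave_bounds(1)[OF h t _ s(2)] by (simp add: field_simps)
  qed simp
qed

lemma right_deriv_antimono:
  fixes h :: "real \<Rightarrow> real"
  assumes h: "concave_on {0..1} h" and "0 < s" "s \<le> t" "t < 1"
  shows "right_deriv h t \<le> right_deriv h s"
proof (cases "s = t")
  case False
  then show ?thesis
    using right_deriv_concave_bounds(1)[OF h, of s t] right_deriv_concave_bounds(2)[OF h, of t s] assms
    by linarith
qed simp

text \<open>The quotient is the slope over \<open>[t - e, t]\<close> minus the slope over
  \<open>[t, t + e]\<close>. For concave \<open>h\<close> and interior \<open>t\<close> its limit is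
  the jump of the one-sided derivatives, so the condition expresses differentiability, but in values
  of \<open>h\<close> alone.\<close>

definition kink_free :: "(real \<Rightarrow> real) \<Rightarrow> real \<Rightarrow> bool" where
  "kink_free h t \<longleftrightarrow> ((\<lambda>e. (2 * h t - h (t - e) - h (t + e)) / e) \<longlongrightarrow> 0) (at_right 0)"

lemma differentiable_imp_kink_free:
  fixes h :: "real \<Rightarrow> real"
  assumes "h differentiable (at t)"
  shows "kink_free h t"
proof -
  obtain D where D: "DERIV h t :> D" using assms by (auto simp: real_differentiable_def)
  then have 1: "((\<lambda>e. (h (t + e) - h t) / e) \<longlongrightarrow> D) (at 0)" by (simp add: DERIV_def)
  have 2: "((\<lambda>e. (h (t + e) - h t) / e) \<longlongrightarrow> D) (at_right 0)"
    using 1 by (rule tendsto_within_subset) simp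
  have "((\<lambda>e. (h (t + e) - h t) / e) \<longlongrightarrow> D) (at_left 0)"
    using 1 by (rule tendsto_within_subset) simp
  then have 3: "((\<lambda>e. (h (t + - e) - h t) / - e) \<longlongrightarrow> D) (at_right 0)"
    by (simp add: filterlim_at_left_to_right)
  have "((\<lambda>e. (h (t + - e) - h t) / - e - (h (t + e) - h t) / e) \<longlongrightarrow> D - D) (at_right 0)"
    by (intro tendsto_diff 2 3)
  moreover have "(\<lambda>e. (h (t + - e) - h t) / - e - (h (t + e) - h t) / e) =
      (\<lambda>e. (2 * h t - h (t - e) - h (t + e)) / e)"
    by (rule ext) (simp add: diff_divide_distrib)
  ultimately show ?thesis unfolding kink_free_def by simp
qed

text \<open>Concavity puts the left slope below \<open>right_deriv h (t - e)\<close> and the right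
  slope above \<open>right_deriv h (t + e)\<close>, so the quotient is squeezed between zero and an
  oscillation of the right derivative around \<open>t\<close>.\<close>

lemma kink_free_if_isCont_right_deriv:
  fixes h :: "real \<Rightarrow> real"
  assumes h: "concave_on {0..1} h" and t: "0 < t" "t < 1" and c: "isCont (right_deriv h) t"
  shows "kink_free h t"
proof -
  let ?g = "\<lambda>e. (2 * h t - h (t - e) - h (t + e)) / e"
  have ev: "eventually (\<lambda>e. 0 < e \<and> e < min t (1 - t)) (at_right 0)"
    using t by (intro eventually_at_rightI[of 0 "min t (1 - t)"]) auto
  have eq: "?g e = (h t - h (t - e)) / (t - (t - e)) - (h (t + e) - h t) / ((t + e) - t)"
    if "0 < e" for e
    using that by (simp add: field_simps)
  have up: "eventually (\<lambda>e. ?g e \<le> right_deriv h (t - e) - right_deriv h (t + e)) (at_right 0)"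
    using ev
  proof eventually_elim
    case (elim e)
    have "(h t - h (t - e)) / (t - (t - e)) \<le> right_deriv h (t - e)"
      using elim t by (intro right_deriv_concave_bounds(1)[OF h]) auto
    moreover have "right_deriv h (t + e) \<le> (h (t + e) - h t) / ((t + e) - t)"
      using elim t by (intro right_deriv_concave_bounds(2)[OF h]) auto
    ultimately show ?case using elim eq by simp
  qed
  have lo: "eventually (\<lambda>e. 0 \<le> ?g e) (at_right 0)"
    using ev
  proof eventually_elim
    case (elim e)
    then show ?case
      using concave_slopes[OF h, of "t - e" "t + e" t] eq[of e] by force
  qed
  have T: "((\<lambda>e. t - e) \<longlongrightarrow> t) (at_right 0)" "((\<lambda>e. t + e) \<longlongrightarrow> t) (at_right 0)"
    by (auto intro!: tendsto_eq_intros)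
  have "((\<lambda>e. right_deriv h (t - e) - right_deriv h (t + e)) \<longlongrightarrow>
      right_deriv h t - right_deriv h t) (at_right 0)"
    by (intro tendsto_diff isCont_tendsto_compose[OF c] T)
  then show ?thesis
    unfolding kink_free_def
    by (intro tendsto_sandwich[OF lo up tendsto_const]) simp
qed

text \<open>The right derivative is monotone, hence has countably many discontinuities, and kinks
  occur only among these.\<close>

lemma countable_kinks:
  fixes h :: "real \<Rightarrow> real"
  assumes h: "concave_on {0..1} h"
  shows "countable {t \<in> {0<..<1}. \<not> kink_free h t}"
proof -
  have "mono_on {0<..<1} (\<lambda>t. - right_deriv h t)"
    using right_deriv_antimono[OF h] by (auto intro!: mono_onI)
  then have "countable {t \<in> {0<..<1}. \<not> isCont (\<lambda>t. - right_deriv h t) t}"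
    by (intro mono_on_ctble_discont_open) auto
  moreover have "isCont (right_deriv h) t" if "isCont (\<lambda>t. - right_deriv h t) t" for t
    using continuous_minus[OF that] by simp
  ultimately show ?thesis
    using kink_free_if_isCont_right_deriv[OF h] by (elim countable_subset[rotated]) auto
qed

text \<open>The slope of the chord between \<open>s\<close> and \<open>t\<close> and the right
  derivative at \<open>t\<close> both lie between the slopes over \<open>[t, t + e]\<close> and
  \<open>[t - e, t]\<close>; the second difference quotient is the length of that interval.\<close>

lemma concave_second_difference_bound:
  fixes h :: "real \<Rightarrow> real"
  assumes h: "concave_on {0..1} h" and t: "0 < t" "t < 1"
    and e: "0 < e" "e < t" "e < 1 - t" and s: "\<bar>s - t\<bar> \<le> e"
  shows "\<bar>h s - h t - right_deriv h t * (s - t)\<bar>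
    \<le> \<bar>s - t\<bar> * ((2 * h t - h (t - e) - h (t + e)) / e)"
proof -
  define p where "p = (h t - h (t - e)) / e"
  define q where "q = (h (t + e) - h t) / e"
  define D where "D = right_deriv h t"
  have pq: "(2 * h t - h (t - e) - h (t + e)) / e = p - q"
    using e by (simp add: p_def q_def field_simps)
  have D: "q \<le> D" "D \<le> p"
    using right_deriv_concave_bounds(1)[OF h t, of "t + e"]
      right_deriv_concave_bounds(2)[OF h t, of "t - e"] e
    by (auto simp: p_def q_def D_def)
  consider "s = t" | "t < s" | "s < t" by linarith
  then show ?thesis
  proof cases
    case 2
    define m where "m = (h s - h t) / (s - t)"
    have "q \<le> m"
      using concave_slopes(2)[OF h, of t "t + e" s] 2 s t e
      by (cases "s = t + e") (auto simp: m_def q_def)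
    moreover have "m \<le> D"
      using right_deriv_concave_bounds(1)[OF h t, of s] 2 s e by (simp add: m_def D_def)
    moreover have "h s - h t = m * (s - t)" using 2 by (simp add: m_def)
    then have "\<bar>h s - h t - D * (s - t)\<bar> = \<bar>s - t\<bar> * \<bar>m - D\<bar>"
      by (simp add: abs_mult[symmetric] algebra_simps)
    ultimately show ?thesis
      unfolding pq D_def[symmetric] using D by (simp add: mult_left_mono)
  next
    case 3
    define m where "m = (h t - h s) / (t - s)"
    have "m \<le> p"
      using concave_slopes(1)[OF h, of "t - e" t s] 3 s t e
      by (cases "s = t - e") (auto simp: m_def p_def)
    moreover have "D \<le> m"
      using right_deriv_concave_bounds(2)[OF h t, of s] 3 s e by (simp add: m_def D_def)
    moreover have "h t - h s = m * (t - s)" using 3 by (simp add: m_def)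
    then have "h s - h t - D * (s - t) = (s - t) * (m - D)" by (simp add: algebra_simps)
    then have "\<bar>h s - h t - D * (s - t)\<bar> = \<bar>s - t\<bar> * \<bar>m - D\<bar>"
      by (simp add: abs_mult)
    ultimately show ?thesis
      unfolding pq D_def[symmetric] using D by (simp add: mult_left_mono)
  qed simp
qed

text \<open>The step \<open>e\<close> is fixed through the limit function; at this single
  \<open>e\<close> the quotient depends on three values, so its bound passes to \<open>H n\<close>
  for large \<open>n\<close>. This replaces uniform differentiability of the sequence.\<close>

lemma second_difference_small:
  fixes h :: "real \<Rightarrow> real"
  assumes H: "\<And>t. t \<in> {0..1} \<Longrightarrow> (\<lambda>n. H n t) \<longlonglongrightarrow> h t"
    and t: "0 < t" "t < 1" and k: "kink_free h t" and eta: "0 < \<eta>"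
  obtains e where "0 < e" "e < t" "e < 1 - t"
    "eventually (\<lambda>n. (2 * H n t - H n (t - e) - H n (t + e)) / e < \<eta>) sequentially"
    "(2 * h t - h (t - e) - h (t + e)) / e < \<eta>"
proof -
  have "eventually (\<lambda>e. (2 * h t - h (t - e) - h (t + e)) / e < \<eta>) (at_right 0)"
    using k eta unfolding kink_free_def by (auto dest: order_tendstoD)
  moreover have "eventually (\<lambda>e. 0 < e \<and> e < min t (1 - t)) (at_right 0)"
    using t by (intro eventually_at_rightI[of 0 "min t (1 - t)"]) auto
  ultimately have "eventually (\<lambda>e. (2 * h t - h (t - e) - h (t + e)) / e < \<eta> \<and>
      0 < e \<and> e < min t (1 - t)) (at_right 0)"
    by (rule eventually_conj)
  then obtain e where e: "(2 * h t - h (t - e) - h (t + e)) / e < \<eta>" "0 < e" "e < t" "e < 1 - t"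
    by (auto dest!: eventually_happens)
  have "(\<lambda>n. (2 * H n t - H n (t - e) - H n (t + e)) / e) \<longlonglongrightarrow>
      (2 * h t - h (t - e) - h (t + e)) / e"
    using e t by (intro tendsto_intros H) auto
  from order_tendstoD(2)[OF this e(1)] show thesis using that e by blast
qed

text \<open>Each right derivative lies between the slopes over \<open>[t, t + e]\<close> and
  \<open>[t - e, t]\<close> of its own function. For \<open>h\<close> these differ by less than
  \<open>\<eta> / 2\<close>, and for large \<open>n\<close> those of \<open>H n\<close> leave that
  range by less than \<open>\<eta> / 2\<close>.\<close>

lemma right_deriv_pointwise_limit:
  fixes h :: "real \<Rightarrow> real"
  assumes conc: "\<And>n. concave_on {0..1} (H n)" "concave_on {0..1} h"
    and H: "\<And>t. t \<in> {0..1} \<Longrightarrow> (\<lambda>n. H n t) \<longlonglongrightarrow> h t"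
    and t: "0 < t" "t < 1" and k: "kink_free h t"
  shows "(\<lambda>n. right_deriv (H n) t) \<longlonglongrightarrow> right_deriv h t"
proof (rule LIMSEQ_I)
  fix \<eta> :: real assume "0 < \<eta>"
  then have "0 < \<eta> / 2" by simp
  from second_difference_small[OF H t k this] obtain e where e: "0 < e" "e < t" "e < 1 - t"
    and small: "(2 * h t - h (t - e) - h (t + e)) / e < \<eta> / 2" by blast
  have lim: "(\<lambda>n. (H n t - H n (t - e)) / e) \<longlonglongrightarrow> (h t - h (t - e)) / e"
    "(\<lambda>n. (H n (t + e) - H n t) / e) \<longlonglongrightarrow> (h (t + e) - h t) / e"
    using e t by (auto intro!: tendsto_intros H)
  have "eventually (\<lambda>n. (H n t - H n (t - e)) / e < (h t - h (t - e)) / e + \<eta> / 2) sequentially"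
    using lim(1) \<open>0 < \<eta>\<close> by (auto elim: order_tendstoD(2))
  moreover have "eventually (\<lambda>n. (h (t + e) - h t) / e - \<eta> / 2 < (H n (t + e) - H n t) / e) sequentially"
    using lim(2) by (rule order_tendstoD(1)) (use \<open>0 < \<eta>\<close> in simp)
  ultimately have "eventually (\<lambda>n. norm (right_deriv (H n) t - right_deriv h t) < \<eta>) sequentially"
  proof eventually_elim
    case (elim n)
    have b: "(g (t + e) - g t) / e \<le> right_deriv g t \<and> right_deriv g t \<le> (g t - g (t - e)) / e"
      if "concave_on {0..1} g" for g
      using right_deriv_concave_bounds(1)[OF that t, of "t + e"]
        right_deriv_concave_bounds(2)[OF that t, of "t - e"] e by auto
    have "(2 * h t - h (t - e) - h (t + e)) / e = (h t - h (t - e)) / e - (h (t + e) - h t) / e"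
      using e by (simp add: field_simps)
    with b[OF conc(1), of n] b[OF conc(2)] elim small show ?case
      unfolding real_norm_def by linarith
  qed
  then show "\<exists>N. \<forall>n\<ge>N. norm (right_deriv (H n) t - right_deriv h t) < \<eta>"
    by (simp add: eventually_sequentially)
qed

text \<open>The displacement \<open>s n - t\<close> is of order \<open>1 / r n\<close>, so it
  eventually falls below the fixed step of the second difference; multiplied by \<open>r n\<close>,
  the remainder is still at most \<open>c\<close> times a small quotient.\<close>

lemma concave_expansion_limit:
  fixes h :: "real \<Rightarrow> real" and r s :: "nat \<Rightarrow> real"
  assumes conc: "\<And>n. concave_on {0..1} (H n)"
    and H: "\<And>t. t \<in> {0..1} \<Longrightarrow> (\<lambda>n. H n t) \<longlonglongrightarrow> h t"
    and t: "0 < t" "t < 1" and k: "kink_free h t"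
    and r: "filterlim r at_top sequentially" and s: "\<And>n. \<bar>r n * (s n - t)\<bar> \<le> c"
  shows "(\<lambda>n. right_deriv (H n) t * (r n * (s n - t)) - r n * (H n (s n) - H n t)) \<longlonglongrightarrow> 0"
proof (rule LIMSEQ_I)
  fix \<epsilon> :: real assume "0 < \<epsilon>"
  have c: "0 \<le> c" using s[of 0] by linarith
  \<comment> \<open>The summand 1 covers \<open>c = 0\<close> and makes
    \<open>c * \<eta> < \<epsilon>\<close> strict.\<close>
  define \<eta> where "\<eta> = \<epsilon> / (c + 1)"
  have eta: "0 < \<eta>" using \<open>0 < \<epsilon>\<close> c by (simp add: \<eta>_def)
  from second_difference_small[OF H t k eta] obtain e where e: "0 < e" "e < t" "e < 1 - t"
    and small: "eventually (\<lambda>n. (2 * H n t - H n (t - e) - H n (t + e)) / e < \<eta>) sequentially"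
    by blast
  \<comment> \<open>The bound 1 makes \<open>r n\<close> positive; the bound \<open>c / e\<close>
    forces \<open>\<bar>s n - t\<bar> \<le> e\<close>.\<close>
  have "eventually (\<lambda>n. max 1 (c / e) \<le> r n) sequentially"
    using r unfolding filterlim_at_top by blast
  with small have "eventually (\<lambda>n. norm (right_deriv (H n) t * (r n * (s n - t)) -
      r n * (H n (s n) - H n t) - 0) < \<epsilon>) sequentially"
  proof eventually_elim
    case (elim n)
    let ?q = "(2 * H n t - H n (t - e) - H n (t + e)) / e"
    have r: "0 < r n" "c \<le> r n * e" using elim e by (auto simp: field_simps)
    have "r n * \<bar>s n - t\<bar> \<le> r n * e" using order_trans[OF s[of n] r(2)] r(1) by (simp only: abs_mult abs_of_pos)
    then have "\<bar>s n - t\<bar> \<le> e" by (rule mult_left_le_imp_le) (rule r)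
    from concave_second_difference_bound[OF conc t e this]
    have "\<bar>H n (s n) - H n t - right_deriv (H n) t * (s n - t)\<bar> \<le> \<bar>s n - t\<bar> * ?q" .
    then have "r n * \<bar>H n (s n) - H n t - right_deriv (H n) t * (s n - t)\<bar> \<le> r n * (\<bar>s n - t\<bar> * ?q)"
      using r by (intro mult_left_mono) auto
    also have "r n * (\<bar>s n - t\<bar> * ?q) = \<bar>r n * (s n - t)\<bar> * ?q" using r by (simp add: abs_mult)
    also have "\<dots> \<le> \<bar>r n * (s n - t)\<bar> * \<eta>" using elim by (intro mult_left_mono) auto
    also have "\<dots> \<le> c * \<eta>" using s eta by (intro mult_right_mono) auto
    also have "c * \<eta> < \<epsilon>" using c \<open>0 < \<epsilon>\<close> by (simp add: \<eta>_def field_simps)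
    finally have "r n * \<bar>H n (s n) - H n t - right_deriv (H n) t * (s n - t)\<bar> < \<epsilon>" .
    also have "r n * \<bar>H n (s n) - H n t - right_deriv (H n) t * (s n - t)\<bar> =
      \<bar>r n * (H n (s n) - H n t - right_deriv (H n) t * (s n - t))\<bar>"
      using r by (simp add: abs_mult)
    also have "\<dots> = norm (right_deriv (H n) t * (r n * (s n - t)) - r n * (H n (s n) - H n t) - 0)"
      unfolding real_norm_def by (subst abs_minus_commute) (simp add: algebra_simps)
    finally show ?case .
  qed
  then show "\<exists>N. \<forall>n\<ge>N. norm (right_deriv (H n) t * (r n * (s n - t)) -
      r n * (H n (s n) - H n t) - 0) < \<epsilon>"
    by (simp add: eventually_sequentially)
qed

section \<open>Growth bounds and measurability for concave distortion functions\<close>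

lemma cc_distortion_functionD:
  assumes "cc_distortion_function h"
  shows "concave_on {0..1} h" "h 0 = 0" "h 1 = 1"
    "\<And>t. 0 \<le> t \<Longrightarrow> t \<le> 1 \<Longrightarrow> 0 \<le> h t" "\<And>t. 0 \<le> t \<Longrightarrow> t \<le> 1 \<Longrightarrow> h t \<le> 1"
    "\<And>s t. 0 \<le> s \<Longrightarrow> s \<le> t \<Longrightarrow> t \<le> 1 \<Longrightarrow> h s \<le> h t"
  using assms unfolding cc_distortion_function_def distortion_function_def
  by (auto simp: PiE_iff mono_onD)

lemma cc_distortion_le_scaled:
  assumes h: "cc_distortion_function h" and c: "0 \<le> c" "c \<le> 1" and t: "0 \<le> t" "t \<le> 1"
  shows "c * h t \<le> h (c * t)"
  using concave_onD[OF cc_distortion_functionD(1)[OF h], of c 0 t] cc_distortion_functionD[OF h] c t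
  by simp

lemma cc_distortion_ge_id:
  assumes h: "cc_distortion_function h" and t: "0 \<le> t" "t \<le> 1"
  shows "t \<le> h t"
  using cc_distortion_le_scaled[OF h t, of 1] cc_distortion_functionD[OF h] by simp

text \<open>The ratio \<open>h t / t\<close> is nonincreasing since \<open>h\<close> is concave with
  \<open>h 0 = 0\<close>. Comparison with the ray from the origin through the point over
  \<open>t\<close> bounds \<open>h s\<close> from below for \<open>s \<le> t\<close> and from above
  for \<open>s > t\<close>; monotonicity gives the other sign.\<close>

lemma cc_distortion_increment_bound:
  assumes h: "cc_distortion_function h" and t: "0 < t" "t \<le> 1" and s: "0 \<le> s" "s \<le> 1"
  shows "\<bar>h s - h t\<bar> \<le> h t / t * \<bar>s - t\<bar>"
proof (cases "s \<le> t")
  case True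
  have "s / t * h t \<le> h (s / t * t)"
    using True t s by (intro cc_distortion_le_scaled[OF h]) auto
  moreover have "h s \<le> h t" using True s t by (intro cc_distortion_functionD(6)[OF h])
  ultimately show ?thesis using t True by (simp add: field_simps)
next
  case False
  have "t / s * h s \<le> h (t / s * s)"
    using False t s by (intro cc_distortion_le_scaled[OF h]) auto
  moreover have "h t \<le> h s" using False s t by (intro cc_distortion_functionD(6)[OF h]) auto
  ultimately show ?thesis using t False by (simp add: field_simps)
qed

text \<open>Comparison with the chords to the two endpoints of the graph, at 1 for the lower bound
  and at 0 for the upper one.\<close>

lemma cc_distortion_right_deriv_bounds:
  assumes h: "cc_distortion_function h" and t: "0 < t" "t < 1"
  shows "0 \<le> right_deriv h t" "right_deriv h t \<le> h t / t"
proof -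
  note d = cc_distortion_functionD[OF h]
  show "right_deriv h t \<le> h t / t"
    using right_deriv_concave_bounds(2)[OF d(1) t, of 0] d t by simp
  have "0 \<le> (h 1 - h t) / (1 - t)" using d t by simp
  also have "\<dots> \<le> right_deriv h t" using right_deriv_concave_bounds(1)[OF d(1) t, of 1] t by simp
  finally show "0 \<le> right_deriv h t" .
qed

lemma mono_on_unit_borel:
  fixes h :: "real \<Rightarrow> real"
  assumes h: "\<And>s t. 0 \<le> s \<Longrightarrow> s \<le> t \<Longrightarrow> t \<le> 1 \<Longrightarrow> h s \<le> h t" and f: "f \<in> borel_measurable M"
    and rng: "\<And>x. x \<in> space M \<Longrightarrow> f x \<in> {0..1}"
  shows "(\<lambda>x. h (f x)) \<in> borel_measurable M"
proof -
  \<comment> \<open>Nothing is known about \<open>h\<close> outside \<open>{0..1}\<close>; clamping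
    the argument gives a monotone function on the whole line.\<close>
  have "mono (\<lambda>t. h (max 0 (min 1 t)))"
    by (intro monoI h) auto
  then have "(\<lambda>t. h (max 0 (min 1 t))) \<in> borel_measurable borel" by (rule borel_measurable_mono)
  then have "(\<lambda>x. h (max 0 (min 1 (f x)))) \<in> borel_measurable M"
    using f by (rule measurable_compose[rotated])
  then show ?thesis using rng by (subst measurable_cong[where g="\<lambda>x. h (max 0 (min 1 (f x)))"]) auto
qed

lemma cc_distortion_borel:
  assumes "cc_distortion_function h" "f \<in> borel_measurable M" "\<And>x. x \<in> space M \<Longrightarrow> f x \<in> {0..1}"
  shows "(\<lambda>x. h (f x)) \<in> borel_measurable M"
  by (rule mono_on_unit_borel) (use assms cc_distortion_functionD(6)[OF assms(1)] in auto)

text \<open>The indicator keeps to interior points, where the right derivative is monotone; on the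
  interval of integration \<open>F0\<close> takes its values there.\<close>

lemma right_deriv_borel:
  assumes h: "concave_on {0..1} h"
  shows "(\<lambda>t. indicator {0<..<1} t * right_deriv h t) \<in> borel_measurable borel"
proof -
  have "mono_on {0<..<1} (\<lambda>t. - right_deriv h t)"
    using right_deriv_antimono[OF h] by (auto intro!: mono_onI)
  then have "(\<lambda>t. - right_deriv h t) \<in> borel_measurable (restrict_space borel {0<..<1})"
    by (rule borel_measurable_mono_on_fnc)
  then have "(\<lambda>t. - (- right_deriv h t)) \<in> borel_measurable (restrict_space borel {0<..<1})"
    by (rule borel_measurable_uminus)
  then show ?thesis by (subst (asm) borel_measurable_restrict_space_iff) (auto simp: mult.commute)
qed

section \<open>Cadlag functions and weighted norms\<close>

lemma filterlim_at_right_sequenceI: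
  fixes q :: "nat \<Rightarrow> real"
  assumes "\<And>n. x < q n" "\<And>n. q n \<le> x + 1 / real (Suc n)"
  shows "filterlim q (at_right x) sequentially"
proof -
  have "(\<lambda>n. x + inverse (real (Suc n))) \<longlonglongrightarrow> x + 0"
    by (intro tendsto_add tendsto_const LIMSEQ_inverse_real_of_nat)
  then have lim: "(\<lambda>n. x + 1 / real (Suc n)) \<longlonglongrightarrow> x" by (simp add: inverse_eq_divide)
  have "q \<longlonglongrightarrow> x"
  proof (rule tendsto_sandwich[OF _ _ tendsto_const lim])
    show "eventually (\<lambda>n. x \<le> q n) sequentially"
      by (rule always_eventually) (use assms(1) in \<open>auto intro: less_imp_le\<close>)
    show "eventually (\<lambda>n. q n \<le> x + 1 / real (Suc n)) sequentially"
      by (rule always_eventually) (use assms(2) in blast)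
  qed
  moreover have "q n \<noteq> x" for n using assms(1)[of n] by simp
  ultimately show ?thesis using assms(1) by (simp add: filterlim_at)
qed

text \<open>Moving \<open>x\<close> to a grid point on its right gives approximants that depend on
  \<open>x\<close> through an integer only, hence are measurable by countable case distinction;
  right continuity gives the pointwise limit.\<close>

lemma jointly_measurable_right_continuous:
  fixes f :: "'c \<Rightarrow> real \<Rightarrow> real"
  assumes meas: "\<And>x. (\<lambda>\<omega>. f \<omega> x) \<in> borel_measurable M"
    and rc: "\<And>\<omega> x. \<omega> \<in> space M \<Longrightarrow> continuous (at_right x) (f \<omega>)"
  shows "(\<lambda>(\<omega>, x). f \<omega> x) \<in> borel_measurable (M \<Otimes>\<^sub>M borel)"
proof (rule borel_measurable_LIMSEQ_real)
  \<comment> \<open>Floor plus one keeps the grid point strictly above \<open>x\<close>, as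
    convergence along \<open>at_right x\<close> requires.\<close>
  define q :: "nat \<Rightarrow> real \<Rightarrow> real"
    where "q n x = (real_of_int \<lfloor>x * real (Suc n)\<rfloor> + 1) / real (Suc n)" for n x
  have q: "x < q n x" "q n x \<le> x + 1 / real (Suc n)" for n x
  proof -
    have "x * real (Suc n) < real_of_int \<lfloor>x * real (Suc n)\<rfloor> + 1" by linarith
    then show "x < q n x" unfolding q_def by (simp add: pos_less_divide_eq)
    have "real_of_int \<lfloor>x * real (Suc n)\<rfloor> + 1 \<le> x * real (Suc n) + 1" by linarith
    then have "q n x \<le> (x * real (Suc n) + 1) / real (Suc n)"
      unfolding q_def by (intro divide_right_mono) auto
    then show "q n x \<le> x + 1 / real (Suc n)" by (simp add: add_divide_distrib)
  qed
  show "(\<lambda>n. (\<lambda>p. f (fst p) (q n (snd p))) z) \<longlonglongrightarrow> (\<lambda>(\<omega>, x). f \<omega> x) z"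
    if "z \<in> space (M \<Otimes>\<^sub>M borel)" for z
  proof -
    obtain \<omega> x where eq: "z = (\<omega>, x)" by (cases z)
    with that have z: "z = (\<omega>, x)" "\<omega> \<in> space M" by (auto simp: space_pair_measure)
    have "filterlim (\<lambda>n. q n x) (at_right x) sequentially"
      by (rule filterlim_at_right_sequenceI) (rule q)+
    then show ?thesis
      using rc[OF z(2), of x] unfolding z continuous_within
      by (simp add: filterlim_compose[of "f \<omega>"])
  qed
  show "(\<lambda>p. f (fst p) (q n (snd p))) \<in> borel_measurable (M \<Otimes>\<^sub>M borel)" for n
  proof -
    have "(\<lambda>p. f (fst p) ((real_of_int k + 1) / real (Suc n))) \<in> borel_measurable (M \<Otimes>\<^sub>M borel)" for k :: int
      by (intro measurable_compose[OF measurable_fst meas])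
    moreover have "(\<lambda>p. \<lfloor>snd p * real (Suc n)\<rfloor>) \<in> measurable (M \<Otimes>\<^sub>M borel) (count_space UNIV)"
      by measurable
    ultimately show ?thesis
      unfolding q_def
      by (rule measurable_compose_countable[where f="\<lambda>k p. f (fst p) ((real_of_int k + 1) / real (Suc n))"])
  qed
qed

lemma right_continuous_borel:
  fixes v :: "real \<Rightarrow> real"
  assumes "\<And>x. continuous (at_right x) v"
  shows "v \<in> borel_measurable borel"
proof -
  have "(\<lambda>(\<omega>, x). v x) \<in> borel_measurable (count_space {undefined :: unit} \<Otimes>\<^sub>M borel)"
    using assms by (intro jointly_measurable_right_continuous) auto
  from measurable_compose[OF measurable_Pair1' this, of undefined] show ?thesis by simp
qed

lemma cadlag_borel: "cadlag v \<Longrightarrow> v \<in> borel_measurable borel"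
  by (auto simp: cadlag_def intro: right_continuous_borel)

lemma cadlag_diff: "cadlag u \<Longrightarrow> cadlag v \<Longrightarrow> cadlag (\<lambda>x. u x - v x)"
  unfolding cadlag_def by (blast intro: continuous_diff tendsto_diff)

lemma cadlag_scale: "cadlag v \<Longrightarrow> cadlag (\<lambda>x. c * v x)"
  unfolding cadlag_def
  using continuous_mult[OF continuous_const[of _ c], of _ v] tendsto_mult_left[of v _ _ c] by blast

section \<open>The weighted norm and Lipschitz functions\<close>

definition wnorm :: "(real \<Rightarrow> real) \<Rightarrow> (real \<Rightarrow> real) \<Rightarrow> real" where
  "wnorm \<phi> v = real_of_ereal (weighted_norm \<phi> v)"

lemma weight_ge_1: "weight_function \<phi> \<Longrightarrow> 1 \<le> \<phi> x"
  by (simp add: weight_function_def)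

lemma weight_pos: "weight_function \<phi> \<Longrightarrow> 0 < \<phi> x"
  using weight_ge_1[of \<phi> x] by simp

lemma weighted_norm_nonneg: "0 \<le> weighted_norm \<phi> v"
  unfolding weighted_norm_def by (rule SUP_upper2[of 0]) auto

text \<open>Membership matters: for infinite norm \<open>real_of_ereal\<close> would return the
  default 0.\<close>

lemma ereal_wnorm:
  assumes "v \<in> D_weighted \<phi>"
  shows "ereal (wnorm \<phi> v) = weighted_norm \<phi> v"
  using assms weighted_norm_nonneg[of \<phi> v] unfolding D_weighted_def wnorm_def
  by (cases "weighted_norm \<phi> v") auto

lemma abs_le_wnorm:
  assumes "weight_function \<phi>" "v \<in> D_weighted \<phi>"
  shows "\<bar>v x\<bar> * \<phi> x \<le> wnorm \<phi> v"
proof -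
  have "ereal \<bar>v x * \<phi> x\<bar> \<le> ereal (wnorm \<phi> v)"
    unfolding ereal_wnorm[OF assms(2)] unfolding weighted_norm_def by (rule SUP_upper) simp
  then show ?thesis using weight_pos[OF assms(1), of x] by (simp add: abs_mult)
qed

lemma abs_le_wnorm_div:
  assumes "weight_function \<phi>" "v \<in> D_weighted \<phi>"
  shows "\<bar>v x\<bar> \<le> wnorm \<phi> v / \<phi> x"
  using abs_le_wnorm[OF assms, of x] weight_pos[OF assms(1), of x] by (simp add: field_simps)

lemma wnorm_nonneg: "0 \<le> wnorm \<phi> v"
  unfolding wnorm_def by (simp add: real_of_ereal_pos weighted_norm_nonneg)

lemma weighted_norm_le:
  assumes "weight_function \<phi>" "\<And>x. \<bar>v x\<bar> * \<phi> x \<le> c"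
  shows "weighted_norm \<phi> v \<le> ereal c"
  unfolding weighted_norm_def
  using assms(2) weight_pos[OF assms(1)] by (intro SUP_least) (simp add: abs_mult abs_of_pos)

lemma D_weightedI:
  assumes "weight_function \<phi>" "cadlag v" "\<And>x. \<bar>v x\<bar> * \<phi> x \<le> c"
  shows "v \<in> D_weighted \<phi>" "wnorm \<phi> v \<le> c"
proof -
  have "weighted_norm \<phi> v \<le> ereal c" using weighted_norm_le[OF assms(1,3)] .
  then show m: "v \<in> D_weighted \<phi>" using assms(2) by (auto simp: D_weighted_def)
  show "wnorm \<phi> v \<le> c"
    using weighted_norm_le[OF assms(1,3)] unfolding ereal_wnorm[OF m, symmetric] by simp
qed

lemma D_weighted_onD:
  assumes "v \<in> D_weighted_on \<phi> F"
  shows "v \<in> D_weighted \<phi>" "cadlag v"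
  using assms by (auto simp: D_weighted_on_def D_weighted_def)

lemma D_weighted_on_diff:
  assumes "weight_function \<phi>" "u \<in> D_weighted_on \<phi> F" "v \<in> D_weighted_on \<phi> F"
  shows "(\<lambda>x. u x - v x) \<in> D_weighted_on \<phi> F"
    and "wnorm \<phi> (\<lambda>x. u x - v x) \<le> wnorm \<phi> u + wnorm \<phi> v"
proof -
  have "\<bar>u x - v x\<bar> * \<phi> x \<le> wnorm \<phi> u + wnorm \<phi> v" for x
  proof -
    have "\<bar>u x - v x\<bar> * \<phi> x \<le> (\<bar>u x\<bar> + \<bar>v x\<bar>) * \<phi> x"
      using weight_pos[OF assms(1), of x] by (intro mult_right_mono) auto
    with abs_le_wnorm[OF assms(1) D_weighted_onD(1)[OF assms(2)], of x]
      abs_le_wnorm[OF assms(1) D_weighted_onD(1)[OF assms(3)], of x]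
    show ?thesis by (simp add: distrib_right)
  qed
  note * = D_weightedI[OF assms(1) cadlag_diff[OF D_weighted_onD(2)[OF assms(2)] D_weighted_onD(2)[OF assms(3)]] this]
  show "wnorm \<phi> (\<lambda>x. u x - v x) \<le> wnorm \<phi> u + wnorm \<phi> v" by (rule *)
  show "(\<lambda>x. u x - v x) \<in> D_weighted_on \<phi> F" using *(1) assms(2,3) by (simp add: D_weighted_on_def)
qed

lemma D_weighted_on_scale:
  assumes "weight_function \<phi>" "v \<in> D_weighted_on \<phi> F"
  shows "(\<lambda>x. c * v x) \<in> D_weighted_on \<phi> F" "wnorm \<phi> (\<lambda>x. c * v x) \<le> \<bar>c\<bar> * wnorm \<phi> v"
proof -
  have "\<bar>c * v x\<bar> * \<phi> x \<le> \<bar>c\<bar> * wnorm \<phi> v" for x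
    using mult_left_mono[OF abs_le_wnorm[OF assms(1) D_weighted_onD(1)[OF assms(2)], of x], of "\<bar>c\<bar>"]
    by (simp add: abs_mult mult.assoc)
  note * = D_weightedI[OF assms(1) cadlag_scale[OF D_weighted_onD(2)[OF assms(2)]] this]
  show "wnorm \<phi> (\<lambda>x. c * v x) \<le> \<bar>c\<bar> * wnorm \<phi> v" by (rule *)
  show "(\<lambda>x. c * v x) \<in> D_weighted_on \<phi> F" using *(1) assms(2) by (simp add: D_weighted_on_def)
qed

lemma wnorm_minus_commute: "wnorm \<phi> (\<lambda>x. u x - v x) = wnorm \<phi> (\<lambda>x. v x - u x)"
proof -
  have "\<bar>(u x - v x) * \<phi> x\<bar> = \<bar>(v x - u x) * \<phi> x\<bar>" for x
    by (simp add: abs_mult abs_minus_commute)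
  then show ?thesis by (simp add: wnorm_def weighted_norm_def)
qed

lemma wnorm_triangle:
  assumes "weight_function \<phi>" "u \<in> D_weighted_on \<phi> F" "v \<in> D_weighted_on \<phi> F"
  shows "\<bar>wnorm \<phi> u - wnorm \<phi> v\<bar> \<le> wnorm \<phi> (\<lambda>x. u x - v x)"
  using D_weighted_on_diff(2)[OF assms(1,2) D_weighted_on_diff(1)[OF assms(1,2,3)]]
    D_weighted_on_diff(2)[OF assms(1,3) D_weighted_on_diff(1)[OF assms(1,3,2)]]
    wnorm_minus_commute[of \<phi> u v]
  by simp

lemma Metric_space_D_weighted:
  assumes w: "weight_function \<phi>"
  shows "Metric_space (D_weighted_on \<phi> F) (\<lambda>u v. wnorm \<phi> (\<lambda>x. u x - v x))"
proof
  show "0 \<le> wnorm \<phi> (\<lambda>x. u x - v x)" for u v by (rule wnorm_nonneg)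
  show "wnorm \<phi> (\<lambda>x. u x - v x) = wnorm \<phi> (\<lambda>x. v x - u x)" for u v
    by (rule wnorm_minus_commute)
  show "(wnorm \<phi> (\<lambda>x. u x - v x) = 0) = (u = v)"
    if "u \<in> D_weighted_on \<phi> F" "v \<in> D_weighted_on \<phi> F" for u v
  proof
    assume "wnorm \<phi> (\<lambda>x. u x - v x) = 0"
    then have "\<bar>u x - v x\<bar> \<le> 0" for x
      using abs_le_wnorm_div[OF w D_weighted_onD(1)[OF D_weighted_on_diff(1)[OF w that]], of x] by simp
    then show "u = v" by (auto intro!: ext)
  qed (simp add: wnorm_def weighted_norm_def flip: zero_ereal_def)
  show "wnorm \<phi> (\<lambda>x. u x - z x) \<le> wnorm \<phi> (\<lambda>x. u x - v x) + wnorm \<phi> (\<lambda>x. v x - z x)"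
    if "u \<in> D_weighted_on \<phi> F" "v \<in> D_weighted_on \<phi> F" "z \<in> D_weighted_on \<phi> F" for u v z
    using D_weighted_on_diff(2)[OF w D_weighted_on_diff(1)[OF w that(1,2)] D_weighted_on_diff(1)[OF w that(3,2)]]
      wnorm_minus_commute[of \<phi> v z] by simp
qed

lemma Lipschitz_continuous_D_weighted:
  assumes w: "weight_function \<phi>"
    and lip: "\<And>u v. u \<in> D_weighted_on \<phi> F \<Longrightarrow> v \<in> D_weighted_on \<phi> F \<Longrightarrow>
      \<bar>f u - f v\<bar> \<le> L * wnorm \<phi> (\<lambda>x. u x - v x)"
  shows "continuous_map (D_weighted_topology \<phi> F) euclideanreal f"
proof -
  interpret Metric_space "D_weighted_on \<phi> F" "\<lambda>u v. wnorm \<phi> (\<lambda>x. u x - v x)"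
    using w by (rule Metric_space_D_weighted)
  have top: "D_weighted_topology \<phi> F = mtopology"
    unfolding D_weighted_topology_def wnorm_def ..
  have "continuous_map mtopology (Metric_space.mtopology UNIV dist) f"
    unfolding metric_continuous_map[OF Met_TC.Metric_space_axioms]
  proof (intro conjI ballI allI impI)
    fix u and \<epsilon> :: real
    assume u: "u \<in> D_weighted_on \<phi> F" and e: "0 < \<epsilon>"
    show "\<exists>\<delta>>0. \<forall>v. v \<in> D_weighted_on \<phi> F \<and> wnorm \<phi> (\<lambda>x. u x - v x) < \<delta> \<longrightarrow> dist (f u) (f v) < \<epsilon>"
    \<comment> \<open>\<open>L\<close> may be zero or negative, hence the radius with
      \<open>\<bar>L\<bar> + 1\<close>.\<close>
    proof (intro exI[of _ "\<epsilon> / (\<bar>L\<bar> + 1)"] conjI allI impI)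
      show "0 < \<epsilon> / (\<bar>L\<bar> + 1)" using e by (simp add: add_nonneg_pos)
      fix v assume v: "v \<in> D_weighted_on \<phi> F \<and> wnorm \<phi> (\<lambda>x. u x - v x) < \<epsilon> / (\<bar>L\<bar> + 1)"
      have "\<bar>f u - f v\<bar> \<le> L * wnorm \<phi> (\<lambda>x. u x - v x)" using lip u v by blast
      also have "\<dots> \<le> (\<bar>L\<bar> + 1) * wnorm \<phi> (\<lambda>x. u x - v x)"
        by (intro mult_right_mono wnorm_nonneg) simp
      also have "\<dots> < \<epsilon>"
        using v by (simp add: pos_less_divide_eq add_nonneg_pos mult.commute)
      finally show "dist (f u) (f v) < \<epsilon>" by (simp add: dist_real_def)
    qed
  qed simp
  then show ?thesis by (simp add: top)
qed

lemma D_weighted_on_subset_D_space: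
  assumes w: "weight_function \<phi>"
  shows "D_weighted_on \<phi> F \<subseteq> D_space"
proof
  fix v assume v: "v \<in> D_weighted_on \<phi> F"
  have "\<bar>v x\<bar> \<le> wnorm \<phi> v" for x
  proof -
    have "\<bar>v x\<bar> * 1 \<le> \<bar>v x\<bar> * \<phi> x" by (intro mult_left_mono weight_ge_1[OF w]) simp
    then show ?thesis using abs_le_wnorm[OF w D_weighted_onD(1)[OF v], of x] by simp
  qed
  then have "bounded (range v)" by (auto simp: bounded_iff)
  then show "v \<in> D_space" using D_weighted_onD(2)[OF v] by (simp add: D_space_def)
qed

section \<open>The projection sigma-algebra and admissible test functions\<close>

lemma space_D_algebra [simp]: "space D_algebra = D_space"
  unfolding D_algebra_def by (rule space_measure_of) auto

lemma space_D_weighted_algebra: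
  "weight_function \<phi> \<Longrightarrow> space (D_weighted_algebra \<phi> F) = D_weighted_on \<phi> F"
  using D_weighted_on_subset_D_space[of \<phi> F]
  by (auto simp: D_weighted_algebra_def space_restrict_space)

lemma measurable_D_algebra_eval: "(\<lambda>v. v x) \<in> borel_measurable D_algebra"
proof (rule measurableI)
  fix A :: "real set" assume "A \<in> sets borel"
  then have "{v \<in> D_space. v x \<in> A} \<in> sets D_algebra"
    unfolding D_algebra_def by (subst sets_measure_of) (auto intro!: sigma_sets.Basic)
  moreover have "(\<lambda>v. v x) -` A \<inter> space D_algebra = {v \<in> D_space. v x \<in> A}" by auto
  ultimately show "(\<lambda>v. v x) -` A \<inter> space D_algebra \<in> sets D_algebra" by simp
qed simp

lemma measurable_D_weighted_eval: "(\<lambda>v. v x) \<in> borel_measurable (D_weighted_algebra \<phi> F)"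
  unfolding D_weighted_algebra_def by (intro measurable_restrict_space1 measurable_D_algebra_eval)

text \<open>Evaluations generate the trace sigma-algebra, so it suffices to check them one at a
  time.\<close>

lemma measurable_D_weighted_algebraI:
  assumes w: "weight_function \<phi>" and f: "\<And>\<omega>. \<omega> \<in> space M \<Longrightarrow> f \<omega> \<in> D_weighted_on \<phi> F"
    and meas: "\<And>x. (\<lambda>\<omega>. f \<omega> x) \<in> borel_measurable M"
  shows "f \<in> measurable M (D_weighted_algebra \<phi> F)"
  unfolding D_weighted_algebra_def
proof (rule measurable_restrict_space2)
  show "f \<in> space M \<rightarrow> D_weighted_on \<phi> F" using f by auto
  have D: "f \<omega> \<in> D_space" if "\<omega> \<in> space M" for \<omega>
    using f[OF that] D_weighted_on_subset_D_space[OF w] by blast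
  show "f \<in> measurable M D_algebra"
    unfolding D_algebra_def
  proof (rule measurable_measure_of)
    fix A assume "A \<in> {{v \<in> D_space. v x \<in> A} |x A. A \<in> sets borel}"
    then obtain x B where A: "A = {v \<in> D_space. v x \<in> B}" "B \<in> sets borel" by auto
    have "f -` A \<inter> space M = (\<lambda>\<omega>. f \<omega> x) -` B \<inter> space M" using D by (auto simp: A)
    then show "f -` A \<inter> space M \<in> sets M" using measurable_sets[OF meas A(2)] by simp
  qed (use D in auto)
qed

text \<open>Along rationals approaching \<open>x\<close> from the right, right continuity of
  \<open>v\<close> and continuity of \<open>\<phi>\<close> recover the value at \<open>x\<close>. As
  a countable supremum the norm is measurable for the projections.\<close>

lemma weighted_norm_eq_SUP_Rats:
  assumes w: "weight_function \<phi>" and v: "cadlag v"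
  shows "weighted_norm \<phi> v = (SUP x\<in>\<rat>. ereal \<bar>v x * \<phi> x\<bar>)"
proof (rule antisym)
  show "(SUP x\<in>\<rat>. ereal \<bar>v x * \<phi> x\<bar>) \<le> weighted_norm \<phi> v"
    unfolding weighted_norm_def by (rule SUP_subset_mono) auto
  show "weighted_norm \<phi> v \<le> (SUP x\<in>\<rat>. ereal \<bar>v x * \<phi> x\<bar>)"
    unfolding weighted_norm_def
  proof (rule SUP_least)
    fix x :: real
    have "\<exists>q. q \<in> \<rat> \<and> x < q \<and> q < x + 1 / real (Suc n)" for n
      using Rats_dense_in_real[of x "x + 1 / real (Suc n)"] by auto
    then obtain q where q: "\<And>n. q n \<in> \<rat>" "\<And>n. x < q n" "\<And>n. q n < x + 1 / real (Suc n)"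
      by metis
    have "filterlim q (at_right x) sequentially"
      by (rule filterlim_at_right_sequenceI[OF q(2) less_imp_le[OF q(3)]])
    moreover have "(v \<longlongrightarrow> v x) (at_right x)" using v by (simp add: cadlag_def continuous_within)
    moreover have "(\<phi> \<longlongrightarrow> \<phi> x) (at_right x)"
      using w by (auto simp: weight_function_def continuous_on_def intro: tendsto_within_subset)
    ultimately have "(\<lambda>n. v (q n)) \<longlonglongrightarrow> v x" "(\<lambda>n. \<phi> (q n)) \<longlonglongrightarrow> \<phi> x"
      by (auto intro: filterlim_compose)
    then have "(\<lambda>n. ereal \<bar>v (q n) * \<phi> (q n)\<bar>) \<longlonglongrightarrow> ereal \<bar>v x * \<phi> x\<bar>"
      by (intro tendsto_intros)
    moreover have "ereal \<bar>v (q n) * \<phi> (q n)\<bar> \<le> (SUP x\<in>\<rat>. ereal \<bar>v x * \<phi> x\<bar>)" for n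
      using q(1)[of n] by (rule SUP_upper)
    ultimately show "ereal \<bar>v x * \<phi> x\<bar> \<le> (SUP x\<in>\<rat>. ereal \<bar>v x * \<phi> x\<bar>)"
      by (intro LIMSEQ_le_const2) blast+
  qed
qed

lemma wnorm_measurable:
  assumes w: "weight_function \<phi>"
  shows "wnorm \<phi> \<in> borel_measurable (D_weighted_algebra \<phi> F)"
proof -
  have "(\<lambda>v. real_of_ereal (SUP x\<in>\<rat>. ereal \<bar>v x * \<phi> x\<bar>)) \<in> borel_measurable (D_weighted_algebra \<phi> F)"
    by (intro borel_measurable_real_of_ereal borel_measurable_SUP countable_rat
        borel_measurable_ereal borel_measurable_abs borel_measurable_times
        measurable_D_weighted_eval borel_measurable_const)
  then show ?thesis
    by (subst measurable_cong[where g="\<lambda>v. real_of_ereal (SUP x\<in>\<rat>. ereal \<bar>v x * \<phi> x\<bar>)"])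
      (auto simp: space_D_weighted_algebra[OF w] wnorm_def weighted_norm_eq_SUP_Rats[OF w D_weighted_onD(2)])
qed

text \<open>All later uses of the convergence hypothesis go through this form, so that for each
  functional only boundedness, a Lipschitz constant and measurability have to be verified.\<close>

lemma conv_in_distr_D_Lipschitz:
  assumes w: "weight_function \<phi>" and conv: "conv_in_distr_D \<phi> F M Y N Z"
    and bdd: "\<And>v. v \<in> D_weighted_on \<phi> F \<Longrightarrow> \<bar>f v\<bar> \<le> c"
    and lip: "\<And>u v. u \<in> D_weighted_on \<phi> F \<Longrightarrow> v \<in> D_weighted_on \<phi> F \<Longrightarrow>
      \<bar>f u - f v\<bar> \<le> L * wnorm \<phi> (\<lambda>x. u x - v x)"
    and meas: "f \<in> borel_measurable (D_weighted_algebra \<phi> F)"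
  shows "(\<lambda>n. \<integral>\<omega>. f (Y n \<omega>) \<partial>M) \<longlonglongrightarrow> (\<integral>\<omega>. f (Z \<omega>) \<partial>N)"
proof -
  have "bounded (f ` D_weighted_on \<phi> F)" unfolding bounded_iff using bdd by auto
  moreover have "continuous_map (D_weighted_topology \<phi> F) euclideanreal f"
    using Lipschitz_continuous_D_weighted[OF w lip] by blast
  ultimately show ?thesis using conv meas unfolding conv_in_distr_D_def by blast
qed

section \<open>Uniform compactness and distortion functionals\<close>

abbreviation unit_cfunspace :: "(real \<Rightarrow> real) metric" where
  "unit_cfunspace \<equiv> cfunspace (top_of_set {0..1}) (euclidean_metric :: real metric)"

lemma uniform_topology_eq:
  "uniform_topology = Metric_space.mtopology (mspace unit_cfunspace) (mdist unit_cfunspace)"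
  by (simp only: uniform_topology_def mtopology_of_def)

lemma uniform_limit_imp_pointwise:
  assumes lim: "limitin uniform_topology H h sequentially" and t: "t \<in> {0..1}"
  shows "(\<lambda>n. H n t) \<longlonglongrightarrow> h t"
proof (rule LIMSEQ_I)
  interpret Metric_space "mspace unit_cfunspace" "mdist unit_cfunspace"
    by (rule Metric_space_mspace_mdist)
  fix e :: real assume "0 < e"
  with lim have "h \<in> mspace unit_cfunspace"
    and ev: "eventually (\<lambda>n. H n \<in> mspace unit_cfunspace \<and> mdist unit_cfunspace (H n) h < e) sequentially"
    unfolding uniform_topology_eq limitin_metric by auto
  from ev have "eventually (\<lambda>n. norm (H n t - h t) < e) sequentially"
  proof eventually_elim
    case (elim n)
    have "mdist euclidean_metric (H n t) (h t) \<le> mdist unit_cfunspace (H n) h"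
      by (rule mdist_cfunspace_imp_mdist_le[OF conjunct1[OF elim] \<open>h \<in> mspace unit_cfunspace\<close> order_refl])
        (use t in simp)
    also have "\<dots> < e" using elim by (rule conjunct2)
    finally show ?case by (simp only: mdist_euclidean_metric dist_real_def real_norm_def)
  qed
  then show "\<exists>N. \<forall>n\<ge>N. norm (H n t - h t) < e" by (simp add: eventually_sequentially)
qed

lemma uniform_compact_sequence:
  assumes "compactin uniform_topology \<G>" "\<And>n::nat. H n \<in> \<G>"
  obtains h \<sigma> where "h \<in> \<G>" "strict_mono \<sigma>" "limitin uniform_topology (H \<circ> \<sigma>) h sequentially"
proof -
  interpret Metric_space "mspace unit_cfunspace" "mdist unit_cfunspace"
    by (rule Metric_space_mspace_mdist)
  show thesis
    using assms that unfolding uniform_topology_eq compactin_sequentially by (metis image_subsetI)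
qed

text \<open>\<open>T\<close> need not be closed, but inside a compact set it is totally bounded, so
  finite nets of radius \<open>1 / Suc n\<close> can be taken in \<open>T\<close> itself. It will be
  \<open>\<G>\<close> or a set of near-optimal functions.\<close>

lemma uniform_compact_countable_dense:
  assumes c: "compactin uniform_topology \<G>" and T: "T \<subseteq> \<G>"
  obtains Q where "countable Q" "Q \<subseteq> T"
    "\<And>h. h \<in> T \<Longrightarrow> \<exists>H. (\<forall>n::nat. H n \<in> Q) \<and> limitin uniform_topology H h sequentially"
proof -
  interpret Metric_space "mspace unit_cfunspace" "mdist unit_cfunspace"
    by (rule Metric_space_mspace_mdist)
  have "mtotally_bounded T"
    using compactin_imp_mtotally_bounded c T mtotally_bounded_subset
    unfolding uniform_topology_eq by blast
  then have "\<exists>K. finite K \<and> K \<subseteq> T \<and> T \<subseteq> (\<Union>x\<in>K. mball x (1 / real (Suc n)))" for n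
    unfolding mtotally_bounded_def by simp
  then obtain K where K: "\<And>n. finite (K n)" "\<And>n. K n \<subseteq> T"
    "\<And>n. T \<subseteq> (\<Union>x\<in>K n. mball x (1 / real (Suc n)))"
    by metis
  show thesis
  proof (rule that[of "\<Union>n. K n"])
    show "countable (\<Union>n. K n)" using K(1) by (auto intro: countable_finite)
    show "(\<Union>n. K n) \<subseteq> T" using K(2) by auto
    fix h assume h: "h \<in> T"
    have "\<exists>x. x \<in> K n \<and> h \<in> mball x (1 / real (Suc n))" for n using K(3)[of n] h by auto
    then obtain H where H: "\<And>n. H n \<in> K n" "\<And>n. h \<in> mball (H n) (1 / real (Suc n))" by metis
    have "limitin mtopology H h sequentially"
      unfolding limitin_metric
    proof (intro conjI allI impI)
      show "h \<in> mspace unit_cfunspace" using H(2)[of 0] by (simp only: in_mball)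
      fix e :: real assume "0 < e"
      then have "eventually (\<lambda>n. inverse (real (Suc n)) < e) sequentially"
        using order_tendstoD(2)[OF LIMSEQ_inverse_real_of_nat] by blast
      then show "eventually (\<lambda>n. H n \<in> mspace unit_cfunspace \<and> mdist unit_cfunspace (H n) h < e) sequentially"
      proof eventually_elim
        case (elim n)
        have "H n \<in> mspace unit_cfunspace \<and> mdist unit_cfunspace (H n) h < 1 / real (Suc n)"
          using H(2)[of n] by (simp only: in_mball simp_thms)
        with elim show ?case by (metis inverse_eq_divide less_trans)
      qed
    qed
    then show "\<exists>H. (\<forall>n. H n \<in> (\<Union>n. K n)) \<and> limitin uniform_topology H h sequentially"
      using H(1) unfolding uniform_topology_eq by blast
  qed
qed

lemma compactin_uniform_singleton:
  assumes "cc_distortion_function g"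
  shows "compactin uniform_topology {g}"
proof -
  interpret Metric_space "mspace unit_cfunspace" "mdist unit_cfunspace"
    by (rule Metric_space_mspace_mdist)
  have "bounded (g ` {0..1})"
    using cc_distortion_functionD(4,5)[OF assms] unfolding bounded_iff by (intro exI[of _ 1]) auto
  \<comment> \<open>Points of this function space are extensional, bounded and continuous; the
    extensional encoding of distortion functions meets the first requirement.\<close>
  then have "g \<in> mspace unit_cfunspace"
    using assms
    by (auto simp: cc_distortion_function_def distortion_function_def PiE_def mbounded_iff_bounded)
  then show ?thesis unfolding uniform_topology_eq by (simp only: compactin_sing topspace_mtopology)
qed

text \<open>The risk functional of \<open>h\<close> as an explicit expression in \<open>F\<close>,
  free of the definite description in \<open>risk_functional\<close>; both agree on
  \<open>dist_funs M \<X>\<close>.\<close>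

definition distortion_functional :: "(real \<Rightarrow> real) \<Rightarrow> (real \<Rightarrow> real) \<Rightarrow> real" where
  "distortion_functional h F = (LBINT x:{..<0}. h (F x)) - (LBINT x:{0<..}. 1 - h (F x))"

lemma distortion_risk_measure_eq:
  "distortion_risk_measure M h X = distortion_functional h (dist_fun M X)"
  by (simp add: distortion_risk_measure_def distortion_functional_def)

lemma risk_functional_eqI:
  assumes "F \<in> dist_funs M \<X>" "\<And>X. X \<in> \<X> \<Longrightarrow> dist_fun M X = F \<Longrightarrow> \<rho> X = r"
  shows "risk_functional M \<X> \<rho> F = r"
  unfolding risk_functional_def using assms by (intro the_equality) (auto simp: dist_funs_def)

lemma risk_functional_distortion:
  "F \<in> dist_funs M \<X> \<Longrightarrow>
    risk_functional M \<X> (distortion_risk_measure M h) F = distortion_functional h F"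
  by (rule risk_functional_eqI) (auto simp: distortion_risk_measure_eq)

context prob_space
begin

lemma dist_fun_eq_prob:
  "X \<in> borel_measurable M \<Longrightarrow> dist_fun M X x = prob {\<omega> \<in> space M. X \<omega> \<le> x}"
  by (simp add: dist_fun_def cdf_def measure_distr vimage_def Int_def conj_commute)

lemma dist_fun_props:
  assumes X: "X \<in> borel_measurable M"
  shows "mono (dist_fun M X)" "\<And>x. continuous (at_right x) (dist_fun M X)"
    "\<And>x. 0 \<le> dist_fun M X x" "\<And>x. dist_fun M X x \<le> 1"
    "(dist_fun M X \<longlongrightarrow> 0) at_bot" "(dist_fun M X \<longlongrightarrow> 1) at_top"
proof -
  interpret D: real_distribution "distr M borel X" using X by (rule real_distribution_distr)
  show "mono (dist_fun M X)" unfolding dist_fun_def using D.cdf_nondecreasing by (auto intro: monoI)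
  show "continuous (at_right x) (dist_fun M X)" for x
    unfolding dist_fun_def by (rule D.cdf_is_right_cont)
  show "0 \<le> dist_fun M X x" "dist_fun M X x \<le> 1" for x
    unfolding dist_fun_def by (rule D.cdf_nonneg, rule D.cdf_bounded_prob)
  show "(dist_fun M X \<longlongrightarrow> 0) at_bot" "(dist_fun M X \<longlongrightarrow> 1) at_top"
    unfolding dist_fun_def by (rule D.cdf_lim_at_bot, rule D.cdf_lim_at_top_prob)
qed

lemma dist_fun_borel: "X \<in> borel_measurable M \<Longrightarrow> dist_fun M X \<in> borel_measurable borel"
  by (rule borel_measurable_mono[OF dist_fun_props(1)])

lemma one_minus_dist_fun:
  assumes "X \<in> borel_measurable M"
  shows "1 - dist_fun M X x = prob {\<omega> \<in> space M. x < X \<omega>}"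
proof -
  have "{\<omega> \<in> space M. x < X \<omega>} = space M - {\<omega> \<in> space M. X \<omega> \<le> x}" by auto
  moreover have "{\<omega> \<in> space M. X \<omega> \<le> x} \<in> events" using assms by measurable
  ultimately show ?thesis using dist_fun_eq_prob[OF assms] by (simp add: prob_compl)
qed

text \<open>Admissibility speaks of the law of \<open>\<bar>X\<bar>\<close>. The lower tail is
  dominated through monotonicity of \<open>h\<close>, the upper tail through
  \<open>t \<le> h t\<close>, used twice.\<close>

lemma distortion_admissible_integrable:
  assumes X: "X \<in> borel_measurable M" and h: "cc_distortion_function h"
    and adm: "distortion_admissible M h X"
  shows "set_integrable lborel {..<0} (\<lambda>x. h (dist_fun M X x))"
    and "set_integrable lborel {0<..} (\<lambda>x. 1 - h (dist_fun M X x))"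
proof -
  let ?F = "dist_fun M X" and ?A = "dist_fun M (\<lambda>\<omega>. \<bar>X \<omega>\<bar>)"
  define G where "G x = indicator {0<..} x * h (1 - ?A x)" for x
  have abs[measurable]: "(\<lambda>\<omega>. \<bar>X \<omega>\<bar>) \<in> borel_measurable M" using X by measurable
  note [measurable] = X
  note dX = dist_fun_props[OF X] and dA = dist_fun_props[OF abs]
  note hD = cc_distortion_functionD[OF h]
  have G: "integrable lborel G"
    using adm by (simp add: distortion_admissible_def set_integrable_def G_def[abs_def])
  have hF: "(\<lambda>x. h (?F x)) \<in> borel_measurable borel"
    using dX by (intro cc_distortion_borel[OF h dist_fun_borel[OF X]]) auto
  have "integrable lborel (\<lambda>x. G (0 + (- (1 / 2)) * x))"
    using G by (rule lborel_integrable_real_affine) simp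
  then have G2: "integrable lborel (\<lambda>x. G (- x / 2))" by simp
  \<comment> \<open>The halving turns the weak inequality \<open>X \<omega> \<le> x < 0\<close> into
    the strict one \<open>- x / 2 < \<bar>X \<omega>\<bar>\<close>.\<close>
  have left: "?F x \<le> 1 - ?A (- x / 2)" if "x < 0" for x
    unfolding dist_fun_eq_prob[OF X] one_minus_dist_fun[OF abs]
    using that by (intro finite_measure_mono) auto
  show "set_integrable lborel {..<0} (\<lambda>x. h (?F x))"
    unfolding set_integrable_def
  proof (rule Bochner_Integration.integrable_bound[OF G2])
    show "AE x in lborel. norm (indicator {..<0} x *\<^sub>R h (?F x)) \<le> norm (G (- x / 2))"
    proof (rule AE_I2)
      fix x :: real
      show "norm (indicator {..<0} x *\<^sub>R h (?F x)) \<le> norm (G (- x / 2))"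
      proof (cases "x < 0")
        case True
        have "0 \<le> h (?F x)" "h (?F x) \<le> h (1 - ?A (- x / 2))"
          using left[OF True] dX dA by (auto intro!: hD)
        then show ?thesis using True by (simp add: G_def)
      qed simp
    qed
  qed (use hF in measurable)
  have right: "1 - h (?F x) \<le> h (1 - ?A x)" for x
  proof -
    have "1 - h (?F x) \<le> 1 - ?F x" using cc_distortion_ge_id[OF h] dX by simp
    also have "\<dots> \<le> 1 - ?A x"
      unfolding one_minus_dist_fun[OF X] one_minus_dist_fun[OF abs]
      by (intro finite_measure_mono) auto
    also have "\<dots> \<le> h (1 - ?A x)" using cc_distortion_ge_id[OF h] dA by simp
    finally show ?thesis .
  qed
  show "set_integrable lborel {0<..} (\<lambda>x. 1 - h (?F x))"
    unfolding set_integrable_def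
  proof (rule Bochner_Integration.integrable_bound[OF G])
    show "AE x in lborel. norm (indicator {0<..} x *\<^sub>R (1 - h (?F x))) \<le> norm (G x)"
    proof (rule AE_I2)
      fix x :: real
      have "0 \<le> 1 - h (?F x)" using hD(5) dX by simp
      then show "norm (indicator {0<..} x *\<^sub>R (1 - h (?F x))) \<le> norm (G x)"
        using right[of x] by (auto simp: G_def indicator_def)
    qed
  qed (use hF in measurable)
qed

end

text \<open>On either half-line the difference contributes the integral of
  \<open>h (F x) - h (F0 x)\<close>, since the constants 1 cancel on the right. This integrand
  vanishes outside \<open>[a, b]\<close>, and the point 0 and finite endpoints are null.\<close>

lemma distortion_functional_diff:
  fixes F F0 :: "real \<Rightarrow> real" and a b :: ereal
  assumes int: "set_integrable lborel {..<0} (\<lambda>x. h (F x))" "set_integrable lborel {..<0} (\<lambda>x. h (F0 x))"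
    "set_integrable lborel {0<..} (\<lambda>x. 1 - h (F x))" "set_integrable lborel {0<..} (\<lambda>x. 1 - h (F0 x))"
    and eq: "\<And>x. ereal x \<notin> {a..b} \<Longrightarrow> F x = F0 x"
  shows "set_integrable lborel (einterval a b) (\<lambda>x. h (F x) - h (F0 x))"
    and "distortion_functional h F - distortion_functional h F0 =
      (LBINT x:einterval a b. h (F x) - h (F0 x))"
proof -
  let ?d = "\<lambda>x. h (F x) - h (F0 x)" and ?U = "{..<0} \<union> {0<..} :: real set"
  have 1: "set_integrable lborel {..<0} ?d" using int(1,2) by (rule set_integral_diff)
  have "set_integrable lborel {0<..} (\<lambda>x. (1 - h (F0 x)) - (1 - h (F x)))"
    using int(4,3) by (rule set_integral_diff)
  then have 2: "set_integrable lborel {0<..} ?d" by simp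
  have U: "set_integrable lborel ?U ?d" using 1 2 by (intro set_integrable_Un) auto
  have ae: "AE x in lborel. indicator ?U x *\<^sub>R ?d x = indicator (einterval a b) x *\<^sub>R ?d x"
    using AE_lborel_singleton[of 0] AE_lborel_singleton[of "real_of_ereal a"]
      AE_lborel_singleton[of "real_of_ereal b"]
  proof eventually_elim
    case (elim x)
    show ?case
    proof (cases "x \<in> einterval a b")
      case True
      with elim show ?thesis by (auto simp: indicator_def)
    next
      case False
      have "ereal x \<notin> {a..b}"
      proof
        assume "ereal x \<in> {a..b}"
        moreover have "ereal x \<noteq> a" "ereal x \<noteq> b" using elim by auto
        ultimately show False using False by (auto simp: einterval_def less_le)
      qed
      then show ?thesis using eq by simp
    qed
  qed
  \<comment> \<open>Measurability is known only off the point 0, which may lie in the interval; its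
    value is added back separately.\<close>
  have m: "(\<lambda>x. indicator (einterval a b) x *\<^sub>R ?d x) \<in> borel_measurable lborel"
  proof -
    have "(\<lambda>x. indicator ?U x *\<^sub>R ?d x) \<in> borel_measurable lborel"
      using U unfolding set_integrable_def by (rule borel_measurable_integrable)
    then have "(\<lambda>x. indicator (einterval a b) x *\<^sub>R (indicator ?U x *\<^sub>R ?d x) +
        indicator (einterval a b \<inter> {0}) x *\<^sub>R ?d 0) \<in> borel_measurable lborel"
      by measurable
    moreover have "(\<lambda>x. indicator (einterval a b) x *\<^sub>R (indicator ?U x *\<^sub>R ?d x) +
        indicator (einterval a b \<inter> {0}) x *\<^sub>R ?d 0) = (\<lambda>x. indicator (einterval a b) x *\<^sub>R ?d x)"
      by (rule ext) (auto simp: indicator_def)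
    ultimately show ?thesis by simp
  qed
  show int': "set_integrable lborel (einterval a b) ?d"
    using U ae m unfolding set_integrable_def
    by (subst integrable_cong_AE[where g="\<lambda>x. indicator ?U x *\<^sub>R ?d x"]) (auto simp: borel_measurable_integrable)
  have "distortion_functional h F - distortion_functional h F0 =
      ((LBINT x:{..<0}. h (F x)) - (LBINT x:{..<0}. h (F0 x))) +
      ((LBINT x:{0<..}. 1 - h (F0 x)) - (LBINT x:{0<..}. 1 - h (F x)))"
    by (simp add: distortion_functional_def)
  also have "(LBINT x:{..<0}. h (F x)) - (LBINT x:{..<0}. h (F0 x)) = (LBINT x:{..<0}. ?d x)"
    using set_integral_diff(2)[OF int(1,2)] by simp
  also have "(LBINT x:{0<..}. 1 - h (F0 x)) - (LBINT x:{0<..}. 1 - h (F x)) = (LBINT x:{0<..}. ?d x)"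
    using set_integral_diff(2)[OF int(4,3)] by simp
  also have "(LBINT x:{..<0}. ?d x) + (LBINT x:{0<..}. ?d x) = (LBINT x:?U. ?d x)"
    by (rule set_integral_Un[OF _ 1 2, symmetric]) auto
  also have "\<dots> = (LBINT x:einterval a b. ?d x)"
    unfolding set_lebesgue_integral_def using ae U m
    by (intro integral_cong_AE) (auto simp: set_integrable_def borel_measurable_integrable)
  finally show "distortion_functional h F - distortion_functional h F0 =
      (LBINT x:einterval a b. h (F x) - h (F0 x))" .
qed

section \<open>Uniform first-order expansion of the distortion functionals\<close>

text \<open>The interval is open at both ends, which excludes the values 0 and 1. Thus right
  derivatives at \<open>F x\<close> are taken at interior points, and division by \<open>F x\<close>
  is legitimate.\<close>

lemma quantile_interval_range:
  assumes F: "mono F" and x: "x \<in> einterval (right_quantile F 0) (left_quantile F 1)"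
  shows "0 < F x" "F x < 1"
proof -
  have q: "right_quantile F 0 < ereal x" "ereal x < left_quantile F 1"
    using x by (auto simp: einterval_def)
  from q(1) obtain y where "0 < F y" "y < x" by (auto simp: right_quantile_def Inf_less_iff)
  moreover have "F y \<le> F x" using monoD[OF F, of y x] \<open>y < x\<close> by simp
  ultimately show "0 < F x" by simp
  show "F x < 1"
  proof (rule ccontr)
    assume "\<not> F x < 1"
    then have "left_quantile F 1 \<le> ereal x"
      unfolding left_quantile_def by (intro Inf_lower) auto
    then show False using q(2) by simp
  qed
qed

text \<open>The common ground of both sets of assumptions. Kinks are avoided for almost every
  \<open>x\<close>, separately for each \<open>h\<close>: an uncountable family has no common
  exceptional null set in general.\<close>

locale risk_setting = prob_space M for M :: "'a measure" +
  fixes \<X> :: "('a \<Rightarrow> real) set" and \<rho> :: "('a \<Rightarrow> real) \<Rightarrow> real" and \<G> :: "(real \<Rightarrow> real) set"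
    and F0 \<phi> :: "real \<Rightarrow> real" and \<gamma> :: real
  assumes model: "model_space M \<X>"
    and representing: "representing_set M \<X> \<rho> \<G>"
    and F0: "F0 \<in> dist_funs M \<X>"
    and weight: "weight_function \<phi>"
    and gamma: "0 < \<gamma>" "\<gamma> < 1"
    and integrable_weight: "set_integrable lborel (einterval (right_quantile F0 0) (left_quantile F0 1))
      (\<lambda>x. assoc_distortion M \<rho> (\<gamma> * F0 x) / (F0 x * \<phi> x))"
    and kinks: "\<And>h. h \<in> \<G> \<Longrightarrow>
      AE x in lborel. x \<in> einterval (right_quantile F0 0) (left_quantile F0 1) \<longrightarrow> kink_free h (F0 x)"
begin

abbreviation "E \<equiv> einterval (right_quantile F0 0) (left_quantile F0 1)"
abbreviation "D \<equiv> D_weighted_on \<phi> F0"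
abbreviation "\<D> \<equiv> D_weighted_algebra \<phi> F0"
abbreviation "\<F> \<equiv> dist_funs M \<X>"
abbreviation "R \<equiv> risk_functional M \<X> \<rho>"
abbreviation "L \<equiv> deriv_integral F0"

text \<open>The dominating function; its factor \<open>1 / \<gamma>\<close> is the price of
  \<open>\<gamma> * h t \<le> h (\<gamma> * t)\<close>. Its integral \<open>K\<close> becomes the
  common Lipschitz constant of the functionals below.\<close>

definition "W x = assoc_distortion M \<rho> (\<gamma> * F0 x) / (\<gamma> * (F0 x * \<phi> x))"
definition "K = (LBINT x:E. W x)"

lemma model_measurable: "X \<in> \<X> \<Longrightarrow> X \<in> borel_measurable M"
  using model by (auto simp: model_space_def)

lemma F_props:
  assumes "F \<in> \<F>"
  shows "mono F" "\<And>x. continuous (at_right x) F" "\<And>x. 0 \<le> F x" "\<And>x. F x \<le> 1"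
    "(F \<longlongrightarrow> 0) at_bot" "(F \<longlongrightarrow> 1) at_top" "F \<in> borel_measurable borel"
  using assms dist_fun_props dist_fun_borel model_measurable unfolding dist_funs_def by blast+

lemma cc: "h \<in> \<G> \<Longrightarrow> cc_distortion_function h"
  using representing by (simp add: representing_set_def)

lemma compact_G: "compactin uniform_topology \<G>"
  using representing by (simp add: representing_set_def)

lemma le_assoc: "h \<in> \<G> \<Longrightarrow> 0 \<le> t \<Longrightarrow> t \<le> 1 \<Longrightarrow> h t \<le> assoc_distortion M \<rho> t"
proof -
  assume h: "h \<in> \<G>" and t: "0 \<le> t" "t \<le> 1"
  then have "ereal (assoc_distortion M \<rho> t) = (SUP g\<in>\<G>. ereal (g t))"
    using representing by (simp add: representing_set_def)
  moreover have "ereal (h t) \<le> (SUP g\<in>\<G>. ereal (g t))" using h by (rule SUP_upper)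
  ultimately show ?thesis by (metis ereal_less_eq(3))
qed

text \<open>The supremum formula depends on \<open>X\<close> through \<open>dist_fun M X\<close>
  alone, which makes the definite description in \<open>risk_functional\<close> well
  defined.\<close>

lemma R_eq_SUP:
  assumes F: "F \<in> \<F>"
  shows "ereal (R F) = (SUP h\<in>\<G>. ereal (distortion_functional h F))"
proof -
  have *: "ereal (\<rho> X) = (SUP h\<in>\<G>. ereal (distortion_functional h (dist_fun M X)))" if "X \<in> \<X>" for X
    using representing that by (simp add: representing_set_def distortion_risk_measure_eq)
  obtain X where X: "X \<in> \<X>" "dist_fun M X = F" using F by (auto simp: dist_funs_def)
  have "R F = \<rho> X"
    using * X by (intro risk_functional_eqI F) (metis ereal.inject)
  then show ?thesis using *[OF X(1)] X(2) by simp
qed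

lemma distortion_functional_le_R: "h \<in> \<G> \<Longrightarrow> F \<in> \<F> \<Longrightarrow> distortion_functional h F \<le> R F"
  using SUP_upper[of h \<G> "\<lambda>h. ereal (distortion_functional h F)"] R_eq_SUP[of F]
  by (metis ereal_less_eq(3))

lemma R_approx:
  assumes "F \<in> \<F>" "c < R F"
  obtains h where "h \<in> \<G>" "c < distortion_functional h F"
proof -
  have "ereal c < (SUP h\<in>\<G>. ereal (distortion_functional h F))"
    using assms(2) R_eq_SUP[OF assms(1)] by (metis less_ereal.simps(1))
  then show thesis using that by (auto simp: less_SUP_iff)
qed

lemma F_integrable:
  assumes "F \<in> \<F>" "h \<in> \<G>"
  shows "set_integrable lborel {..<0} (\<lambda>x. h (F x))"
    and "set_integrable lborel {0<..} (\<lambda>x. 1 - h (F x))"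
proof -
  obtain X where X: "X \<in> \<X>" "F = dist_fun M X" using assms(1) by (auto simp: dist_funs_def)
  have "distortion_admissible M h X"
    using representing X(1) assms(2) by (simp add: representing_set_def)
  note * = distortion_admissible_integrable[OF model_measurable[OF X(1)] cc[OF assms(2)] this]
  show "set_integrable lborel {..<0} (\<lambda>x. h (F x))" "set_integrable lborel {0<..} (\<lambda>x. 1 - h (F x))"
    using * X(2) by simp_all
qed

lemma E_F0:
  assumes "x \<in> E"
  shows "0 < F0 x" "F0 x < 1"
  by (rule quantile_interval_range[OF F_props(1)[OF F0] assms])+

lemma quantiles_le: "right_quantile F0 0 \<le> left_quantile F0 1"
  unfolding right_quantile_def left_quantile_def by (intro Inf_superset_mono image_mono) auto

lemma F0_borel [measurable]: "F0 \<in> borel_measurable borel"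
  by (rule F_props(7)[OF F0])

lemma W_integrable: "set_integrable lborel E W"
proof -
  have "set_integrable lborel E (\<lambda>x. (1 / \<gamma>) * (assoc_distortion M \<rho> (\<gamma> * F0 x) / (F0 x * \<phi> x)))"
    using integrable_weight by (rule set_integrable_mult_right)
  moreover have "(\<lambda>x. (1 / \<gamma>) * (assoc_distortion M \<rho> (\<gamma> * F0 x) / (F0 x * \<phi> x))) = W"
    unfolding W_def by (rule ext) simp
  ultimately show ?thesis by simp
qed

lemma G_nonempty: "\<G> \<noteq> {}"
proof
  assume "\<G> = {}"
  then show False using R_eq_SUP[OF F0] by (simp add: bot_ereal_def)
qed

text \<open>Concavity moves \<open>\<gamma>\<close> inside the argument, and \<open>h\<close> lies
  below the associated distortion; here the shrunken argument of the integrability assumption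
  enters.\<close>

lemma slope_le_W:
  assumes h: "h \<in> \<G>" and x: "x \<in> E"
  shows "h (F0 x) / F0 x \<le> W x * \<phi> x"
proof -
  note F = E_F0[OF x]
  have "\<gamma> * h (F0 x) \<le> h (\<gamma> * F0 x)"
    using F gamma by (intro cc_distortion_le_scaled[OF cc[OF h]]) auto
  also have "\<dots> \<le> assoc_distortion M \<rho> (\<gamma> * F0 x)"
    using F gamma by (intro le_assoc h) (auto intro!: mult_le_one)
  finally have "h (F0 x) \<le> assoc_distortion M \<rho> (\<gamma> * F0 x) / \<gamma>"
    using gamma by (simp add: field_simps)
  then have "h (F0 x) / F0 x \<le> assoc_distortion M \<rho> (\<gamma> * F0 x) / \<gamma> / F0 x"
    using F by (intro divide_right_mono) auto
  also have "\<dots> = W x * \<phi> x" using weight_pos[OF weight, of x] by (simp add: W_def)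
  finally show ?thesis .
qed

lemma W_nonneg:
  assumes "x \<in> E"
  shows "0 \<le> W x"
proof -
  obtain h where h: "h \<in> \<G>" using G_nonempty by auto
  have "0 \<le> h (F0 x) / F0 x"
    using E_F0[OF assms] cc_distortion_functionD(4)[OF cc[OF h], of "F0 x"] by simp
  also have "\<dots> \<le> W x * \<phi> x" using slope_le_W[OF h assms] .
  finally show ?thesis using weight_pos[OF weight, of x] by (simp add: zero_le_mult_iff)
qed

lemma K_nonneg: "0 \<le> K"
  unfolding K_def set_lebesgue_integral_def using W_nonneg
  by (intro integral_nonneg_AE AE_I2) (auto simp: indicator_def)

lemma slope_mult_le:
  assumes h: "h \<in> \<G>" and x: "x \<in> E" and v: "v \<in> D_weighted \<phi>"
  shows "h (F0 x) / F0 x * \<bar>v x\<bar> \<le> wnorm \<phi> v * W x"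
proof -
  have "h (F0 x) / F0 x * \<bar>v x\<bar> \<le> (W x * \<phi> x) * (wnorm \<phi> v / \<phi> x)"
    using slope_le_W[OF h x] abs_le_wnorm_div[OF weight v] W_nonneg[OF x] weight_pos[OF weight, of x]
    by (intro mult_mono) auto
  then show ?thesis using weight_pos[OF weight, of x] by (simp add: mult.commute)
qed

text \<open>The oriented integral would change sign for endpoints in reverse order, which
  \<open>quantiles_le\<close> excludes.\<close>

lemma deriv_integral_eq: "L h v = (LBINT x:E. right_deriv h (F0 x) * v x)"
  unfolding deriv_integral_def interval_lebesgue_integral_def using quantiles_le by simp

lemma integrand_borel:
  assumes h: "h \<in> \<G>" and v: "v \<in> borel_measurable borel"
  shows "(\<lambda>x. indicator E x *\<^sub>R (right_deriv h (F0 x) * v x)) \<in> borel_measurable borel"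
proof -
  have "(\<lambda>x. indicator {0<..<1} (F0 x) * right_deriv h (F0 x)) \<in> borel_measurable borel"
    using F0_borel right_deriv_borel[OF cc_distortion_functionD(1)[OF cc[OF h]]]
    by (rule measurable_compose)
  then have *: "(\<lambda>x. indicator E x *\<^sub>R ((indicator {0<..<1} (F0 x) * right_deriv h (F0 x)) * v x))
      \<in> borel_measurable borel"
    using v by measurable
  have eq: "indicator E x *\<^sub>R ((indicator {0<..<1} (F0 x) * right_deriv h (F0 x)) * v x) =
      indicator E x *\<^sub>R (right_deriv h (F0 x) * v x)" for x
    using E_F0[of x] by (auto simp: indicator_def)
  show ?thesis using * unfolding eq .
qed

lemma integrand_bound:
  assumes h: "h \<in> \<G>" and x: "x \<in> E" and v: "v \<in> D"
  shows "\<bar>right_deriv h (F0 x) * v x\<bar> \<le> wnorm \<phi> v * W x"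
proof -
  note F = E_F0[OF x]
  have "\<bar>right_deriv h (F0 x) * v x\<bar> \<le> h (F0 x) / F0 x * \<bar>v x\<bar>"
    using cc_distortion_right_deriv_bounds[OF cc[OF h] F] by (simp add: abs_mult mult_right_mono del: times_divide_eq_left)
  also have "\<dots> \<le> wnorm \<phi> v * W x" by (rule slope_mult_le[OF h x D_weighted_onD(1)[OF v]])
  finally show ?thesis .
qed

lemma integrand_integrable:
  assumes h: "h \<in> \<G>" and v: "v \<in> D"
  shows "set_integrable lborel E (\<lambda>x. right_deriv h (F0 x) * v x)"
proof -
  have "set_integrable lborel E (\<lambda>x. wnorm \<phi> v * W x)"
    by (rule set_integrable_mult_right[OF W_integrable])
  then show ?thesis
    unfolding set_integrable_def
  proof (rule Bochner_Integration.integrable_bound)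
    show "(\<lambda>x. indicator E x *\<^sub>R (right_deriv h (F0 x) * v x)) \<in> borel_measurable lborel"
      using integrand_borel[OF h cadlag_borel[OF D_weighted_onD(2)[OF v]]] by simp
    have "norm (indicator E x *\<^sub>R (right_deriv h (F0 x) * v x)) \<le> norm (indicator E x *\<^sub>R (wnorm \<phi> v * W x))" for x
      using integrand_bound[OF h _ v, of x] by (cases "x \<in> E") auto
    then show "AE x in lborel. norm (indicator E x *\<^sub>R (right_deriv h (F0 x) * v x))
        \<le> norm (indicator E x *\<^sub>R (wnorm \<phi> v * W x))" by simp
  qed
qed

lemma set_integral_le_K:
  assumes f: "set_integrable lborel E f" and b: "\<And>x. x \<in> E \<Longrightarrow> \<bar>f x\<bar> \<le> c * W x"
  shows "\<bar>LBINT x:E. f x\<bar> \<le> K * c"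
proof -
  have "\<bar>LBINT x:E. f x\<bar> \<le> (LBINT x:E. \<bar>f x\<bar>)"
    using set_integral_norm_bound[OF f] by simp
  also have "\<dots> \<le> (LBINT x:E. c * W x)"
    using f b by (intro set_integral_mono set_integrable_abs set_integrable_mult_right W_integrable) auto
  finally show ?thesis by (simp add: K_def mult.commute)
qed

lemma L_bound: "h \<in> \<G> \<Longrightarrow> v \<in> D \<Longrightarrow> \<bar>L h v\<bar> \<le> K * wnorm \<phi> v"
  unfolding deriv_integral_eq by (intro set_integral_le_K integrand_integrable integrand_bound)

lemma L_diff:
  assumes "h \<in> \<G>" "u \<in> D" "v \<in> D"
  shows "L h u - L h v = L h (\<lambda>x. u x - v x)"
  unfolding deriv_integral_eq
  using set_integral_diff(2)[OF integrand_integrable[OF assms(1,2)] integrand_integrable[OF assms(1,3)]]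
  by (simp add: right_diff_distrib)

text \<open>The constant \<open>K\<close> does not depend on \<open>h\<close>, so suprema over
  nonempty sets of \<open>h\<close> inherit it.\<close>

lemma L_Lipschitz:
  assumes "h \<in> \<G>" "u \<in> D" "v \<in> D"
  shows "\<bar>L h u - L h v\<bar> \<le> K * wnorm \<phi> (\<lambda>x. u x - v x)"
  unfolding L_diff[OF assms] using assms by (intro L_bound D_weighted_on_diff(1) weight)

lemma eq_outside:
  assumes "(\<lambda>x. F x - F0 x) \<in> D" "ereal x \<notin> {right_quantile F0 0..left_quantile F0 1}"
  shows "F x = F0 x"
  using assms unfolding D_weighted_on_def by auto

lemma increment_integral:
  assumes h: "h \<in> \<G>" and F: "F \<in> \<F>" and d: "(\<lambda>x. F x - F0 x) \<in> D"
  shows "set_integrable lborel E (\<lambda>x. h (F x) - h (F0 x))"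
    and "distortion_functional h F - distortion_functional h F0 = (LBINT x:E. h (F x) - h (F0 x))"
  using distortion_functional_diff[OF F_integrable(1)[OF F h] F_integrable(1)[OF F0 h]
      F_integrable(2)[OF F h] F_integrable(2)[OF F0 h] eq_outside[OF d]] by auto

lemma increment_bound:
  assumes h: "h \<in> \<G>" and F: "F \<in> \<F>" and d: "(\<lambda>x. F x - F0 x) \<in> D" and x: "x \<in> E"
  shows "\<bar>h (F x) - h (F0 x)\<bar> \<le> wnorm \<phi> (\<lambda>x. F x - F0 x) * W x"
proof -
  have "\<bar>h (F x) - h (F0 x)\<bar> \<le> h (F0 x) / F0 x * \<bar>F x - F0 x\<bar>"
    using E_F0[OF x] F_props(3,4)[OF F] by (intro cc_distortion_increment_bound[OF cc[OF h]]) auto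
  also have "\<dots> \<le> wnorm \<phi> (\<lambda>x. F x - F0 x) * W x"
    by (rule slope_mult_le[OF h x D_weighted_onD(1)[OF d]])
  finally show ?thesis .
qed

lemma distortion_functional_Lipschitz:
  assumes h: "h \<in> \<G>" and F: "F \<in> \<F>" and d: "(\<lambda>x. F x - F0 x) \<in> D"
  shows "\<bar>distortion_functional h F - distortion_functional h F0\<bar> \<le> K * wnorm \<phi> (\<lambda>x. F x - F0 x)"
  unfolding increment_integral(2)[OF assms]
  by (intro set_integral_le_K increment_integral(1)[OF assms] increment_bound assms)

text \<open>The supergradient inequality, integrated over \<open>E\<close>. It holds at every scale
  \<open>r\<close> without a remainder.\<close>

lemma quotient_le_L:
  assumes h: "h \<in> \<G>" and F: "F \<in> \<F>" and d: "(\<lambda>x. F x - F0 x) \<in> D" and r: "0 < r"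
  shows "r * (distortion_functional h F - distortion_functional h F0) \<le> L h (\<lambda>x. r * (F x - F0 x))"
proof -
  have "r * (LBINT x:E. h (F x) - h (F0 x)) = (LBINT x:E. r * (h (F x) - h (F0 x)))" by simp
  also have "\<dots> \<le> (LBINT x:E. right_deriv h (F0 x) * (r * (F x - F0 x)))"
  proof (rule set_integral_mono)
    show "set_integrable lborel E (\<lambda>x. r * (h (F x) - h (F0 x)))"
      by (intro set_integrable_mult_right increment_integral(1) assms)
    show "set_integrable lborel E (\<lambda>x. right_deriv h (F0 x) * (r * (F x - F0 x)))"
      by (intro integrand_integrable[OF h] D_weighted_on_scale(1) weight d)
    fix x assume x: "x \<in> E"
    have "h (F x) - h (F0 x) \<le> right_deriv h (F0 x) * (F x - F0 x)"
      using E_F0[OF x] F_props(3,4)[OF F]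
      by (intro right_deriv_supergradient cc_distortion_functionD(1)[OF cc[OF h]]) auto
    from mult_left_mono[OF this, of r] r
    show "r * (h (F x) - h (F0 x)) \<le> right_deriv h (F0 x) * (r * (F x - F0 x))"
      by (simp add: mult.left_commute)
  qed
  finally show ?thesis unfolding increment_integral(2)[OF h F d] deriv_integral_eq .
qed

lemma G_sequence:
  assumes "\<And>n::nat. H n \<in> \<G>"
  obtains h \<sigma> where "h \<in> \<G>" "strict_mono \<sigma>" "limitin uniform_topology (H \<circ> \<sigma>) h sequentially"
  by (rule uniform_compact_sequence[OF compact_G assms], rule that, assumption+)

text \<open>Right derivatives converge at \<open>F0 x\<close> wherever the limit \<open>h\<close>
  has no kink, that is for almost every \<open>x\<close> in \<open>E\<close>, and a multiple of
  \<open>W\<close> dominates.\<close>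

lemma L_continuous:
  assumes H: "\<And>n::nat. H n \<in> \<G>" and h: "h \<in> \<G>"
    and lim: "limitin uniform_topology H h sequentially" and v: "v \<in> D"
  shows "(\<lambda>n. L (H n) v) \<longlonglongrightarrow> L h v"
  unfolding deriv_integral_eq set_lebesgue_integral_def
proof (rule integral_dominated_convergence)
  have vb: "v \<in> borel_measurable borel" using v by (intro cadlag_borel D_weighted_onD(2))
  show "(\<lambda>x. indicator E x *\<^sub>R (right_deriv h (F0 x) * v x)) \<in> borel_measurable lborel"
    "(\<lambda>x. indicator E x *\<^sub>R (right_deriv (H n) (F0 x) * v x)) \<in> borel_measurable lborel" for n
    using integrand_borel[OF h vb] integrand_borel[OF H vb] by simp_all
  show "integrable lborel (\<lambda>x. indicator E x *\<^sub>R (wnorm \<phi> v * W x))"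
    using set_integrable_mult_right[OF W_integrable] unfolding set_integrable_def by blast
  have "norm (indicator E x *\<^sub>R (right_deriv (H n) (F0 x) * v x)) \<le> indicator E x *\<^sub>R (wnorm \<phi> v * W x)" for n x
    using integrand_bound[OF H _ v, of x] by (cases "x \<in> E") auto
  then show "AE x in lborel. norm (indicator E x *\<^sub>R (right_deriv (H n) (F0 x) * v x))
      \<le> indicator E x *\<^sub>R (wnorm \<phi> v * W x)" for n by simp
  show "AE x in lborel. (\<lambda>n. indicator E x *\<^sub>R (right_deriv (H n) (F0 x) * v x))
      \<longlonglongrightarrow> indicator E x *\<^sub>R (right_deriv h (F0 x) * v x)"
    using kinks[OF h]
  proof eventually_elim
    case (elim x)
    show ?case
    proof (cases "x \<in> E")
      case True
      have "(\<lambda>n. right_deriv (H n) (F0 x)) \<longlonglongrightarrow> right_deriv h (F0 x)"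
        using elim True E_F0[OF True] cc_distortion_functionD(1)[OF cc] H h
        by (intro right_deriv_pointwise_limit uniform_limit_imp_pointwise[OF lim]) auto
      then show ?thesis by (intro tendsto_intros)
    qed simp
  qed
qed

text \<open>Violations at scales tending to infinity would give functions \<open>H n\<close> that
  converge uniformly along a subsequence to some \<open>h\<close>. The integrated remainder vanishes
  pointwise off the kinks of \<open>h\<close> and is dominated by a multiple of \<open>W\<close>. An
  upper bound suffices, the remainder being nonnegative by \<open>quotient_le_L\<close>.\<close>

lemma uniform_expansion:
  assumes e: "0 < e"
  obtains r0 where "0 < r0" "\<And>r h F. r0 \<le> r \<Longrightarrow> h \<in> \<G> \<Longrightarrow> F \<in> \<F> \<Longrightarrow> (\<lambda>x. F x - F0 x) \<in> D \<Longrightarrow>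
    wnorm \<phi> (\<lambda>x. r * (F x - F0 x)) \<le> c \<Longrightarrow>
    L h (\<lambda>x. r * (F x - F0 x)) - r * (distortion_functional h F - distortion_functional h F0) \<le> e"
proof -
  define Q where "Q r h F \<longleftrightarrow> h \<in> \<G> \<and> F \<in> \<F> \<and> (\<lambda>x. F x - F0 x) \<in> D \<and>
    wnorm \<phi> (\<lambda>x. r * (F x - F0 x)) \<le> c \<and>
    e < L h (\<lambda>x. r * (F x - F0 x)) - r * (distortion_functional h F - distortion_functional h F0)"
    for r h F
  have "\<exists>r0>0. \<forall>r h F. r0 \<le> r \<longrightarrow> \<not> Q r h F"
  proof (rule ccontr)
    assume neg: "\<not> ?thesis"
    have "\<exists>r h F. real (Suc n) \<le> r \<and> Q r h F" for n
    proof -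
      have "0 < real (Suc n)" by simp
      with neg show ?thesis by blast
    qed
    then obtain r H F where r: "\<And>n. real (Suc n) \<le> r n" and Q: "\<And>n. Q (r n) (H n) (F n)"
      by metis
    have H: "H n \<in> \<G>" and F: "F n \<in> \<F>" and d: "(\<lambda>x. F n x - F0 x) \<in> D"
      and c: "wnorm \<phi> (\<lambda>x. r n * (F n x - F0 x)) \<le> c"
      and large: "e < L (H n) (\<lambda>x. r n * (F n x - F0 x)) -
        r n * (distortion_functional (H n) (F n) - distortion_functional (H n) F0)" for n
      using Q[of n] by (simp_all only: Q_def)
    obtain h \<sigma> where h: "h \<in> \<G>" and \<sigma>: "strict_mono \<sigma>"
      and lim: "limitin uniform_topology (H \<circ> \<sigma>) h sequentially"
      by (rule G_sequence[OF H])
    define v where "v n x = r n * (F n x - F0 x)" for n x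
    have v: "v n \<in> D" for n
      unfolding v_def using D_weighted_on_scale(1)[OF weight d] .
    have vc: "wnorm \<phi> (v n) \<le> c" for n using c unfolding v_def .
    define f where "f n x = right_deriv (H n) (F0 x) * v n x - r n * (H n (F n x) - H n (F0 x))" for n x
    have rpos: "0 < r n" for n using r[of n] by (meson less_le_trans of_nat_0_less_iff zero_less_Suc)
    have int1: "set_integrable lborel E (\<lambda>x. right_deriv (H n) (F0 x) * v n x)" for n
      by (rule integrand_integrable[OF H v])
    have int2: "set_integrable lborel E (\<lambda>x. r n * (H n (F n x) - H n (F0 x)))" for n
      by (intro set_integrable_mult_right increment_integral(1) H F d)
    have int: "set_integrable lborel E (f n)" for n
      unfolding f_def using int1 int2 by (rule set_integral_diff)
    have eq: "(LBINT x:E. f n x) = L (H n) (\<lambda>x. r n * (F n x - F0 x)) -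
        r n * (distortion_functional (H n) (F n) - distortion_functional (H n) F0)" for n
      unfolding f_def set_integral_diff(2)[OF int1 int2] increment_integral(2)[OF H F d] deriv_integral_eq
      by (simp add: v_def)
    \<comment> \<open>One \<open>c\<close> for the linear term and one for the increment, each
      bounded by the slope \<open>H n (F0 x) / F0 x\<close> of the ray.\<close>
    have bound: "\<bar>f n x\<bar> \<le> 2 * c * W x" if x: "x \<in> E" for n x
    proof -
      have "\<bar>right_deriv (H n) (F0 x) * v n x\<bar> \<le> wnorm \<phi> (v n) * W x"
        by (rule integrand_bound[OF H x v])
      also have "\<dots> \<le> c * W x" using vc W_nonneg[OF x] by (intro mult_right_mono)
      finally have 1: "\<bar>right_deriv (H n) (F0 x) * v n x\<bar> \<le> c * W x" .
      have "\<bar>H n (F n x) - H n (F0 x)\<bar> \<le> H n (F0 x) / F0 x * \<bar>F n x - F0 x\<bar>"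
        using E_F0[OF x] F_props(3,4)[OF F] by (intro cc_distortion_increment_bound[OF cc[OF H]]) auto
      then have "r n * \<bar>H n (F n x) - H n (F0 x)\<bar> \<le> r n * (H n (F0 x) / F0 x * \<bar>F n x - F0 x\<bar>)"
        using rpos[of n] by (intro mult_left_mono) auto
      also have "\<dots> = H n (F0 x) / F0 x * \<bar>v n x\<bar>"
        using rpos[of n] by (simp add: v_def abs_mult)
      also have "\<dots> \<le> wnorm \<phi> (v n) * W x"
        by (rule slope_mult_le[OF H x D_weighted_onD(1)[OF v]])
      also have "\<dots> \<le> c * W x" using vc W_nonneg[OF x] by (intro mult_right_mono)
      finally have "\<bar>r n * (H n (F n x) - H n (F0 x))\<bar> \<le> c * W x"
        using rpos[of n] by (simp add: abs_mult)
      with 1 show ?thesis unfolding f_def by linarith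
    qed
    have "(\<lambda>n. LBINT x:E. f (\<sigma> n) x) \<longlonglongrightarrow> (LBINT x:E. 0)"
      unfolding set_lebesgue_integral_def
    proof (rule integral_dominated_convergence)
      show "(\<lambda>x. indicator E x *\<^sub>R 0 :: real) \<in> borel_measurable lborel" by simp
      show "(\<lambda>x. indicator E x *\<^sub>R f (\<sigma> n) x) \<in> borel_measurable lborel" for n
        using int unfolding set_integrable_def by (rule borel_measurable_integrable)
      show "integrable lborel (\<lambda>x. indicator E x *\<^sub>R (2 * c * W x))"
        using set_integrable_mult_right[OF W_integrable] unfolding set_integrable_def by blast
      have "norm (indicator E x *\<^sub>R f (\<sigma> n) x) \<le> indicator E x *\<^sub>R (2 * c * W x)" for n x
        using bound[of x "\<sigma> n"] by (cases "x \<in> E") auto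
      then show "AE x in lborel. norm (indicator E x *\<^sub>R f (\<sigma> n) x) \<le> indicator E x *\<^sub>R (2 * c * W x)" for n
        by simp
      show "AE x in lborel. (\<lambda>n. indicator E x *\<^sub>R f (\<sigma> n) x) \<longlonglongrightarrow> indicator E x *\<^sub>R 0"
        using kinks[OF h]
      proof eventually_elim
        case (elim x)
        show ?case
        proof (cases "x \<in> E")
          case True
          have "filterlim (\<lambda>n. real (Suc n)) at_top sequentially"
            using filterlim_compose[OF filterlim_real_sequentially filterlim_Suc] by simp
          then have "filterlim r at_top sequentially"
            by (rule filterlim_at_top_mono) (use r in \<open>auto intro: always_eventually\<close>)
          then have rt: "filterlim (\<lambda>n. r (\<sigma> n)) at_top sequentially"
            by (rule filterlim_compose[OF _ filterlim_subseq[OF \<sigma>]])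
          have "(\<lambda>n. right_deriv ((H \<circ> \<sigma>) n) (F0 x) * (r (\<sigma> n) * (F (\<sigma> n) x - F0 x)) -
              r (\<sigma> n) * ((H \<circ> \<sigma>) n (F (\<sigma> n) x) - (H \<circ> \<sigma>) n (F0 x))) \<longlonglongrightarrow> 0"
          proof (rule concave_expansion_limit[where h=h and c="c / \<phi> x"])
            show "concave_on {0..1} ((H \<circ> \<sigma>) n)" for n
              using cc_distortion_functionD(1)[OF cc[OF H]] by simp
            show "(\<lambda>n. (H \<circ> \<sigma>) n t) \<longlonglongrightarrow> h t" if "t \<in> {0..1}" for t
              by (rule uniform_limit_imp_pointwise[OF lim that])
            show "0 < F0 x" "F0 x < 1" "kink_free h (F0 x)" using E_F0[OF True] elim True by auto
            show "\<bar>r (\<sigma> n) * (F (\<sigma> n) x - F0 x)\<bar> \<le> c / \<phi> x" for n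
            proof -
              have "\<bar>v (\<sigma> n) x\<bar> \<le> wnorm \<phi> (v (\<sigma> n)) / \<phi> x"
                by (rule abs_le_wnorm_div[OF weight D_weighted_onD(1)[OF v]])
              also have "\<dots> \<le> c / \<phi> x"
                using vc weight_pos[OF weight, of x] by (intro divide_right_mono) auto
              finally show ?thesis by (simp only: v_def)
            qed
          qed (rule rt)
          then show ?thesis using True by (simp add: f_def v_def)
        qed simp
      qed
    qed
    then have "eventually (\<lambda>n. (LBINT x:E. f (\<sigma> n) x) < e) sequentially"
      using e by (auto simp: set_lebesgue_integral_def dest: order_tendstoD(2))
    then obtain n where "(LBINT x:E. f (\<sigma> n) x) < e" by (auto dest: eventually_happens)
    then show False using large[of "\<sigma> n"] unfolding eq by simp
  qed
  then obtain r0 where "0 < r0" and r0: "\<And>r h F. r0 \<le> r \<Longrightarrow> \<not> Q r h F" by blast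
  show thesis
    by (rule that[OF \<open>0 < r0\<close>]) (use r0 in \<open>auto simp: Q_def not_less\<close>)
qed

end

section \<open>The directional derivative of the risk functional\<close>

context risk_setting
begin

abbreviation "N \<epsilon> \<equiv> near_optimal M \<X> \<rho> \<G> F0 \<epsilon>"
abbreviation "S \<epsilon> v \<equiv> (SUP h\<in>N \<epsilon>. L h v)"
abbreviation "Rdot \<equiv> risk_derivative M \<X> \<rho> \<G> F0"

lemma near_optimal_iff: "h \<in> N \<epsilon> \<longleftrightarrow> h \<in> \<G> \<and> R F0 - \<epsilon> \<le> distortion_functional h F0"
  by (simp add: near_optimal_def risk_functional_distortion[OF F0])

lemma near_optimal_subset: "N \<epsilon> \<subseteq> \<G>"
  by (auto simp: near_optimal_iff)

lemma near_optimalD: "h \<in> N \<epsilon> \<Longrightarrow> h \<in> \<G>"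
  by (simp add: near_optimal_iff)

lemma near_optimal_mono: "\<epsilon> \<le> \<epsilon>' \<Longrightarrow> N \<epsilon> \<subseteq> N \<epsilon>'"
  by (auto simp: near_optimal_iff)

text \<open>The supremum \<open>R F0\<close> may fail to be attained, so a positive tolerance is
  what guarantees a member.\<close>

lemma near_optimal_nonempty: "0 < \<epsilon> \<Longrightarrow> N \<epsilon> \<noteq> {}"
  using R_approx[OF F0, of "R F0 - \<epsilon>"] by (metis diff_less empty_iff less_imp_le near_optimal_iff diff_strict_left_mono diff_zero)

lemma bdd_above_L: "v \<in> D \<Longrightarrow> T \<subseteq> \<G> \<Longrightarrow> bdd_above ((\<lambda>h. L h v) ` T)"
  using L_bound by (intro bdd_aboveI2[where M="K * wnorm \<phi> v"]) (auto simp: abs_le_iff)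

lemma L_le_S: "v \<in> D \<Longrightarrow> h \<in> N \<epsilon> \<Longrightarrow> L h v \<le> S \<epsilon> v"
  by (rule cSUP_upper[OF _ bdd_above_L[OF _ near_optimal_subset]])

lemma S_least: "0 < \<epsilon> \<Longrightarrow> (\<And>h. h \<in> N \<epsilon> \<Longrightarrow> L h v \<le> c) \<Longrightarrow> S \<epsilon> v \<le> c"
  by (rule cSUP_least[OF near_optimal_nonempty])

lemma S_mono: "v \<in> D \<Longrightarrow> 0 < \<epsilon> \<Longrightarrow> \<epsilon> \<le> \<epsilon>' \<Longrightarrow> S \<epsilon> v \<le> S \<epsilon>' v"
  by (rule S_least) (use L_le_S near_optimal_mono in blast)+

lemma S_ge:
  assumes v: "v \<in> D" and \<epsilon>: "0 < \<epsilon>"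
  shows "- (K * wnorm \<phi> v) \<le> S \<epsilon> v"
proof -
  obtain h where h: "h \<in> N \<epsilon>" using near_optimal_nonempty[OF \<epsilon>] by blast
  have "- (K * wnorm \<phi> v) \<le> L h v"
    using L_bound[OF near_optimalD[OF h] v] by (simp add: abs_le_iff)
  also have "\<dots> \<le> S \<epsilon> v" by (rule L_le_S[OF v h])
  finally show ?thesis .
qed

lemma S_Lipschitz:
  assumes u: "u \<in> D" and v: "v \<in> D" and \<epsilon>: "0 < \<epsilon>"
  shows "\<bar>S \<epsilon> u - S \<epsilon> v\<bar> \<le> K * wnorm \<phi> (\<lambda>x. u x - v x)"
proof -
  have *: "S \<epsilon> p \<le> S \<epsilon> q + K * wnorm \<phi> (\<lambda>x. p x - q x)" if p: "p \<in> D" and q: "q \<in> D" for p q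
  proof (rule S_least[OF \<epsilon>])
    fix h assume h: "h \<in> N \<epsilon>"
    have "L h p \<le> L h q + K * wnorm \<phi> (\<lambda>x. p x - q x)"
      using L_Lipschitz[OF near_optimalD[OF h] p q] by (simp add: abs_le_iff)
    with L_le_S[OF q h] show "L h p \<le> S \<epsilon> q + K * wnorm \<phi> (\<lambda>x. p x - q x)" by linarith
  qed
  show ?thesis
    using *[OF u v] *[OF v u] wnorm_minus_commute[of \<phi> u v] by (simp add: abs_le_iff)
qed

text \<open>\<open>S \<epsilon> v\<close> is nondecreasing in \<open>\<epsilon>\<close> and bounded
  below, so its right-hand limit at 0 is its infimum and \<open>Lim\<close> in the definition is a
  genuine limit.\<close>

lemma S_tendsto_Rdot:
  assumes v: "v \<in> D"
  shows "((\<lambda>\<epsilon>. S \<epsilon> v) \<longlongrightarrow> Rdot v) (at_right 0)"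
proof -
  have "((\<lambda>\<epsilon>. S \<epsilon> v) \<longlongrightarrow> Inf ((\<lambda>\<epsilon>. S \<epsilon> v) ` ({0<..} \<inter> UNIV))) (at 0 within ({0<..} \<inter> UNIV))"
    by (rule Lim_right_bound[where K="- (K * wnorm \<phi> v)"]) (use S_mono[OF v] S_ge[OF v] in auto)
  then have *: "((\<lambda>\<epsilon>. S \<epsilon> v) \<longlongrightarrow> Inf ((\<lambda>\<epsilon>. S \<epsilon> v) ` {0<..})) (at_right 0)" by simp
  then have "Rdot v = Inf ((\<lambda>\<epsilon>. S \<epsilon> v) ` {0<..})"
    unfolding risk_derivative_def by (intro tendsto_Lim) simp_all
  with * show ?thesis by simp
qed

lemma S_seq_tendsto_Rdot:
  assumes "v \<in> D"
  shows "(\<lambda>n. S (inverse (real (Suc n))) v) \<longlonglongrightarrow> Rdot v"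
proof -
  have "filterlim (\<lambda>n. inverse (real (Suc n))) (at_right 0) sequentially"
    by (rule filterlim_at_right_sequenceI) (auto simp: inverse_eq_divide)
  then show ?thesis by (rule filterlim_compose[OF S_tendsto_Rdot[OF assms]])
qed

lemma Rdot_le_S:
  assumes v: "v \<in> D" and \<epsilon>: "0 < \<epsilon>"
  shows "Rdot v \<le> S \<epsilon> v"
proof (rule tendsto_upperbound[OF S_tendsto_Rdot[OF v]])
  show "eventually (\<lambda>\<delta>. S \<delta> v \<le> S \<epsilon> v) (at_right 0)"
    by (rule eventually_at_rightI[of 0 \<epsilon>]) (use S_mono[OF v] \<epsilon> in auto)
qed simp

lemma Rdot_greatest:
  assumes v: "v \<in> D" and c: "\<And>\<epsilon>. 0 < \<epsilon> \<Longrightarrow> c \<le> S \<epsilon> v"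
  shows "c \<le> Rdot v"
proof (rule tendsto_lowerbound[OF S_tendsto_Rdot[OF v]])
  show "eventually (\<lambda>\<delta>. c \<le> S \<delta> v) (at_right 0)"
    by (rule eventually_at_rightI[of 0 1]) (use c in auto)
qed simp

lemma Rdot_Lipschitz:
  assumes u: "u \<in> D" and v: "v \<in> D"
  shows "\<bar>Rdot u - Rdot v\<bar> \<le> K * wnorm \<phi> (\<lambda>x. u x - v x)"
proof (rule tendsto_upperbound)
  show "(\<lambda>n. \<bar>S (inverse (real (Suc n))) u - S (inverse (real (Suc n))) v\<bar>) \<longlonglongrightarrow> \<bar>Rdot u - Rdot v\<bar>"
    by (intro tendsto_rabs tendsto_diff S_seq_tendsto_Rdot u v)
  show "eventually (\<lambda>n. \<bar>S (inverse (real (Suc n))) u - S (inverse (real (Suc n))) v\<bar>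
      \<le> K * wnorm \<phi> (\<lambda>x. u x - v x)) sequentially"
    using S_Lipschitz[OF u v] by (intro always_eventually allI) simp
qed simp

lemma space_D: "space \<D> = D"
  by (rule space_D_weighted_algebra[OF weight])

text \<open>Evaluation in \<open>v\<close> and \<open>x\<close> is jointly measurable by right
  continuity in \<open>x\<close>, so measurability of the integral in \<open>v\<close> is the Fubini
  statement for \<open>lborel\<close>.\<close>

lemma L_measurable:
  assumes h: "h \<in> \<G>"
  shows "L h \<in> borel_measurable \<D>"
proof -
  have "(\<lambda>(v, x). v x) \<in> borel_measurable (\<D> \<Otimes>\<^sub>M borel)"
    using D_weighted_onD(2) by (intro jointly_measurable_right_continuous measurable_D_weighted_eval)
      (auto simp: space_D cadlag_def)
  moreover have "(\<lambda>x. indicator E x *\<^sub>R (right_deriv h (F0 x) * 1)) \<in> borel_measurable borel"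
    by (rule integrand_borel[OF h]) simp
  then have "(\<lambda>p. indicator E (snd p) *\<^sub>R (right_deriv h (F0 (snd p)) * 1)) \<in> borel_measurable (\<D> \<Otimes>\<^sub>M borel)"
    by (rule measurable_compose[OF measurable_snd])
  ultimately have "(\<lambda>p. (indicator E (snd p) *\<^sub>R (right_deriv h (F0 (snd p)) * 1)) * (\<lambda>(v, x). v x) p)
      \<in> borel_measurable (\<D> \<Otimes>\<^sub>M borel)"
    by (rule borel_measurable_times[rotated])
  moreover have "(\<lambda>p. (indicator E (snd p) *\<^sub>R (right_deriv h (F0 (snd p)) * 1)) * (\<lambda>(v, x). v x) p) =
      (\<lambda>(v, x). indicator E x *\<^sub>R (right_deriv h (F0 x) * v x))"
    by (rule ext) (simp add: case_prod_beta)
  moreover have "sets (\<D> \<Otimes>\<^sub>M borel) = sets (\<D> \<Otimes>\<^sub>M lborel)"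
    by (intro sets_pair_measure_cong) auto
  ultimately have "(\<lambda>(v, x). indicator E x *\<^sub>R (right_deriv h (F0 x) * v x)) \<in> borel_measurable (\<D> \<Otimes>\<^sub>M lborel)"
    by (simp cong: measurable_cong_sets)
  then have "(\<lambda>v. \<integral>x. indicator E x *\<^sub>R (right_deriv h (F0 x) * v x) \<partial>lborel) \<in> borel_measurable \<D>"
    by (rule lborel.borel_measurable_lebesgue_integral)
  then show ?thesis unfolding deriv_integral_eq[abs_def] set_lebesgue_integral_def .
qed

text \<open>\<open>N \<epsilon>\<close> may be uncountable; continuity of \<open>L h v\<close> in
  \<open>h\<close> lets a countable dense subset, chosen independently of \<open>v\<close>, give the
  same supremum.\<close>

lemma S_measurable:
  assumes \<epsilon>: "0 < \<epsilon>"
  shows "S \<epsilon> \<in> borel_measurable \<D>"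
proof -
  obtain Q where Q: "countable Q" "Q \<subseteq> N \<epsilon>"
    and dense: "\<And>h. h \<in> N \<epsilon> \<Longrightarrow> \<exists>H. (\<forall>n::nat. H n \<in> Q) \<and> limitin uniform_topology H h sequentially"
    using uniform_compact_countable_dense[OF compact_G near_optimal_subset] by metis
  have QG: "Q \<subseteq> \<G>" using Q(2) near_optimal_subset by blast
  have eq: "S \<epsilon> v = (SUP h\<in>Q. L h v)" if v: "v \<in> D" for v
  proof (rule antisym)
    obtain h0 where "h0 \<in> N \<epsilon>" using near_optimal_nonempty[OF \<epsilon>] by blast
    with dense have "Q \<noteq> {}" by blast
    then show "(SUP h\<in>Q. L h v) \<le> S \<epsilon> v" using Q(2) L_le_S[OF v] by (intro cSUP_least) auto
    show "S \<epsilon> v \<le> (SUP h\<in>Q. L h v)"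
    proof (rule S_least[OF \<epsilon>])
      fix h assume h: "h \<in> N \<epsilon>"
      then obtain H where H: "\<And>n::nat. H n \<in> Q" and lim: "limitin uniform_topology H h sequentially"
        using dense by blast
      have "(\<lambda>n. L (H n) v) \<longlonglongrightarrow> L h v"
        using H QG h near_optimal_subset by (intro L_continuous lim v) auto
      moreover have "L (H n) v \<le> (SUP h\<in>Q. L h v)" for n
        by (rule cSUP_upper[OF H bdd_above_L[OF v QG]])
      ultimately show "L h v \<le> (SUP h\<in>Q. L h v)" by (intro LIMSEQ_le_const2) auto
    qed
  qed
  have "(\<lambda>v. SUP h\<in>Q. L h v) \<in> borel_measurable \<D>"
    using QG bdd_above_L by (intro borel_measurable_cSUP Q(1) L_measurable) (auto simp: space_D)
  then show ?thesis by (subst measurable_cong[where g="\<lambda>v. SUP h\<in>Q. L h v"]) (auto simp: space_D eq)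
qed

lemma Rdot_measurable: "Rdot \<in> borel_measurable \<D>"
proof (rule borel_measurable_LIMSEQ_real)
  show "(\<lambda>n. S (inverse (real (Suc n))) v) \<longlonglongrightarrow> Rdot v" if "v \<in> space \<D>" for v
    using that unfolding space_D by (rule S_seq_tendsto_Rdot)
  show "S (inverse (real (Suc n))) \<in> borel_measurable \<D>" for n by (rule S_measurable) simp
qed

section \<open>Two-sided bounds for the difference quotient\<close>

text \<open>Let \<open>c\<close> be \<open>K\<close> times the norm of \<open>F - F0\<close>.
  Passing from \<open>F\<close> to \<open>F0\<close> costs \<open>c\<close> for the functional of
  \<open>h\<close> and \<open>c\<close> for \<open>R\<close>, so a function within
  \<open>\<epsilon> - 2 * c\<close> of the supremum at \<open>F\<close> is
  \<open>\<epsilon>\<close>-optimal at \<open>F0\<close>, and \<open>quotient_le_L\<close> applies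
  to it. The assumption \<open>small\<close> gives \<open>2 * c < \<epsilon>\<close>.\<close>

lemma quotient_le_S:
  assumes r: "0 < r" and F: "F \<in> \<F>" and d: "(\<lambda>x. F x - F0 x) \<in> D"
    and small: "2 * (K * wnorm \<phi> (\<lambda>x. r * (F x - F0 x))) < r * \<epsilon>"
  shows "r * (R F - R F0) \<le> S \<epsilon> (\<lambda>x. r * (F x - F0 x))"
proof (rule ccontr)
  let ?v = "\<lambda>x. r * (F x - F0 x)"
  define c where "c = K * wnorm \<phi> (\<lambda>x. F x - F0 x)"
  have v: "?v \<in> D" by (rule D_weighted_on_scale(1)[OF weight d])
  have "wnorm \<phi> (\<lambda>x. inverse r * ?v x) \<le> \<bar>inverse r\<bar> * wnorm \<phi> ?v"
    by (rule D_weighted_on_scale(2)[OF weight v])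
  moreover have "(\<lambda>x. inverse r * ?v x) = (\<lambda>x. F x - F0 x)" using r by (simp add: fun_eq_iff)
  ultimately have "r * wnorm \<phi> (\<lambda>x. F x - F0 x) \<le> wnorm \<phi> ?v" using r by (simp add: field_simps)
  from mult_left_mono[OF this K_nonneg] have "r * c \<le> K * wnorm \<phi> ?v"
    by (simp add: c_def mult.left_commute)
  with small have "r * (2 * c) < r * \<epsilon>" by linarith
  then have c2: "2 * c < \<epsilon>" using r by simp
  have lip: "\<bar>distortion_functional h F - distortion_functional h F0\<bar> \<le> c" if "h \<in> \<G>" for h
    unfolding c_def by (rule distortion_functional_Lipschitz[OF that F d])
  have RF: "R F0 - c \<le> R F"
  proof (rule ccontr)
    assume "\<not> R F0 - c \<le> R F"
    then have "R F + c < R F0" by simp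
    then obtain h where "h \<in> \<G>" "R F + c < distortion_functional h F0" by (rule R_approx[OF F0])
    then show False using lip[of h] distortion_functional_le_R[of h F] F by linarith
  qed
  assume "\<not> r * (R F - R F0) \<le> S \<epsilon> ?v"
  then have "R F0 + S \<epsilon> ?v / r < R F" using r by (simp add: field_simps)
  \<comment> \<open>The first threshold will contradict the bound by \<open>S \<epsilon>\<close>;
    the second puts the chosen \<open>h\<close> into \<open>N \<epsilon>\<close>.\<close>
  with c2 have "max (R F0 + S \<epsilon> ?v / r) (R F - (\<epsilon> - 2 * c)) < R F" by simp
  then obtain h where h: "h \<in> \<G>" and big: "max (R F0 + S \<epsilon> ?v / r) (R F - (\<epsilon> - 2 * c)) < distortion_functional h F"
    by (rule R_approx[OF F])
  have "R F0 - \<epsilon> \<le> distortion_functional h F0" using big lip[OF h] RF by linarith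
  then have "h \<in> N \<epsilon>" using h by (simp add: near_optimal_iff)
  then have "r * (distortion_functional h F - distortion_functional h F0) \<le> S \<epsilon> ?v"
    using quotient_le_L[OF h F d r] L_le_S[OF v, of h \<epsilon>] by linarith
  moreover have "r * (distortion_functional h F - R F0) \<le> r * (distortion_functional h F - distortion_functional h F0)"
    using distortion_functional_le_R[OF h F0] r by simp
  ultimately have "r * (distortion_functional h F - R F0) \<le> S \<epsilon> ?v" by linarith
  then have "distortion_functional h F - R F0 \<le> S \<epsilon> ?v / r"
    using r by (simp add: pos_le_divide_eq mult.commute)
  then show False using big by linarith
qed

text \<open>The tolerance may shrink with the scale: \<open>\<epsilon> = e / 2 / r\<close> costs
  \<open>e / 2\<close> after multiplication by \<open>r\<close>, and the uniform expansion costs the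
  other half. Since \<open>Rdot\<close> lies below \<open>S \<epsilon>\<close> for every positive
  \<open>\<epsilon>\<close>, no rate of convergence enters.\<close>

lemma quotient_ge_Rdot:
  assumes e: "0 < e"
  obtains r0 where "0 < r0" "\<And>r F. r0 \<le> r \<Longrightarrow> F \<in> \<F> \<Longrightarrow> (\<lambda>x. F x - F0 x) \<in> D \<Longrightarrow>
    wnorm \<phi> (\<lambda>x. r * (F x - F0 x)) \<le> c \<Longrightarrow> Rdot (\<lambda>x. r * (F x - F0 x)) - e \<le> r * (R F - R F0)"
proof -
  have "0 < e / 2" using e by simp
  then obtain r0 where r0: "0 < r0" and
    ex: "\<And>r h F. r0 \<le> r \<Longrightarrow> h \<in> \<G> \<Longrightarrow> F \<in> \<F> \<Longrightarrow> (\<lambda>x. F x - F0 x) \<in> D \<Longrightarrow>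
    wnorm \<phi> (\<lambda>x. r * (F x - F0 x)) \<le> c \<Longrightarrow>
    L h (\<lambda>x. r * (F x - F0 x)) - r * (distortion_functional h F - distortion_functional h F0) \<le> e / 2"
    by (rule uniform_expansion[where c=c]) (erule that, blast)
  show thesis
  proof (rule that[OF r0])
    fix r F
    assume r: "r0 \<le> r" and F: "F \<in> \<F>" and d: "(\<lambda>x. F x - F0 x) \<in> D"
      and c: "wnorm \<phi> (\<lambda>x. r * (F x - F0 x)) \<le> c"
    let ?v = "\<lambda>x. r * (F x - F0 x)"
    have v: "?v \<in> D" by (rule D_weighted_on_scale(1)[OF weight d])
    have rpos: "0 < r" using r r0 by simp
    define \<epsilon> where "\<epsilon> = e / 2 / r"
    have \<epsilon>: "0 < \<epsilon>" "r * \<epsilon> = e / 2" using e rpos by (auto simp: \<epsilon>_def)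
    have "Rdot ?v \<le> S \<epsilon> ?v" by (rule Rdot_le_S[OF v \<epsilon>(1)])
    also have "\<dots> \<le> r * (R F - R F0) + e"
    proof (rule S_least[OF \<epsilon>(1)])
      fix h assume "h \<in> N \<epsilon>"
      then have h: "h \<in> \<G>" "R F0 - \<epsilon> \<le> distortion_functional h F0" by (auto simp: near_optimal_iff)
      have "r * (distortion_functional h F - distortion_functional h F0) \<le> r * (R F - R F0 + \<epsilon>)"
        using distortion_functional_le_R[OF h(1) F] h(2) rpos by (intro mult_left_mono) auto
      also have "\<dots> = r * (R F - R F0) + e / 2" using \<epsilon>(2) by (simp add: distrib_left)
      finally show "L h ?v \<le> r * (R F - R F0) + e" using ex[OF r h(1) F d c] by linarith
    qed
    finally show "Rdot ?v - e \<le> r * (R F - R F0)" by simp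
  qed
qed

text \<open>Lower semicontinuity is enough: superlevel sets are open in \<open>\<G>\<close>, so a
  sequence from \<open>Q\<close> approaching \<open>h\<close> eventually enters the one containing
  \<open>h\<close>. One countable \<open>Q\<close> serves all \<open>F\<close>, which gives
  measurability of \<open>R\<close> along random \<open>F\<close>.\<close>

lemma R_eq_countable_SUP:
  obtains Q where "countable Q" "Q \<subseteq> \<G>" "Q \<noteq> {}"
    "\<And>F. F \<in> \<F> \<Longrightarrow> R F = (SUP h\<in>Q. distortion_functional h F)"
proof -
  obtain Q where Q: "countable Q" "Q \<subseteq> \<G>"
    and dense: "\<And>h. h \<in> \<G> \<Longrightarrow> \<exists>H. (\<forall>n::nat. H n \<in> Q) \<and> limitin uniform_topology H h sequentially"
    using uniform_compact_countable_dense[OF compact_G order_refl] by metis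
  have ne: "Q \<noteq> {}" using dense G_nonempty by blast
  show thesis
  proof (rule that[OF Q ne])
    fix F assume F: "F \<in> \<F>"
    have bdd: "bdd_above ((\<lambda>h. distortion_functional h F) ` Q)"
      using distortion_functional_le_R[OF _ F] Q(2) by (intro bdd_aboveI2) auto
    show "R F = (SUP h\<in>Q. distortion_functional h F)"
    proof (rule antisym)
      show "(SUP h\<in>Q. distortion_functional h F) \<le> R F"
        using distortion_functional_le_R[OF _ F] Q(2) by (intro cSUP_least ne) auto
      show "R F \<le> (SUP h\<in>Q. distortion_functional h F)"
      proof (rule ccontr)
        assume "\<not> R F \<le> (SUP h\<in>Q. distortion_functional h F)"
        then have lt: "(SUP h\<in>Q. distortion_functional h F) < R F" by simp
        define c where "c = (SUP h\<in>Q. distortion_functional h F)"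
        obtain h where h: "h \<in> \<G>" "c < distortion_functional h F"
          using R_approx[OF F lt] unfolding c_def by blast
        obtain X where X: "X \<in> \<X>" "F = dist_fun M X" using F by (auto simp: dist_funs_def)
        have "openin (subtopology uniform_topology \<G>) {g \<in> \<G>. c < distortion_risk_measure M g X}"
          using representing X(1) by (simp add: representing_set_def)
        then have op: "openin (subtopology uniform_topology \<G>) {g \<in> \<G>. c < distortion_functional g F}"
          by (simp add: distortion_risk_measure_eq X(2))
        obtain H where H: "\<And>n::nat. H n \<in> Q" and lim: "limitin uniform_topology H h sequentially"
          using dense h(1) by blast
        have "limitin (subtopology uniform_topology \<G>) H h sequentially"
          using lim h(1) H Q(2) by (auto simp: limitin_subtopology intro!: always_eventually)
        then have "eventually (\<lambda>n. H n \<in> {g \<in> \<G>. c < distortion_functional g F}) sequentially"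
          using op h unfolding limitin_def by blast
        then obtain n where "c < distortion_functional (H n) F" by (auto dest: eventually_happens)
        moreover have "distortion_functional (H n) F \<le> c"
          unfolding c_def by (rule cSUP_upper[OF H bdd])
        ultimately show False by simp
      qed
    qed
  qed
qed

lemma R_measurable:
  assumes G: "\<And>\<omega>. \<omega> \<in> space M' \<Longrightarrow> G \<omega> \<in> \<F>" and meas: "\<And>x. (\<lambda>\<omega>. G \<omega> x) \<in> borel_measurable M'"
  shows "(\<lambda>\<omega>. R (G \<omega>)) \<in> borel_measurable M'"
proof -
  obtain Q where Q: "countable Q" "Q \<subseteq> \<G>" "Q \<noteq> {}"
    and eq: "\<And>F. F \<in> \<F> \<Longrightarrow> R F = (SUP h\<in>Q. distortion_functional h F)"
    by (rule R_eq_countable_SUP) (rule that)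
  have joint: "(\<lambda>(\<omega>, x). G \<omega> x) \<in> borel_measurable (M' \<Otimes>\<^sub>M borel)"
    using F_props(2) G by (intro jointly_measurable_right_continuous meas) auto
  have df: "(\<lambda>\<omega>. distortion_functional h (G \<omega>)) \<in> borel_measurable M'" if h: "h \<in> \<G>" for h
  proof -
    have sets: "sets (M' \<Otimes>\<^sub>M borel) = sets (M' \<Otimes>\<^sub>M lborel)"
      by (intro sets_pair_measure_cong) auto
    have "(\<lambda>p. h ((\<lambda>(\<omega>, x). G \<omega> x) p)) \<in> borel_measurable (M' \<Otimes>\<^sub>M borel)"
      using F_props(3,4)[OF G] by (intro cc_distortion_borel[OF cc[OF h] joint]) (auto simp: space_pair_measure)
    then have [measurable]: "(\<lambda>p. h (G (fst p) (snd p))) \<in> borel_measurable (M' \<Otimes>\<^sub>M lborel)"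
      unfolding measurable_cong_sets[OF sets refl] by (simp add: case_prod_beta)
    have "(\<lambda>(\<omega>, x). indicator {..<0} x *\<^sub>R h (G \<omega> x)) \<in> borel_measurable (M' \<Otimes>\<^sub>M lborel)"
      "(\<lambda>(\<omega>, x). indicator {0<..} x *\<^sub>R (1 - h (G \<omega> x))) \<in> borel_measurable (M' \<Otimes>\<^sub>M lborel)"
      unfolding case_prod_beta by measurable
    from this[THEN lborel.borel_measurable_lebesgue_integral] show ?thesis
      unfolding distortion_functional_def set_lebesgue_integral_def by (rule borel_measurable_diff)
  qed
  have "(\<lambda>\<omega>. SUP h\<in>Q. distortion_functional h (G \<omega>)) \<in> borel_measurable M'"
  proof (intro borel_measurable_cSUP Q(1) df)
    show "bdd_above ((\<lambda>h. distortion_functional h (G \<omega>)) ` Q)" if "\<omega> \<in> space M'" for \<omega>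
      using distortion_functional_le_R[OF _ G[OF that]] Q(2) by (intro bdd_aboveI2) auto
  qed (use Q(2) in auto)
  then show ?thesis
    by (subst measurable_cong[where g="\<lambda>\<omega>. SUP h\<in>Q. distortion_functional h (G \<omega>)"]) (auto simp: eq G)
qed

section \<open>Attainment of the supremum under the integrability condition\<close>

lemma optimal_iff: "h \<in> optimal M \<X> \<rho> \<G> F0 \<longleftrightarrow> h \<in> \<G> \<and> R F0 = distortion_functional h F0"
  by (simp add: optimal_def risk_functional_distortion[OF F0])

text \<open>Full continuity lets a uniform limit of ever more nearly optimal functions inherit the
  value \<open>R F0\<close>.\<close>

lemma near_optimal_limit:
  assumes cont: "continuous_map (subtopology uniform_topology \<G>) euclideanreal (\<lambda>h. distortion_functional h F0)"
    and H: "\<And>n. H n \<in> N (inverse (real (Suc n)))"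
  obtains h \<sigma> where "h \<in> optimal M \<X> \<rho> \<G> F0" "strict_mono \<sigma>" "limitin uniform_topology (H \<circ> \<sigma>) h sequentially"
proof -
  have HG: "H n \<in> \<G>" for n using H near_optimal_subset by blast
  obtain h \<sigma> where h: "h \<in> \<G>" and \<sigma>: "strict_mono \<sigma>"
    and lim: "limitin uniform_topology (H \<circ> \<sigma>) h sequentially"
    by (rule G_sequence[OF HG])
  have "limitin (subtopology uniform_topology \<G>) (H \<circ> \<sigma>) h sequentially"
    using lim h HG by (simp add: limitin_subtopology)
  then have 1: "(\<lambda>n. distortion_functional (H (\<sigma> n)) F0) \<longlonglongrightarrow> distortion_functional h F0"
    using continuous_map_limit[OF cont] by (simp add: o_def)
  have 2: "(\<lambda>n. R F0 - inverse (real (Suc (\<sigma> n)))) \<longlonglongrightarrow> R F0 - 0"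
    by (intro tendsto_diff tendsto_const filterlim_compose[OF LIMSEQ_inverse_real_of_nat filterlim_subseq[OF \<sigma>]])
  have "R F0 - 0 \<le> distortion_functional h F0"
    using H by (intro LIMSEQ_le[OF 2 1]) (auto simp: near_optimal_iff)
  then have "h \<in> optimal M \<X> \<rho> \<G> F0"
    using distortion_functional_le_R[OF h F0] h by (simp add: optimal_iff)
  then show thesis using that \<sigma> lim by blast
qed

text \<open>An optimal \<open>h\<close> lies in every \<open>N \<epsilon>\<close>, which gives one
  inequality. For the other, functions that are \<open>1 / Suc n\<close>-optimal and almost realise
  \<open>S\<close> at that tolerance converge along a subsequence to an optimal one, and
  \<open>L\<close> is continuous along it.\<close>

lemma optimal_derivative:
  assumes cont: "continuous_map (subtopology uniform_topology \<G>) euclideanreal (\<lambda>h. distortion_functional h F0)"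
  shows "optimal M \<X> \<rho> \<G> F0 \<noteq> {}"
    and "\<And>v. v \<in> D \<Longrightarrow> Rdot v = (SUP h\<in>optimal M \<X> \<rho> \<G> F0. L h v)"
proof -
  let ?O = "optimal M \<X> \<rho> \<G> F0"
  have "\<exists>h. h \<in> N (inverse (real (Suc n)))" for n
    using near_optimal_nonempty[of "inverse (real (Suc n))"] by auto
  then obtain H where "\<And>n. H n \<in> N (inverse (real (Suc n)))" by metis
  from near_optimal_limit[OF cont this] show ne: "?O \<noteq> {}" by blast
  have ON: "?O \<subseteq> N \<epsilon>" if "0 < \<epsilon>" for \<epsilon> using that by (auto simp: optimal_iff near_optimal_iff)
  have OG: "?O \<subseteq> \<G>" by (auto simp: optimal_iff)
  show "Rdot v = (SUP h\<in>?O. L h v)" if v: "v \<in> D" for v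
  proof (rule antisym)
    show "(SUP h\<in>?O. L h v) \<le> Rdot v"
      by (rule cSUP_least[OF ne], rule Rdot_greatest[OF v], rule L_le_S[OF v]) (use ON in blast)
    have "\<exists>h. h \<in> N (inverse (real (Suc n))) \<and> Rdot v - inverse (real (Suc n)) < L h v" for n
    proof -
      have pos: "0 < inverse (real (Suc n))" by simp
      have "Rdot v - inverse (real (Suc n)) < S (inverse (real (Suc n))) v"
        using Rdot_le_S[OF v pos] pos by linarith
      then show ?thesis
        using less_cSUP_iff[OF near_optimal_nonempty[OF pos] bdd_above_L[OF v near_optimal_subset]] by blast
    qed
    then obtain H where H: "\<And>n. H n \<in> N (inverse (real (Suc n)))"
      and HL: "\<And>n. Rdot v - inverse (real (Suc n)) < L (H n) v" by metis
    obtain h \<sigma> where h: "h \<in> ?O" and \<sigma>: "strict_mono \<sigma>"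
      and lim: "limitin uniform_topology (H \<circ> \<sigma>) h sequentially"
      by (rule near_optimal_limit[OF cont H])
    have "(\<lambda>n. L ((H \<circ> \<sigma>) n) v) \<longlonglongrightarrow> L h v"
      using H near_optimal_subset h OG by (intro L_continuous lim v) (auto simp: o_def)
    moreover have "(\<lambda>n. Rdot v - inverse (real (Suc (\<sigma> n)))) \<longlonglongrightarrow> Rdot v - 0"
      by (intro tendsto_diff tendsto_const filterlim_compose[OF LIMSEQ_inverse_real_of_nat filterlim_subseq[OF \<sigma>]])
    ultimately have "Rdot v - 0 \<le> L h v"
      using HL by (intro LIMSEQ_le[of _ "Rdot v - 0" _ "L h v"]) (auto intro!: exI[of _ 0] less_imp_le)
    also have "\<dots> \<le> (SUP h\<in>?O. L h v)" by (rule cSUP_upper[OF h bdd_above_L[OF v OG]])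
    finally show "Rdot v \<le> (SUP h\<in>?O. L h v)" by simp
  qed
qed

lemma integrable_imp_continuous:
  assumes "0 < \<delta>" "\<delta> < 1" "set_integrable lborel {..<0} (\<lambda>x. assoc_distortion M \<rho> (\<delta> * F0 x))"
  shows "continuous_map (subtopology uniform_topology \<G>) euclideanreal (\<lambda>h. distortion_functional h F0)"
proof -
  obtain X where X: "X \<in> \<X>" "F0 = dist_fun M X" using F0 by (auto simp: dist_funs_def)
  have "\<exists>\<gamma>\<in>{0<..<1}. set_integrable lborel {..<0} (\<lambda>x. assoc_distortion M \<rho> (\<gamma> * dist_fun M X x))"
    using assms X(2) by auto
  then have "continuous_map (subtopology uniform_topology \<G>) euclideanreal (\<lambda>h. distortion_risk_measure M h X)"
    using representing X(1) unfolding representing_set_def by blast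
  then show ?thesis by (simp add: distortion_risk_measure_eq X(2))
qed

text \<open>All four facts are read off the pointwise supremum over \<open>\<G>\<close>; the
  Bernoulli description stays closed.\<close>

lemma assoc_props:
  shows "\<And>t. 0 \<le> t \<Longrightarrow> t \<le> 1 \<Longrightarrow> 0 \<le> assoc_distortion M \<rho> t"
    and "\<And>t. 0 \<le> t \<Longrightarrow> t \<le> 1 \<Longrightarrow> assoc_distortion M \<rho> t \<le> 1"
    and "assoc_distortion M \<rho> 0 = 0"
    and "\<And>s t. 0 \<le> s \<Longrightarrow> s \<le> t \<Longrightarrow> t \<le> 1 \<Longrightarrow> assoc_distortion M \<rho> s \<le> assoc_distortion M \<rho> t"
proof -
  have eq: "ereal (assoc_distortion M \<rho> t) = (SUP g\<in>\<G>. ereal (g t))" if "0 \<le> t" "t \<le> 1" for t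
    using representing that by (simp add: representing_set_def)
  have le: "assoc_distortion M \<rho> t \<le> c" if "0 \<le> t" "t \<le> 1" "\<And>g. g \<in> \<G> \<Longrightarrow> g t \<le> c" for t c
  proof -
    have "(SUP g\<in>\<G>. ereal (g t)) \<le> ereal c" using that(3) by (intro SUP_least) simp
    then show ?thesis using eq[OF that(1,2)] by (metis ereal_less_eq(3))
  qed
  obtain h where h: "h \<in> \<G>" using G_nonempty by blast
  show nn: "0 \<le> assoc_distortion M \<rho> t" if "0 \<le> t" "t \<le> 1" for t
    using le_assoc[OF h that] cc_distortion_functionD(4)[OF cc[OF h] that] by linarith
  show "assoc_distortion M \<rho> t \<le> 1" if "0 \<le> t" "t \<le> 1" for t
    using le[OF that] cc_distortion_functionD(5)[OF cc that] by blast
  have "assoc_distortion M \<rho> 0 \<le> 0" by (rule le) (auto simp: cc_distortion_functionD(2)[OF cc])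
  with nn[of 0] show "assoc_distortion M \<rho> 0 = 0" by simp
  show "assoc_distortion M \<rho> s \<le> assoc_distortion M \<rho> t" if st: "0 \<le> s" "s \<le> t" "t \<le> 1" for s t
  proof (rule le)
    fix g assume g: "g \<in> \<G>"
    have "g s \<le> g t" by (rule cc_distortion_functionD(6)[OF cc[OF g] st])
    also have "\<dots> \<le> assoc_distortion M \<rho> t" using le_assoc[OF g] st by simp
    finally show "g s \<le> assoc_distortion M \<rho> t" .
  qed (use st in auto)
qed

text \<open>On \<open>E\<close> below zero the integrand is
  \<open>\<gamma> * (F0 x * \<phi> x) * W x\<close>, a bounded multiple of \<open>W\<close>. Left of
  \<open>E\<close> it vanishes with \<open>F0\<close>, and any remaining negative points form a
  bounded set, where it is at most 1.\<close>

lemma bounded_imp_integrable: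
  assumes "bounded ((\<lambda>x. F0 x * \<phi> x) ` {..<0})"
  shows "set_integrable lborel {..<0} (\<lambda>x. assoc_distortion M \<rho> (\<gamma> * F0 x))"
proof -
  let ?g = "assoc_distortion M \<rho>"
  obtain c where c: "\<And>x. x < 0 \<Longrightarrow> \<bar>F0 x * \<phi> x\<bar> \<le> c"
    using assms by (auto simp: bounded_iff)
  have "eventually (\<lambda>y. F0 y < 1) at_bot"
    using F_props(5)[OF F0] by (rule order_tendstoD(2)) simp
  \<comment> \<open>Below \<open>y\<close>, a point outside \<open>E\<close> can only lie at or left
    of the lower endpoint.\<close>
  then obtain y where y: "F0 y < 1" by (auto simp: eventually_at_bot_linorder)
  have rng: "0 \<le> \<gamma> * F0 x" "\<gamma> * F0 x \<le> 1" for x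
    using gamma F_props(3,4)[OF F0, of x] by (auto intro!: mult_le_one)
  define f where "f x = indicator E x *\<^sub>R (\<gamma> * c * W x) + indicator {y..0} x" for x :: real
  have f: "integrable lborel f"
    unfolding f_def
  proof (rule Bochner_Integration.integrable_add)
    show "integrable lborel (\<lambda>x. indicator E x *\<^sub>R (\<gamma> * c * W x))"
      using set_integrable_mult_right[OF W_integrable] unfolding set_integrable_def by blast
    show "integrable lborel (\<lambda>x. indicator {y..0} x :: real)"
      by (subst integrable_indicator_iff) (auto simp: emeasure_lborel_Icc_eq)
  qed
  have meas: "set_borel_measurable lborel {..<0} (\<lambda>x. ?g (\<gamma> * F0 x))"
  proof -
    have "(\<lambda>x. ?g (\<gamma> * F0 x)) \<in> borel_measurable borel"
      by (rule mono_on_unit_borel) (use assoc_props(4) rng in auto)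
    then show ?thesis unfolding set_borel_measurable_def by measurable
  qed
  have bound: "AE x in lborel. norm (indicator {..<0} x *\<^sub>R ?g (\<gamma> * F0 x)) \<le> norm (f x)"
    using AE_lborel_singleton[of "real_of_ereal (right_quantile F0 0)"]
  proof eventually_elim
    case (elim x)
    show ?case
    proof (cases "x < 0")
      case x: True
      note g = assoc_props(1,2)[OF rng(1,2), of x]
      consider "x \<in> E" | "x \<notin> E" "y \<le> x" | "x \<notin> E" "x < y" by linarith
      then show ?thesis
      proof cases
        case 1
        note F = E_F0[OF 1]
        have "?g (\<gamma> * F0 x) = \<gamma> * (F0 x * \<phi> x) * W x"
          using gamma F weight_pos[OF weight, of x] by (simp add: W_def)
        also have "\<dots> \<le> \<gamma> * c * W x"
          using c[OF x] gamma W_nonneg[OF 1] by (intro mult_right_mono mult_left_mono) (auto simp: abs_le_iff)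
        also have "\<dots> \<le> f x" using 1 by (simp add: f_def)
        finally have "?g (\<gamma> * F0 x) \<le> f x" .
        then show ?thesis using g x by simp
      next
        case 2
        then show ?thesis using g x by (simp add: f_def)
      next
        case 3
        have Fx: "F0 z < 1" if "z \<le> y" for z using y monoD[OF F_props(1)[OF F0] that] by simp
        have "ereal y \<le> left_quantile F0 1"
          unfolding left_quantile_def
        proof (rule Inf_greatest)
          fix z assume "z \<in> ereal ` {x. 1 \<le> F0 x}"
          then obtain z' where z': "z = ereal z'" "1 \<le> F0 z'" by auto
          then show "ereal y \<le> z" using Fx[of z'] by (cases "y \<le> z'") auto
        qed
        moreover have "ereal x < ereal y" using 3 by simp
        ultimately have "ereal x < left_quantile F0 1" by (rule less_le_trans[rotated])
        then have "right_quantile F0 0 \<ge> ereal x" using 3 by (auto simp: einterval_def)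
        moreover have "right_quantile F0 0 \<noteq> ereal x" using elim by auto
        ultimately have "ereal x < right_quantile F0 0" by simp
        moreover have "right_quantile F0 0 \<le> ereal x" if "0 < F0 x"
          unfolding right_quantile_def by (rule Inf_lower) (use that in auto)
        ultimately have "\<not> 0 < F0 x" by auto
        then have "F0 x = 0" using F_props(3)[OF F0, of x] by simp
        then show ?thesis using assoc_props(3) by simp
      qed
    qed simp
  qed
  show ?thesis
    unfolding set_integrable_def
    by (rule Bochner_Integration.integrable_bound[OF f meas[unfolded set_borel_measurable_def] bound])
qed

end

section \<open>Weak convergence of the normalised risk functional\<close>

text \<open>The clamped form reduces monotonicity and the Lipschitz bound to linear arithmetic.
  Convergence of the integrals of these decreasing ramps implies weak convergence.\<close>

lemma cts_step_alt: "x < y \<Longrightarrow> cts_step x y t = max 0 (min 1 ((y - t) / (y - x)))"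
  by (auto simp: cts_step_def max_def min_def field_simps)

lemma cts_step_bounds: "0 \<le> cts_step x y t" "cts_step x y t \<le> 1"
  by (auto simp: cts_step_def divide_simps)

lemma cts_step_antimono:
  assumes "x < y" "s \<le> t"
  shows "cts_step x y t \<le> cts_step x y s"
proof -
  have "(y - t) / (y - x) \<le> (y - s) / (y - x)" using assms by (intro divide_right_mono) auto
  then show ?thesis unfolding cts_step_alt[OF assms(1)] by linarith
qed

lemma cts_step_Lipschitz:
  assumes "x < y"
  shows "\<bar>cts_step x y s - cts_step x y t\<bar> \<le> \<bar>s - t\<bar> / (y - x)"
proof -
  have "\<bar>max 0 (min 1 p) - max 0 (min 1 q)\<bar> \<le> \<bar>p - q\<bar>" for p q :: real by linarith
  then have "\<bar>cts_step x y s - cts_step x y t\<bar> \<le> \<bar>(y - s) / (y - x) - (y - t) / (y - x)\<bar>"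
    unfolding cts_step_alt[OF assms] by blast
  also have "\<dots> = \<bar>s - t\<bar> / (y - x)"
    using assms by (simp add: diff_divide_distrib[symmetric] abs_minus_commute)
  finally show ?thesis .
qed

lemma cts_step_borel: "x < y \<Longrightarrow> cts_step x y \<in> borel_measurable borel"
  using cts_step_uniformly_continuous[of x y]
  by (intro borel_measurable_continuous_onI uniformly_continuous_imp_continuous)

context risk_setting
begin

context
  fixes Fhat :: "nat \<Rightarrow> 'a \<Rightarrow> real \<Rightarrow> real" and Q :: "'b measure" and B :: "'b \<Rightarrow> real \<Rightarrow> real"
    and r :: "nat \<Rightarrow> real"
  assumes Fhat: "\<And>n \<omega>. \<omega> \<in> space M \<Longrightarrow> Fhat n \<omega> \<in> \<F>"
    and Fhat_meas: "\<And>n. Fhat n \<in> measurable M D_algebra"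
    and Fhat_D: "\<And>n \<omega>. \<omega> \<in> space M \<Longrightarrow> (\<lambda>x. Fhat n \<omega> x - F0 x) \<in> D"
    and Q: "prob_space Q" and B: "B \<in> measurable Q \<D>"
    and r_pos: "\<And>n. 0 < r n" and r_top: "filterlim r at_top sequentially"
    and conv: "conv_in_distr_D \<phi> F0 M (\<lambda>n \<omega> x. r n * (Fhat n \<omega> x - F0 x)) Q B"
begin

abbreviation "Y n \<omega> \<equiv> (\<lambda>x. r n * (Fhat n \<omega> x - F0 x))"
abbreviation "T n \<omega> \<equiv> r n * (R (Fhat n \<omega>) - R F0)"

lemma Fhat_eval: "(\<lambda>\<omega>. Fhat n \<omega> x) \<in> borel_measurable M"
  using measurable_compose[OF Fhat_meas measurable_D_algebra_eval] by simp

lemma Y_D: "\<omega> \<in> space M \<Longrightarrow> Y n \<omega> \<in> D"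
  by (rule D_weighted_on_scale(1)[OF weight Fhat_D])

lemma Y_measurable: "Y n \<in> measurable M \<D>"
  using Fhat_eval by (intro measurable_D_weighted_algebraI weight Y_D) auto

lemma T_measurable: "T n \<in> borel_measurable M"
  using R_measurable[of M "Fhat n", OF Fhat Fhat_eval] by simp

lemma B_D: "\<omega> \<in> space Q \<Longrightarrow> B \<omega> \<in> D"
  using measurable_space[OF B] by (simp add: space_D)

lemma conv_Lipschitz:
  assumes "\<And>v. v \<in> D \<Longrightarrow> \<bar>f v\<bar> \<le> c"
    and "\<And>u v. u \<in> D \<Longrightarrow> v \<in> D \<Longrightarrow> \<bar>f u - f v\<bar> \<le> l * wnorm \<phi> (\<lambda>x. u x - v x)"
    and "f \<in> borel_measurable \<D>"
  shows "(\<lambda>n. \<integral>\<omega>. f (Y n \<omega>) \<partial>M) \<longlonglongrightarrow> (\<integral>\<omega>. f (B \<omega>) \<partial>Q)"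
  by (rule conv_in_distr_D_Lipschitz[OF weight conv assms])

lemma conv_cts_step_Lipschitz:
  assumes xy: "x < y" and meas: "f \<in> borel_measurable \<D>"
    and lip: "\<And>u v. u \<in> D \<Longrightarrow> v \<in> D \<Longrightarrow> \<bar>f u - f v\<bar> \<le> K * wnorm \<phi> (\<lambda>x. u x - v x)"
  shows "(\<lambda>n. \<integral>\<omega>. cts_step x y (f (Y n \<omega>)) \<partial>M) \<longlonglongrightarrow> (\<integral>\<omega>. cts_step x y (f (B \<omega>)) \<partial>Q)"
proof (rule conv_Lipschitz[where c=1 and l="K / (y - x)"])
  show "\<bar>cts_step x y (f v)\<bar> \<le> 1" for v using cts_step_bounds[of x y "f v"] by simp
  show "(\<lambda>v. cts_step x y (f v)) \<in> borel_measurable \<D>"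
    by (rule measurable_compose[OF meas cts_step_borel[OF xy]])
  fix u v assume "u \<in> D" "v \<in> D"
  have "\<bar>cts_step x y (f u) - cts_step x y (f v)\<bar> \<le> \<bar>f u - f v\<bar> / (y - x)"
    by (rule cts_step_Lipschitz[OF xy])
  also have "\<dots> \<le> K * wnorm \<phi> (\<lambda>x. u x - v x) / (y - x)"
    using lip[OF \<open>u \<in> D\<close> \<open>v \<in> D\<close>] xy by (intro divide_right_mono) auto
  finally show "\<bar>cts_step x y (f u) - cts_step x y (f v)\<bar> \<le> K / (y - x) * wnorm \<phi> (\<lambda>x. u x - v x)"
    by simp
qed

text \<open>A Lipschitz substitute for the discontinuous indicator of a large norm: zero for norm at
  most \<open>c\<close>, one for norm at least \<open>c + 1\<close>.\<close>

definition tail :: "real \<Rightarrow> (real \<Rightarrow> real) \<Rightarrow> real" where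
  "tail c v = max 0 (min 1 (wnorm \<phi> v - c))"

lemma tail_bounds: "0 \<le> tail c v" "tail c v \<le> 1"
  by (auto simp: tail_def)

lemma tail_measurable: "tail c \<in> borel_measurable \<D>"
  unfolding tail_def using wnorm_measurable[OF weight] by measurable

lemma conv_tail: "(\<lambda>n. \<integral>\<omega>. tail c (Y n \<omega>) \<partial>M) \<longlonglongrightarrow> (\<integral>\<omega>. tail c (B \<omega>) \<partial>Q)"
proof (rule conv_Lipschitz[where c=1 and l=1])
  show "\<bar>tail c v\<bar> \<le> 1" for v using tail_bounds[of c v] by simp
  fix u v assume "u \<in> D" "v \<in> D"
  from wnorm_triangle[OF weight this]
  show "\<bar>tail c u - tail c v\<bar> \<le> 1 * wnorm \<phi> (\<lambda>x. u x - v x)" unfolding tail_def by linarith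
qed (rule tail_measurable)

lemma integrable_01:
  assumes "prob_space P" "f \<in> borel_measurable P" "\<And>\<omega>. 0 \<le> f \<omega>" "\<And>\<omega>. f \<omega> \<le> (1::real)"
  shows "integrable P f"
proof -
  interpret P: prob_space P by fact
  show ?thesis using assms by (intro P.integrable_const_bound[of _ 1]) auto
qed

lemma tail_B_small: "(\<lambda>k. \<integral>\<omega>. tail (real k) (B \<omega>) \<partial>Q) \<longlonglongrightarrow> 0"
proof -
  interpret Q: prob_space Q by (rule Q)
  have "(\<lambda>k. \<integral>\<omega>. tail (real k) (B \<omega>) \<partial>Q) \<longlonglongrightarrow> (\<integral>\<omega>. 0 \<partial>Q)"
  proof (rule integral_dominated_convergence[where w="\<lambda>_. 1"])
    show "(\<lambda>\<omega>. tail (real k) (B \<omega>)) \<in> borel_measurable Q" for k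
      by (rule measurable_compose[OF B tail_measurable])
    show "AE \<omega> in Q. (\<lambda>k. tail (real k) (B \<omega>)) \<longlonglongrightarrow> 0"
    proof (rule AE_I2)
      fix \<omega>
      obtain k0 :: nat where k0: "wnorm \<phi> (B \<omega>) \<le> real k0" using real_arch_simple by blast
      have "eventually (\<lambda>k. tail (real k) (B \<omega>) = 0) sequentially"
        using eventually_ge_at_top[of k0] by eventually_elim (use k0 in \<open>simp add: tail_def\<close>)
      then show "(\<lambda>k. tail (real k) (B \<omega>)) \<longlonglongrightarrow> 0" by (rule tendsto_eventually)
    qed
    show "AE \<omega> in Q. norm (tail (real k) (B \<omega>)) \<le> 1" for k
      using tail_bounds by simp
  qed auto
  then show ?thesis by simp
qed

text \<open>Ramps decrease, so on the event of norm at most \<open>c + 1\<close> the bounds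
  \<open>T n \<le> S \<epsilon> (Y n)\<close> and \<open>Rdot (Y n) - e \<le> T n\<close> become a
  lower and an upper bound for the ramp of \<open>T n\<close>; off the event \<open>tail\<close>
  equals 1 and absorbs everything. Each side collects four errors of
  \<open>\<eta> / 8\<close>.\<close>

lemma conv_cts_step:
  assumes xy: "x < y"
  shows "(\<lambda>n. \<integral>\<omega>. cts_step x y (T n \<omega>) \<partial>M) \<longlonglongrightarrow> (\<integral>\<omega>. cts_step x y (Rdot (B \<omega>)) \<partial>Q)"
proof (rule LIMSEQ_I)
  let ?\<psi> = "cts_step x y" and ?inv = "\<lambda>n. inverse (real (Suc n))"
  interpret Q: prob_space Q by (rule Q)
  fix \<eta> :: real assume eta: "0 < \<eta>"
  have "eventually (\<lambda>k. (\<integral>\<omega>. tail (real k) (B \<omega>) \<partial>Q) < \<eta> / 8) sequentially"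
    by (rule order_tendstoD(2)[OF tail_B_small]) (use eta in simp)
  then obtain c where c: "(\<integral>\<omega>. tail (real c) (B \<omega>) \<partial>Q) < \<eta> / 8" by (auto dest: eventually_happens)
  have \<psi>S: "(\<lambda>\<omega>. ?\<psi> (S (?inv k) (B \<omega>))) \<in> borel_measurable Q" for k
    by (rule measurable_compose[OF measurable_compose[OF B S_measurable] cts_step_borel[OF xy]]) simp
  have "(\<lambda>k. \<integral>\<omega>. ?\<psi> (S (?inv k) (B \<omega>)) \<partial>Q) \<longlonglongrightarrow> (\<integral>\<omega>. ?\<psi> (Rdot (B \<omega>)) \<partial>Q)"
  proof (rule integral_dominated_convergence[where w="\<lambda>_. 1"])
    show "(\<lambda>\<omega>. ?\<psi> (Rdot (B \<omega>))) \<in> borel_measurable Q"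
      by (rule measurable_compose[OF measurable_compose[OF B Rdot_measurable] cts_step_borel[OF xy]])
    show "AE \<omega> in Q. (\<lambda>k. ?\<psi> (S (?inv k) (B \<omega>))) \<longlonglongrightarrow> ?\<psi> (Rdot (B \<omega>))"
    proof (rule AE_I2)
      fix \<omega> assume "\<omega> \<in> space Q"
      have "isCont ?\<psi> z" for z
        using uniformly_continuous_imp_continuous[OF cts_step_uniformly_continuous[OF xy]]
        by (auto simp: continuous_on_eq_continuous_at)
      then show "(\<lambda>k. ?\<psi> (S (?inv k) (B \<omega>))) \<longlonglongrightarrow> ?\<psi> (Rdot (B \<omega>))"
        by (rule isCont_tendsto_compose[OF _ S_seq_tendsto_Rdot[OF B_D[OF \<open>\<omega> \<in> space Q\<close>]]])
    qed
    show "AE \<omega> in Q. norm (?\<psi> (S (?inv k) (B \<omega>))) \<le> 1" for k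
      using cts_step_bounds[of x y] by simp
  qed (use \<psi>S in auto)
  then have "eventually (\<lambda>k. (\<integral>\<omega>. ?\<psi> (Rdot (B \<omega>)) \<partial>Q) - \<eta> / 8 < (\<integral>\<omega>. ?\<psi> (S (?inv k) (B \<omega>)) \<partial>Q)) sequentially"
    by (rule order_tendstoD(1)) (use eta in simp)
  \<comment> \<open>The upper bound for \<open>T n\<close> works with one tolerance for all
    \<open>n\<close>; this one costs less than \<open>\<eta> / 8\<close> under the limit
    law.\<close>
  then obtain k where k: "(\<integral>\<omega>. ?\<psi> (Rdot (B \<omega>)) \<partial>Q) - \<eta> / 8 < (\<integral>\<omega>. ?\<psi> (S (?inv k) (B \<omega>)) \<partial>Q)"
    by (auto dest: eventually_happens)
  define \<epsilon> where "\<epsilon> = ?inv k"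
  have eps: "0 < \<epsilon>" by (simp add: \<epsilon>_def)
  \<comment> \<open>The ramp has Lipschitz constant \<open>1 / (y - x)\<close>, so a shift by
    \<open>e\<close> changes it by at most \<open>\<eta> / 8\<close>.\<close>
  define e where "e = \<eta> / 8 * (y - x)"
  have "y - x \<noteq> 0" using xy by simp
  then have e: "0 < e" "e / (y - x) = \<eta> / 8"
    unfolding e_def using eta xy by (simp, intro nonzero_mult_div_cancel_right)
  obtain r0 where r0: "0 < r0" and lower: "\<And>r F. r0 \<le> r \<Longrightarrow> F \<in> \<F> \<Longrightarrow> (\<lambda>x. F x - F0 x) \<in> D \<Longrightarrow>
    wnorm \<phi> (\<lambda>x. r * (F x - F0 x)) \<le> real c + 1 \<Longrightarrow> Rdot (\<lambda>x. r * (F x - F0 x)) - e \<le> r * (R F - R F0)"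
    by (rule quotient_ge_Rdot[OF e(1), of "real c + 1"]) (erule that, blast)
  \<comment> \<open>The summand 1 makes the smallness condition of \<open>quotient_le_S\<close>
    strict on the event of norm at most \<open>c + 1\<close>.\<close>
  have ev: "eventually (\<lambda>n. max r0 ((2 * (K * (real c + 1)) + 1) / \<epsilon>) \<le> r n) sequentially"
    using r_top unfolding filterlim_at_top by blast
  have S_lim: "(\<lambda>n. \<integral>\<omega>. ?\<psi> (S \<epsilon> (Y n \<omega>)) \<partial>M) \<longlonglongrightarrow> (\<integral>\<omega>. ?\<psi> (S \<epsilon> (B \<omega>)) \<partial>Q)"
    by (rule conv_cts_step_Lipschitz[OF xy S_measurable[OF eps] S_Lipschitz[OF _ _ eps]])
  have R_lim: "(\<lambda>n. \<integral>\<omega>. ?\<psi> (Rdot (Y n \<omega>)) \<partial>M) \<longlonglongrightarrow> (\<integral>\<omega>. ?\<psi> (Rdot (B \<omega>)) \<partial>Q)"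
    by (rule conv_cts_step_Lipschitz[OF xy Rdot_measurable Rdot_Lipschitz])
  have ev1: "eventually (\<lambda>n. (\<integral>\<omega>. ?\<psi> (S \<epsilon> (B \<omega>)) \<partial>Q) - \<eta> / 8 < (\<integral>\<omega>. ?\<psi> (S \<epsilon> (Y n \<omega>)) \<partial>M)) sequentially"
    by (rule order_tendstoD(1)[OF S_lim]) (use eta in simp)
  have ev2: "eventually (\<lambda>n. (\<integral>\<omega>. ?\<psi> (Rdot (Y n \<omega>)) \<partial>M) < (\<integral>\<omega>. ?\<psi> (Rdot (B \<omega>)) \<partial>Q) + \<eta> / 8) sequentially"
    by (rule order_tendstoD(2)[OF R_lim]) (use eta in simp)
  have ev3: "eventually (\<lambda>n. (\<integral>\<omega>. tail (real c) (Y n \<omega>) \<partial>M) < (\<integral>\<omega>. tail (real c) (B \<omega>) \<partial>Q) + \<eta> / 8) sequentially"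
    by (rule order_tendstoD(2)[OF conv_tail]) (use eta in simp)
  have "eventually (\<lambda>n. norm ((\<integral>\<omega>. ?\<psi> (T n \<omega>) \<partial>M) - (\<integral>\<omega>. ?\<psi> (Rdot (B \<omega>)) \<partial>Q)) < \<eta>) sequentially"
    using ev ev1 ev2 ev3
  proof eventually_elim
    case (elim n)
    have rn: "r0 \<le> r n" "2 * (K * (real c + 1)) + 1 \<le> r n * \<epsilon>"
      using elim(1) eps by (auto simp: pos_divide_le_eq)
    have small: "?\<psi> (S \<epsilon> (Y n \<omega>)) - tail (real c) (Y n \<omega>) \<le> ?\<psi> (T n \<omega>) \<and>
        ?\<psi> (T n \<omega>) \<le> ?\<psi> (Rdot (Y n \<omega>)) + \<eta> / 8 + tail (real c) (Y n \<omega>)"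
      if \<omega>: "\<omega> \<in> space M" for \<omega>
    proof (cases "wnorm \<phi> (Y n \<omega>) \<le> real c + 1")
      case True
      have "2 * (K * wnorm \<phi> (Y n \<omega>)) \<le> 2 * (K * (real c + 1))"
        using mult_left_mono[OF True K_nonneg] by simp
      then have "T n \<omega> \<le> S \<epsilon> (Y n \<omega>)"
        using rn(2) by (intro quotient_le_S r_pos Fhat[OF \<omega>] Fhat_D[OF \<omega>]) simp
      then have 1: "?\<psi> (S \<epsilon> (Y n \<omega>)) \<le> ?\<psi> (T n \<omega>)" by (rule cts_step_antimono[OF xy])
      have "Rdot (Y n \<omega>) - e \<le> T n \<omega>" by (rule lower[OF rn(1) Fhat[OF \<omega>] Fhat_D[OF \<omega>] True])
      then have "?\<psi> (T n \<omega>) \<le> ?\<psi> (Rdot (Y n \<omega>) - e)" by (rule cts_step_antimono[OF xy])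
      moreover have "\<bar>?\<psi> (Rdot (Y n \<omega>) - e) - ?\<psi> (Rdot (Y n \<omega>))\<bar> \<le> \<eta> / 8"
        using cts_step_Lipschitz[OF xy, of "Rdot (Y n \<omega>) - e" "Rdot (Y n \<omega>)"] e by simp
      ultimately show ?thesis using 1 tail_bounds[of "real c" "Y n \<omega>"] by linarith
    next
      case False
      then have "tail (real c) (Y n \<omega>) = 1" by (simp add: tail_def)
      then show ?thesis
        using cts_step_bounds[of x y "T n \<omega>"] cts_step_bounds[of x y "S \<epsilon> (Y n \<omega>)"]
          cts_step_bounds[of x y "Rdot (Y n \<omega>)"] eta by linarith
    qed
    have iT: "integrable M (\<lambda>\<omega>. ?\<psi> (T n \<omega>))"
      by (rule integrable_01[OF prob_space_axioms measurable_compose[OF T_measurable cts_step_borel[OF xy]]])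
        (rule cts_step_bounds)+
    have iS: "integrable M (\<lambda>\<omega>. ?\<psi> (S \<epsilon> (Y n \<omega>)))"
      by (rule integrable_01[OF prob_space_axioms measurable_compose[OF
            measurable_compose[OF Y_measurable S_measurable[OF eps]] cts_step_borel[OF xy]]])
        (rule cts_step_bounds)+
    have iR: "integrable M (\<lambda>\<omega>. ?\<psi> (Rdot (Y n \<omega>)))"
      by (rule integrable_01[OF prob_space_axioms measurable_compose[OF
            measurable_compose[OF Y_measurable Rdot_measurable] cts_step_borel[OF xy]]])
        (rule cts_step_bounds)+
    have it: "integrable M (\<lambda>\<omega>. tail (real c) (Y n \<omega>))"
      by (rule integrable_01[OF prob_space_axioms measurable_compose[OF Y_measurable tail_measurable]])
        (rule tail_bounds)+
    have "(\<integral>\<omega>. ?\<psi> (S \<epsilon> (Y n \<omega>)) \<partial>M) - (\<integral>\<omega>. tail (real c) (Y n \<omega>) \<partial>M) =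
        (\<integral>\<omega>. ?\<psi> (S \<epsilon> (Y n \<omega>)) - tail (real c) (Y n \<omega>) \<partial>M)"
      using iS it by simp
    also have "\<dots> \<le> (\<integral>\<omega>. ?\<psi> (T n \<omega>) \<partial>M)"
      using small by (intro integral_mono Bochner_Integration.integrable_diff iS it iT) blast
    finally have lo: "(\<integral>\<omega>. ?\<psi> (S \<epsilon> (Y n \<omega>)) \<partial>M) - (\<integral>\<omega>. tail (real c) (Y n \<omega>) \<partial>M) \<le> (\<integral>\<omega>. ?\<psi> (T n \<omega>) \<partial>M)" .
    have "(\<integral>\<omega>. ?\<psi> (T n \<omega>) \<partial>M) \<le> (\<integral>\<omega>. ?\<psi> (Rdot (Y n \<omega>)) + \<eta> / 8 + tail (real c) (Y n \<omega>) \<partial>M)"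
      using small by (intro integral_mono Bochner_Integration.integrable_add iR it iT integrable_const) blast
    also have "\<dots> = (\<integral>\<omega>. ?\<psi> (Rdot (Y n \<omega>)) \<partial>M) + \<eta> / 8 + (\<integral>\<omega>. tail (real c) (Y n \<omega>) \<partial>M)"
      using iR it by (simp add: prob_space)
    finally have hi: "(\<integral>\<omega>. ?\<psi> (T n \<omega>) \<partial>M) \<le>
        (\<integral>\<omega>. ?\<psi> (Rdot (Y n \<omega>)) \<partial>M) + \<eta> / 8 + (\<integral>\<omega>. tail (real c) (Y n \<omega>) \<partial>M)" .
    show ?case
      using lo hi elim(2-4) c k eta unfolding \<epsilon>_def[symmetric] real_norm_def by linarith
  qed
  then show "\<exists>no. \<forall>n\<ge>no. norm ((\<integral>\<omega>. ?\<psi> (T n \<omega>) \<partial>M) - (\<integral>\<omega>. ?\<psi> (Rdot (B \<omega>)) \<partial>Q)) < \<eta>"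
    by (simp add: eventually_sequentially)
qed

lemma risk_conv_in_distr: "conv_in_distr_real M T Q (\<lambda>\<omega>. Rdot (B \<omega>))"
proof -
  have RB: "(\<lambda>\<omega>. Rdot (B \<omega>)) \<in> borel_measurable Q" by (rule measurable_compose[OF B Rdot_measurable])
  interpret Q: prob_space Q by (rule Q)
  have "weak_conv_m (\<lambda>n. distr M borel (T n)) (distr Q borel (\<lambda>\<omega>. Rdot (B \<omega>)))"
  proof (rule integral_cts_step_conv_imp_weak_conv)
    show "real_distribution (distr M borel (T n))" for n
      by (rule real_distribution_distr[OF T_measurable])
    show "real_distribution (distr Q borel (\<lambda>\<omega>. Rdot (B \<omega>)))"
      by (rule Q.real_distribution_distr[OF RB])
    show "(\<lambda>n. integral\<^sup>L (distr M borel (T n)) (cts_step x y))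
        \<longlonglongrightarrow> integral\<^sup>L (distr Q borel (\<lambda>\<omega>. Rdot (B \<omega>))) (cts_step x y)" if "x < y" for x y
      using conv_cts_step[OF that]
      by (simp only: integral_distr[OF T_measurable cts_step_borel[OF that]]
          integral_distr[OF RB cts_step_borel[OF that]])
  qed
  then show ?thesis using T_measurable RB by (simp add: conv_in_distr_real_def)
qed

end

end

section \<open>Distortion functions on atomless spaces\<close>

context prob_space
begin

text \<open>Of the two pieces of an atomless splitting both are nonnull and one has at most half of
  the mass; iteration makes the mass arbitrarily small.\<close>

lemma atomless_small_subset:
  assumes "atomless M" and A: "A \<in> events" "0 < prob A" and e: "0 < e"
  obtains C where "C \<in> events" "C \<subseteq> A" "0 < prob C" "prob C < e"
proof -
  have halve: "\<exists>C\<in>events. C \<subseteq> A \<and> 0 < prob C \<and> prob C \<le> prob A / 2 ^ n" for n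
  proof (induction n)
    case 0
    then show ?case using A by auto
  next
    case (Suc n)
    then obtain C where C: "C \<in> events" "C \<subseteq> A" "0 < prob C" "prob C \<le> prob A / 2 ^ n" by blast
    obtain C' where C': "C' \<in> events" "C' \<subseteq> C" "0 < prob C'" "prob C' < prob C"
      using \<open>atomless M\<close> C unfolding atomless_def by blast
    have diff: "prob (C - C') = prob C - prob C'" using C C' by (intro finite_measure_Diff)
    have "prob C / 2 \<le> prob A / 2 ^ Suc n" using C(4) by simp
    then show ?case
    proof (cases "prob C' \<le> prob C / 2")
      case True
      with \<open>prob C / 2 \<le> _\<close> have "prob C' \<le> prob A / 2 ^ Suc n" by linarith
      then show ?thesis using C C' by blast
    next
      case False
      with \<open>prob C / 2 \<le> _\<close> diff have "prob (C - C') \<le> prob A / 2 ^ Suc n" by linarith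
      moreover have "0 < prob (C - C')" "C - C' \<in> events" using C C' diff by auto
      ultimately show ?thesis using C by blast
    qed
  qed
  have "(\<lambda>n. prob A * (1 / 2) ^ n) \<longlonglongrightarrow> prob A * 0"
    by (intro tendsto_mult_left LIMSEQ_power_zero) simp
  then have "eventually (\<lambda>n. prob A * (1 / 2) ^ n < e) sequentially"
    using e by (intro order_tendstoD(2)) auto
  then obtain n where "prob A * (1 / 2) ^ n < e" by (auto dest: eventually_happens)
  then have "prob A / 2 ^ n < e" by (simp add: power_one_over field_simps)
  then show thesis using halve[of n] that by (meson le_less_trans)
qed

text \<open>Greedy exhaustion: every step captures at least half of the largest admissible mass, so an
  admissible set disjoint from the limit would have to be null.\<close>

lemma atomless_prob_attained:
  assumes atomless: "atomless M" and t: "0 \<le> t" "t \<le> 1"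
  obtains A where "A \<in> events" "prob A = t"
proof -
  define P where "P A \<longleftrightarrow> A \<in> events \<and> prob A \<le> t" for A
  define adm where "adm A C \<longleftrightarrow> C \<in> events \<and> A \<inter> C = {} \<and> prob A + prob C \<le> t" for A C
  define step where "step A A' \<longleftrightarrow> A \<subseteq> A' \<and> (\<forall>C. adm A C \<longrightarrow> prob C \<le> 2 * (prob A' - prob A))" for A A'
  have "\<exists>A'. P A' \<and> step A A'" if A: "P A" for A
  proof -
    let ?S = "prob ` {C. adm A C}"
    have ne: "?S \<noteq> {}" using A by (auto simp: adm_def P_def intro!: exI[of _ "{}"])
    have bdd: "bdd_above ?S" by (rule bdd_aboveI2[where M=1]) simp
    have up: "prob C \<le> Sup ?S" if "adm A C" for C using that by (intro cSup_upper bdd) auto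
    show ?thesis
    proof (cases "Sup ?S \<le> 0")
      case True
      then have "step A A" using up by (force simp: step_def)
      with A show ?thesis by blast
    next
      case False
      then have "Sup ?S / 2 < Sup ?S" by simp
      then obtain C where C: "adm A C" "Sup ?S / 2 < prob C"
        using less_cSup_iff[OF ne bdd] by auto
      then have un: "prob (A \<union> C) = prob A + prob C"
        using A by (intro finite_measure_Union) (auto simp: P_def adm_def)
      have "step A (A \<union> C)" unfolding step_def un using C(2) up by fastforce
      moreover have "P (A \<union> C)" unfolding P_def un using A C(1) by (auto simp: P_def adm_def)
      ultimately show ?thesis by blast
    qed
  qed
  moreover have "P {}" using t by (simp add: P_def)
  ultimately obtain f where f: "\<And>n::nat. P (f n)" "\<And>n. step (f n) (f (Suc n))"
    using dependent_nat_choice[of "\<lambda>_. P" "\<lambda>_. step"] by blast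
  have ev: "f n \<in> events" for n using f(1) by (simp add: P_def)
  have inc: "incseq f" using f(2) by (intro incseq_SucI) (simp add: step_def)
  have lim: "(\<lambda>n. prob (f n)) \<longlonglongrightarrow> prob (\<Union>n. f n)"
    using ev by (intro finite_Lim_measure_incseq inc) auto
  have le: "prob (\<Union>n. f n) \<le> t"
    using f(1) by (intro LIMSEQ_le_const2[OF lim]) (auto simp: P_def)
  have U: "(\<Union>n. f n) \<in> events" using ev by blast
  have "prob (\<Union>n. f n) = t"
  proof (rule ccontr)
    assume "prob (\<Union>n. f n) \<noteq> t"
    with le have lt: "prob (\<Union>n. f n) < t" by simp
    have "0 < prob (space M - (\<Union>n. f n))" using prob_compl[OF U] lt t by simp
    then obtain C where C: "C \<in> events" "C \<subseteq> space M - (\<Union>n. f n)" "0 < prob C"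
        "prob C < t - prob (\<Union>n. f n)"
      using atomless_small_subset[OF atomless, of "space M - (\<Union>n. f n)" "t - prob (\<Union>n. f n)"] U lt
      by (metis diff_gt_0_iff_gt sets.compl_sets)
    \<comment> \<open>\<open>C\<close> avoids the whole union and fits into the mass missing in the
      limit, so it was admissible at every stage; yet the gains of the stages tend to zero.\<close>
    have "adm (f n) C" for n
    proof -
      have "prob (f n) \<le> prob (\<Union>n. f n)" using U by (intro finite_measure_mono) auto
      then show ?thesis using C by (auto simp: adm_def)
    qed
    then have "prob C \<le> 2 * (prob (f (Suc n)) - prob (f n))" for n
      using f(2) by (auto simp: step_def)
    moreover have "(\<lambda>n. 2 * (prob (f (Suc n)) - prob (f n))) \<longlonglongrightarrow> 2 * (prob (\<Union>n. f n) - prob (\<Union>n. f n))"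
      by (intro tendsto_mult_left tendsto_diff lim LIMSEQ_Suc)
    ultimately have "prob C \<le> 2 * (prob (\<Union>n. f n) - prob (\<Union>n. f n))"
      by (intro LIMSEQ_le_const) auto
    then show False using C(3) by simp
  qed
  then show thesis using that U by blast
qed

end

section \<open>Bernoulli variables and the associated distortion\<close>

lemma measure_bernoulli_pmf:
  assumes "0 \<le> t" "t \<le> 1"
  shows "measure (measure_pmf (bernoulli_pmf t)) A = of_bool (True \<in> A) * t + of_bool (False \<in> A) * (1 - t)"
proof -
  have "measure (measure_pmf (bernoulli_pmf t)) A = measure_pmf.expectation (bernoulli_pmf t) (indicator A)"
    by simp
  also have "\<dots> = indicator A True * t + indicator A False * (1 - t)"
    by (rule integral_bernoulli_pmf[OF assms])
  finally show ?thesis by (simp add: indicator_def)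
qed

lemma (in prob_space) bernoulli_indicator:
  assumes A: "A \<in> events"
  shows "distr M borel (indicator A) =
    distr (measure_pmf (bernoulli_pmf (prob A))) borel (of_bool :: bool \<Rightarrow> real)"
proof (rule measure_eqI)
  interpret D: prob_space "distr M borel (indicator A :: 'a \<Rightarrow> real)"
    by (rule prob_space_distr[OF borel_measurable_indicator[OF A]])
  have m: "(of_bool :: bool \<Rightarrow> real) \<in> measurable (measure_pmf (bernoulli_pmf (prob A))) borel" by simp
  interpret B: prob_space "distr (measure_pmf (bernoulli_pmf (prob A))) borel (of_bool :: bool \<Rightarrow> real)"
    by (rule measure_pmf.prob_space_distr[OF m])
  fix X :: "real set" assume "X \<in> sets (distr M borel (indicator A))"
  then have X: "X \<in> sets borel" by simp
  have "indicator A -` X \<inter> space M = (if 1 \<in> X then A else {}) \<union> (if 0 \<in> X then space M - A else {})"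
    using sets.sets_into_space[OF A] by (auto simp: indicator_def of_bool_def split: if_splits)
  then have "measure (distr M borel (indicator A)) X =
      of_bool (1 \<in> X) * prob A + of_bool (0 \<in> X) * (1 - prob A)"
    using A X prob_compl[OF A] finite_measure_Union[OF A, of "space M - A"]
    by (simp add: measure_distr)
  also have "\<dots> = measure (distr (measure_pmf (bernoulli_pmf (prob A))) borel of_bool) X"
    using measure_distr[OF m X] by (simp add: measure_bernoulli_pmf)
  finally show "emeasure (distr M borel (indicator A)) X =
      emeasure (distr (measure_pmf (bernoulli_pmf (prob A))) borel of_bool) X"
    by (simp add: D.emeasure_eq_measure B.emeasure_eq_measure)
qed simp

text \<open>\<open>B\<close> is given by its law only, hence the almost sure bound. The distribution
  function of \<open>- B\<close> equals \<open>t\<close> on \<open>[-1, 0)\<close>, an interval of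
  length one; it is 0 before and 1 after, where the integrals of \<open>g\<close> contribute
  nothing.\<close>

lemma (in prob_space) bernoulli_negative:
  assumes B: "B \<in> borel_measurable M" and t: "0 \<le> t" "t \<le> 1"
    and law: "distr M borel B = distr (measure_pmf (bernoulli_pmf t)) borel (of_bool :: bool \<Rightarrow> real)"
  shows "AE \<omega> in M. \<bar>- B \<omega>\<bar> \<le> 1"
    and "cc_distortion_function g \<Longrightarrow> distortion_risk_measure M g (\<lambda>\<omega>. - B \<omega>) = g t"
proof -
  have m: "(of_bool :: bool \<Rightarrow> real) \<in> measurable (measure_pmf (bernoulli_pmf t)) borel" by simp
  have law': "prob (B -` X \<inter> space M) = of_bool (1 \<in> X) * t + of_bool (0 \<in> X) * (1 - t)"
    if X: "X \<in> sets borel" for X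
    using measure_distr[OF B X] measure_distr[OF m X] law measure_bernoulli_pmf[OF t, of "of_bool -` X"] by simp
  have "prob (B -` {-1..1} \<inter> space M) = 1" by (subst law') auto
  then have "AE \<omega> in M. \<omega> \<in> B -` {-1..1} \<inter> space M" by (rule AE_prob_1)
  then show "AE \<omega> in M. \<bar>- B \<omega>\<bar> \<le> 1" by eventually_elim auto
  assume g: "cc_distortion_function g"
  note gD = cc_distortion_functionD[OF g]
  have F: "dist_fun M (\<lambda>\<omega>. - B \<omega>) x = of_bool (- 1 \<le> x) * t + of_bool (0 \<le> x) * (1 - t)" for x
  proof -
    have "{\<omega> \<in> space M. - B \<omega> \<le> x} = B -` {- x..} \<inter> space M" by auto
    then show ?thesis using B law'[of "{- x..}"] by (subst dist_fun_eq_prob) auto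
  qed
  have "(LBINT x:{..<0}. g (dist_fun M (\<lambda>\<omega>. - B \<omega>) x)) = (LBINT x:{-1..<0::real}. g t)"
    unfolding set_lebesgue_integral_def
    by (rule Bochner_Integration.integral_cong[OF refl]) (auto simp: F gD(2) indicator_def)
  also have "\<dots> = g t" by (simp add: set_lebesgue_integral_def)
  finally have 1: "(LBINT x:{..<0}. g (dist_fun M (\<lambda>\<omega>. - B \<omega>) x)) = g t" .
  have "(LBINT x:{0<..}. 1 - g (dist_fun M (\<lambda>\<omega>. - B \<omega>) x)) = (LBINT x:{0::real<..}. 0)"
    unfolding set_lebesgue_integral_def
    by (rule Bochner_Integration.integral_cong[OF refl]) (auto simp: F gD(3) indicator_def)
  then have 2: "(LBINT x:{0<..}. 1 - g (dist_fun M (\<lambda>\<omega>. - B \<omega>) x)) = 0" by (simp add: set_lebesgue_integral_def)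
  show "distortion_risk_measure M g (\<lambda>\<omega>. - B \<omega>) = g t"
    unfolding distortion_risk_measure_def 1 2 by simp
qed

text \<open>The definite description needs one value and one witness: every Bernoulli variable gives
  \<open>g t\<close>, and atomlessness supplies a set of probability \<open>t\<close>, whose
  indicator is such a variable. Outside \<open>{0..1}\<close> both sides are
  \<open>undefined\<close>.\<close>

lemma (in prob_space) assoc_distortion_distortion_risk_measure:
  assumes atomless: "atomless M" and model: "model_space M \<X>" and g: "cc_distortion_function g"
    and \<rho>: "\<And>X. X \<in> \<X> \<Longrightarrow> \<rho> X = distortion_risk_measure M g X"
  shows "assoc_distortion M \<rho> = g"
proof
  fix t
  show "assoc_distortion M \<rho> t = g t"
  proof (cases "t \<in> {0..1}")
    case True
    then have t: "0 \<le> t" "t \<le> 1" by auto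
    have val: "\<rho> (\<lambda>\<omega>. - B \<omega>) = g t" if B: "B \<in> borel_measurable M"
      and law: "distr M borel B = distr (measure_pmf (bernoulli_pmf t)) borel (of_bool :: bool \<Rightarrow> real)" for B
    proof -
      have "(\<lambda>\<omega>. - B \<omega>) \<in> borel_measurable M" using B by measurable
      moreover have "\<And>X. X \<in> borel_measurable M \<Longrightarrow> \<exists>c. AE \<omega> in M. \<bar>X \<omega>\<bar> \<le> c \<Longrightarrow> X \<in> \<X>"
        using model by (simp add: model_space_def)
      ultimately have "(\<lambda>\<omega>. - B \<omega>) \<in> \<X>"
        using bernoulli_negative(1)[OF B t law] by blast
      then show ?thesis using \<rho> bernoulli_negative(2)[OF B t law g] by simp
    qed
    obtain A where A: "A \<in> events" "prob A = t" by (rule atomless_prob_attained[OF atomless t])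
    have ind: "(indicator A :: 'a \<Rightarrow> real) \<in> borel_measurable M" using A(1) by measurable
    have "(THE r. \<exists>B\<in>borel_measurable M. distr M borel B =
        distr (measure_pmf (bernoulli_pmf t)) borel (of_bool :: bool \<Rightarrow> real) \<and> \<rho> (\<lambda>\<omega>. - B \<omega>) = r) = g t"
    proof (rule the_equality)
      show "\<exists>B\<in>borel_measurable M. distr M borel B =
        distr (measure_pmf (bernoulli_pmf t)) borel (of_bool :: bool \<Rightarrow> real) \<and> \<rho> (\<lambda>\<omega>. - B \<omega>) = g t"
        using bernoulli_indicator[OF A(1)] val[OF ind] A(2) ind by blast
    qed (use val in blast)
    then show ?thesis using True by (simp add: assoc_distortion_def)
  next
    case False
    then have "g t = undefined"
      using g by (auto simp: cc_distortion_function_def distortion_function_def PiE_def extensional_def)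
    then show ?thesis using False unfolding assoc_distortion_def restrict_def by (simp only: if_False)
  qed
qed

text \<open>In a one-point subspace every subset is open and every map continuous; the derivative
  bound holds because \<open>g t / t\<close> is nonincreasing.\<close>

lemma (in prob_space) representing_set_singleton:
  assumes atomless: "atomless M" and model: "model_space M \<X>" and g: "cc_distortion_function g"
    and adm: "\<And>X. X \<in> \<X> \<Longrightarrow> distortion_admissible M g X"
    and \<rho>: "\<And>X. X \<in> \<X> \<Longrightarrow> \<rho> X = distortion_risk_measure M g X"
  shows "representing_set M \<X> \<rho> {g}"
proof -
  have assoc: "assoc_distortion M \<rho> = g"
    by (rule assoc_distortion_distortion_risk_measure[OF atomless model g]) (rule \<rho>)
  have top: "g \<in> topspace uniform_topology"
    using compactin_subset_topspace[OF compactin_uniform_singleton[OF g]] by simp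
  have deriv: "right_deriv g t \<le> g (\<gamma> * t) / (\<gamma> * t)" if "0 < \<gamma>" "\<gamma> < 1" "0 < t" "t < 1" for \<gamma> t
  proof -
    have "right_deriv g t \<le> g t / t" by (rule cc_distortion_right_deriv_bounds(2)[OF g that(3,4)])
    also have "\<dots> \<le> g (\<gamma> * t) / (\<gamma> * t)"
      using cc_distortion_le_scaled[OF g, of \<gamma> t] that by (simp add: field_simps)
    finally show ?thesis .
  qed
  have op: "openin (subtopology uniform_topology {g}) {h \<in> {g}. P h}" for P
  proof (cases "P g")
    case True
    then have "{h \<in> {g}. P h} = {g}" by auto
    then show ?thesis using top by (simp add: openin_subtopology_refl)
  next
    case False
    then have eq: "{h \<in> {g}. P h} = {}" by auto
    show ?thesis unfolding eq by (rule openin_empty)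
  qed
  have cont: "continuous_map (subtopology uniform_topology {g}) euclideanreal f" for f
    by (rule continuous_map_eq[of _ _ "\<lambda>_. f g"]) auto
  show ?thesis
    unfolding representing_set_def assoc
    using g adm \<rho> deriv op cont compactin_uniform_singleton[OF g] by simp
qed

text \<open>A positive derivative makes \<open>F\<close> strictly increasing at each point of
  \<open>S - D\<close>, hence injective there, so the countably many kinks of \<open>h\<close> have
  countably many preimages; \<open>D\<close> adds finitely many points.\<close>

lemma countable_kink_preimage:
  fixes F :: "real \<Rightarrow> real"
  assumes F: "mono F" and h: "concave_on {0..1} h" and fin: "finite D"
    and deriv: "\<And>x. x \<in> S - D \<Longrightarrow> (F has_real_derivative f x) (at x)" "\<And>x. x \<in> S - D \<Longrightarrow> 0 < f x"
    and rng: "\<And>x. x \<in> S \<Longrightarrow> F x \<in> {0<..<1}"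
  shows "countable {x \<in> S. \<not> kink_free h (F x)}"
proof -
  have less: "F x < F y" if x: "x \<in> S - D" and "x < y" for x y
  proof -
    obtain d where d: "0 < d" "\<And>e. 0 < e \<Longrightarrow> e < d \<Longrightarrow> F x < F (x + e)"
      using has_real_derivative_pos_inc_right[OF deriv[OF x]] by auto
    define e where "e = min (d / 2) (y - x)"
    have "F x < F (x + e)" using d \<open>x < y\<close> by (auto simp: e_def)
    also have "\<dots> \<le> F y" by (rule monoD[OF F]) (simp add: e_def)
    finally show ?thesis .
  qed
  let ?A = "{x \<in> S - D. \<not> kink_free h (F x)}"
  have "inj_on F ?A"
    using less by (intro linorder_inj_onI') (auto, fastforce)
  moreover have "F ` ?A \<subseteq> {t \<in> {0<..<1}. \<not> kink_free h t}" using rng by auto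
  then have "countable (F ` ?A)" using countable_kinks[OF h] by (rule countable_subset)
  ultimately have "countable ?A" by (simp add: countable_image_inj_eq)
  then have "countable (?A \<union> D)" using fin by (simp add: countable_finite)
  then show ?thesis by (rule countable_subset[rotated]) auto
qed

section \<open>The functional delta method\<close>

text \<open>The limit variable may live on its own probability space \<open>N\<close>. As
  \<open>SUP\<close>, \<open>Lim\<close> and the integrals are total functions, the first conjunct
  certifies their intended meaning; the last one covers the sufficient condition named as an
  example.\<close>

theorem theorem3p1:
  fixes M :: "'a measure" and \<X> :: "('a \<Rightarrow> real) set" and \<rho> :: "('a \<Rightarrow> real) \<Rightarrow> real"
    and F0 \<phi> :: "real \<Rightarrow> real" and \<G> :: "(real \<Rightarrow> real) set"
    and Fhat :: "nat \<Rightarrow> 'a \<Rightarrow> real \<Rightarrow> real"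
    and N :: "'b measure" and B :: "'b \<Rightarrow> real \<Rightarrow> real" and C :: "(real \<Rightarrow> real) set"
    and r :: "nat \<Rightarrow> real"
  defines "a \<equiv> right_quantile F0 0" and "b \<equiv> left_quantile F0 1"
    and "g\<rho> \<equiv> assoc_distortion M \<rho>"
  assumes "prob_space M" and "atomless M" and "model_space M \<X>"
    and "F0 \<in> dist_funs M \<X>" and "weight_function \<phi>"
    and A_or_B:
      "(stonean_lattice \<X> \<and> coherent_risk_measure M \<X> \<rho> \<and> law_invariant M \<X> \<rho> \<and>
        (\<forall>X\<in>\<X>. (AE \<omega> in M. 0 \<le> X \<omega>) \<longrightarrow>
           (\<lambda>k::nat. \<rho> (\<lambda>\<omega>. - max (X \<omega> - real k) 0)) \<longlonglongrightarrow> 0) \<and>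
        (g\<rho> \<longlongrightarrow> 0) (at_right 0) \<and>
        (\<exists>D f. finite D \<and> continuous_on (einterval a b - D) f \<and>
           (\<forall>x\<in>einterval a b - D. (F0 has_real_derivative f x) (at x) \<and> 0 < f x)) \<and>
        (\<exists>\<gamma>\<in>{0<..<1}. set_integrable lborel (einterval a b)
           (\<lambda>x. g\<rho> (\<gamma> * F0 x) / (F0 x * \<phi> x))) \<and>
        representing_set M \<X> \<rho> \<G>)
       \<or>
       (\<exists>g. cc_distortion_function g \<and>
        (\<forall>X\<in>\<X>. distortion_admissible M g X \<and> \<rho> X = distortion_risk_measure M g X) \<and>
        {x\<in>einterval a b. \<not> g differentiable (at (F0 x))} \<in> null_sets lebesgue \<and>
        (\<exists>\<gamma>\<in>{0<..<1}. set_integrable lborel (einterval a b)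
           (\<lambda>x. g (\<gamma> * F0 x) / (F0 x * \<phi> x))) \<and>
        \<G> = {g})"
    and "\<And>n \<omega>. \<omega> \<in> space M \<Longrightarrow> Fhat n \<omega> \<in> dist_funs M \<X>"
    and "\<And>n. Fhat n \<in> measurable M D_algebra"
    and "\<And>n \<omega>. \<omega> \<in> space M \<Longrightarrow> (\<lambda>x. Fhat n \<omega> x - F0 x) \<in> D_weighted_on \<phi> F0"
    and "prob_space N" and "B \<in> measurable N (D_weighted_algebra \<phi> F0)"
    and "C \<subseteq> C_weighted_on \<phi> F0" and "C \<in> sets (D_weighted_algebra \<phi> F0)"
    and "separable_space (subtopology (D_weighted_topology \<phi> F0) C)"
    and "measure N {\<omega>\<in>space N. B \<omega> \<in> C} = 1"
    and "incseq r" and "\<And>n. 0 < r n" and "filterlim r at_top sequentially"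
    and "conv_in_distr_D \<phi> F0 M (\<lambda>n \<omega> x. r n * (Fhat n \<omega> x - F0 x)) N B"
  shows
    (* the integrals, suprema and the limit that define the derivative exist *)
    "(\<forall>v\<in>C_weighted_on \<phi> F0.
       (\<forall>h\<in>\<G>. interval_lebesgue_integrable lborel a b (\<lambda>x. right_deriv h (F0 x) * v x)) \<and>
       bdd_above ((\<lambda>h. deriv_integral F0 h v) ` \<G>) \<and>
       (\<forall>\<epsilon>>0. near_optimal M \<X> \<rho> \<G> F0 \<epsilon> \<noteq> {}) \<and>
       ((\<lambda>\<epsilon>. SUP h\<in>near_optimal M \<X> \<rho> \<G> F0 \<epsilon>. deriv_integral F0 h v)
          \<longlongrightarrow> risk_derivative M \<X> \<rho> \<G> F0 v) (at_right 0)) \<and>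
     conv_in_distr_real M
       (\<lambda>n \<omega>. r n * (risk_functional M \<X> \<rho> (Fhat n \<omega>) - risk_functional M \<X> \<rho> F0))
       N (\<lambda>\<omega>. risk_derivative M \<X> \<rho> \<G> F0 (B \<omega>)) \<and>
     ((\<exists>\<delta>\<in>{0<..<1}. set_integrable lborel {..<0} (\<lambda>x. g\<rho> (\<delta> * F0 x))) \<longrightarrow>
       optimal M \<X> \<rho> \<G> F0 \<noteq> {} \<and>
       (\<forall>v\<in>C_weighted_on \<phi> F0.
          risk_derivative M \<X> \<rho> \<G> F0 v = (SUP h\<in>optimal M \<X> \<rho> \<G> F0. deriv_integral F0 h v))) \<and>
     (bounded ((\<lambda>x. F0 x * \<phi> x) ` {..<0}) \<longrightarrow>
       (\<exists>\<delta>\<in>{0<..<1}. set_integrable lborel {..<0} (\<lambda>x. g\<rho> (\<delta> * F0 x))))"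
proof -
  have r_pos: "0 < r n" for n by fact
  have inner: "einterval a b = einterval (right_quantile F0 0) (left_quantile F0 1)"
    by (simp add: a_def b_def)
  interpret prob_space M by fact
  \<comment> \<open>Here the two cases merge: (A) yields absence of kinks almost everywhere by
    countability, (B) by differentiability off a null set.\<close>
  have "\<exists>\<gamma>. risk_setting M \<X> \<rho> \<G> F0 \<phi> \<gamma>"
    using A_or_B
  proof (elim disjE exE conjE bexE)
    fix D f \<gamma>
    assume D: "finite D" and f: "\<forall>x\<in>einterval a b - D. (F0 has_real_derivative f x) (at x) \<and> 0 < f x"
      and \<gamma>: "\<gamma> \<in> {0<..<1}" "set_integrable lborel (einterval a b) (\<lambda>x. g\<rho> (\<gamma> * F0 x) / (F0 x * \<phi> x))"
      and rep: "representing_set M \<X> \<rho> \<G>"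
    obtain X where X: "X \<in> \<X>" "F0 = dist_fun M X"
      using \<open>F0 \<in> dist_funs M \<X>\<close> by (auto simp: dist_funs_def)
    then have mono: "mono F0"
      using \<open>model_space M \<X>\<close> by (auto simp: model_space_def intro: dist_fun_props(1))
    have "AE x in lborel. x \<in> einterval a b \<longrightarrow> kink_free h (F0 x)" if "h \<in> \<G>" for h
    proof -
      have "cc_distortion_function h" using rep that by (simp add: representing_set_def)
      then have "countable {x \<in> einterval a b. \<not> kink_free h (F0 x)}"
        using f quantile_interval_range[OF mono] unfolding inner
        by (intro countable_kink_preimage[OF mono cc_distortion_functionD(1) D, where f=f]) auto
      from AE_not_in[OF countable_imp_null_set_lborel[OF this]] show ?thesis by eventually_elim auto
    qed
    then have "risk_setting M \<X> \<rho> \<G> F0 \<phi> \<gamma>"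
      using \<gamma> rep \<open>model_space M \<X>\<close> \<open>F0 \<in> dist_funs M \<X>\<close> \<open>weight_function \<phi>\<close> unfolding inner g\<rho>_def
      by unfold_locales auto
    then show ?thesis by blast
  next
    fix g \<gamma>
    assume g: "cc_distortion_function g"
      and dist: "\<forall>X\<in>\<X>. distortion_admissible M g X \<and> \<rho> X = distortion_risk_measure M g X"
      and null: "{x \<in> einterval a b. \<not> g differentiable (at (F0 x))} \<in> null_sets lebesgue"
      and \<gamma>: "\<gamma> \<in> {0<..<1}" "set_integrable lborel (einterval a b) (\<lambda>x. g (\<gamma> * F0 x) / (F0 x * \<phi> x))"
      and \<G>: "\<G> = {g}"
    have rep: "representing_set M \<X> \<rho> {g}"
      using dist by (intro representing_set_singleton \<open>atomless M\<close> \<open>model_space M \<X>\<close> g) auto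
    have assoc: "assoc_distortion M \<rho> = g"
      by (rule assoc_distortion_distortion_risk_measure[OF \<open>atomless M\<close> \<open>model_space M \<X>\<close> g])
        (use dist in auto)
    \<comment> \<open>The null set is Lebesgue but perhaps not Borel measurable, so the passage to
      \<open>lborel\<close> goes through the completion.\<close>
    have "AE x in lebesgue. x \<in> einterval a b \<longrightarrow> kink_free g (F0 x)"
      using AE_not_in[OF null] by eventually_elim (auto intro: differentiable_imp_kink_free)
    then have "AE x in lborel. x \<in> einterval a b \<longrightarrow> kink_free g (F0 x)"
      by (simp only: AE_completion_iff)
    then have "risk_setting M \<X> \<rho> \<G> F0 \<phi> \<gamma>"
      using \<gamma> rep \<open>model_space M \<X>\<close> \<open>F0 \<in> dist_funs M \<X>\<close> \<open>weight_function \<phi>\<close> unfolding inner \<G>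
      by unfold_locales (auto simp: assoc)
    then show ?thesis by blast
  qed
  then obtain \<gamma> where "risk_setting M \<X> \<rho> \<G> F0 \<phi> \<gamma>" by blast
  then interpret S: risk_setting M \<X> \<rho> \<G> F0 \<phi> \<gamma> .
  have CD: "v \<in> D_weighted_on \<phi> F0" if "v \<in> C_weighted_on \<phi> F0" for v
    using that by (simp add: C_weighted_on_def)
  have integrable: "interval_lebesgue_integrable lborel a b (\<lambda>x. right_deriv h (F0 x) * v x)"
    if "h \<in> \<G>" "v \<in> C_weighted_on \<phi> F0" for h v
    using S.integrand_integrable[OF that(1) CD[OF that(2)]] S.quantiles_le
    by (simp add: interval_lebesgue_integrable_def a_def b_def)
  have conv: "conv_in_distr_real M
      (\<lambda>n \<omega>. r n * (risk_functional M \<X> \<rho> (Fhat n \<omega>) - risk_functional M \<X> \<rho> F0))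
      N (\<lambda>\<omega>. risk_derivative M \<X> \<rho> \<G> F0 (B \<omega>))"
    by (rule S.risk_conv_in_distr; fact)
  have optimal: "optimal M \<X> \<rho> \<G> F0 \<noteq> {} \<and> (\<forall>v\<in>C_weighted_on \<phi> F0.
      risk_derivative M \<X> \<rho> \<G> F0 v = (SUP h\<in>optimal M \<X> \<rho> \<G> F0. deriv_integral F0 h v))"
    if ex: "\<exists>\<delta>\<in>{0<..<1}. set_integrable lborel {..<0} (\<lambda>x. g\<rho> (\<delta> * F0 x))"
  proof -
    obtain \<delta> where "0 < \<delta>" "\<delta> < 1" "set_integrable lborel {..<0} (\<lambda>x. assoc_distortion M \<rho> (\<delta> * F0 x))"
      using ex by (auto simp: g\<rho>_def)
    from S.optimal_derivative[OF S.integrable_imp_continuous[OF this]] CD show ?thesis by blast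
  qed
  have bounded: "\<exists>\<delta>\<in>{0<..<1}. set_integrable lborel {..<0} (\<lambda>x. g\<rho> (\<delta> * F0 x))"
    if "bounded ((\<lambda>x. F0 x * \<phi> x) ` {..<0})"
    using S.bounded_imp_integrable[OF that] S.gamma unfolding g\<rho>_def by auto
  have exist: "\<forall>v\<in>C_weighted_on \<phi> F0.
      (\<forall>h\<in>\<G>. interval_lebesgue_integrable lborel a b (\<lambda>x. right_deriv h (F0 x) * v x)) \<and>
      bdd_above ((\<lambda>h. deriv_integral F0 h v) ` \<G>) \<and>
      (\<forall>\<epsilon>>0. near_optimal M \<X> \<rho> \<G> F0 \<epsilon> \<noteq> {}) \<and>
      ((\<lambda>\<epsilon>. SUP h\<in>near_optimal M \<X> \<rho> \<G> F0 \<epsilon>. deriv_integral F0 h v)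
        \<longlongrightarrow> risk_derivative M \<X> \<rho> \<G> F0 v) (at_right 0)"
    by (intro conjI ballI allI impI integrable S.bdd_above_L S.near_optimal_nonempty S.S_tendsto_Rdot
        CD order_refl)
  show ?thesis
    by (rule conjI[OF exist conjI[OF conv conjI[OF impI[OF optimal] impI[OF bounded]]]])
qed

end
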